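(* Consider the model, null hypothesis $H_0$, local alternatives $H_1^{(n)}$, log-likelihood ratio $\Lambda_{n,h,h'}$ and assumptions $(A_1)$, $(A_2)$, $(A_3)$ described in the context, with fixed $h,h'\in\mathbb{R}$, $hh'\neq 0$. Put $$\mathcal{V}_{n,h,h'}=-n^{-1/2}\sum_{i=1}^{n}\Big\{h\,M_f(\epsilon_i)\frac{G(Z_i)}{\sigma(\theta_0,Z_i)}+h'\big(1+\epsilon_iM_f(\epsilon_i)\big)\frac{S(Z_i)}{\sigma(\theta_0,Z_i)}\Big\},$$ $I_j=\mathbf{E}\big(\epsilon_0^j M_f^2(\epsilon_0)\big)$ for $j\in\{0,1,2\}$, and $$\tau^2_{h,h'}=h^2 I_0\,\mathbf{E}\Big(\frac{G(Z_0)}{\sigma(\theta_0,Z_0)}\Big)^2+h'^2(I_2-1)\,\mathbf{E}\Big(\frac{S(Z_0)}{\sigma(\theta_0,Z_0)}\Big)^2+2hh'I_1\,\mathbf{E}\Big(\frac{G(Z_0)S(Z_0)}{\sigma^2(\theta_0,Z_0)}\Big).$$ Then, under $H_0$, as $n\to\infty$, $$\Lambda_{n,h,h'}=\mathcal{V}_{n,h,h'}-\frac{\tau^2_{h,h'}}{2}+o_P(1),\qquad \mathcal{V}_{n,h,h'}\xrightarrow{\ \mathcal{D}\ }\mathcal{N}(0,\tau^2_{h,h'}).$$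
   Context: **Model.** $\{(Y_i,X_i)\}$ is a stationary ergodic sequence of random vectors with finite second and third moments, $Y_i$ real-valued and $X_i$ $\mathbb{R}^d$-valued. For fixed nonnegative integers $s,q$, $Z_i=(Y_{i-1},\dots,Y_{i-s},X_i,X_{i-1},\dots,X_{i-q})$. The $\epsilon_i$ are i.i.d., centred, with unit variance and a known positive density $f$, and $\epsilon_i$ is independent of $\mathcal{F}_i=\sigma(Z_j,\ j\le i)$. The functions $m(\rho,\cdot)$ and $\sigma(\theta,\cdot)>0$ are of known form, with $\rho\in\Theta_1\subset\mathbb{R}^\ell$, $\theta\in\Theta_2\subset\mathbb{R}^p$ (both with nonempty interior); $(\rho_0,\theta_0)\in\Theta_1\times\Theta_2$; $G,S$ are specified real-valued functions. Null hypothesis $H_0$: $Y_i=m(\rho_0,Z_i)+\sigma(\theta_0,Z_i)\epsilon_i$. Alternative $H_1^{(n)}$: $Y_i=m(\rho_0,Z_i)+h n^{-1/2}G(Z_i)+\big(\sigma(\theta_0,Z_i)+h' n^{-1/2}S(Z_i)\big)\epsilon_i$, where the perturbed scale is positive. All expectations $\mathbf{E}$ and stochastic orders $o_P(1)$ are under $H_0$. **Log-likelihood ratio.** Let $F(x;a,b)=\frac1b f\big(\frac{x-a}{b}\big)$ for $|a|<\infty$, $0<b<\infty$. The log-likelihood ratio of $H_1^{(n)}$ to $H_0$ is $\Lambda_{n,h,h'}=\sum_{i=1}^n\log g_{n,i,h,h'}$, where, under $H_0$, $$g_{n,i,h,h'}=\frac{F(\epsilon_i;\alpha_{n,i},\beta_{n,i})}{f(\epsilon_i)},\quad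 \alpha_{n,i}=hn^{-1/2}\frac{G(Z_i)}{\sigma(\theta_0,Z_i)},\quad \beta_{n,i}=1+h'n^{-1/2}\frac{S(Z_i)}{\sigma(\theta_0,Z_i)}.$$ **Notation.** $M_f=\dot f/f$, assumed differentiable with derivative $\dot M_f$. **Assumption $(A_1)$.** Below $j,k$ are nonnegative integers with $j+k=2$. - $(A_{1.1})$ There are a positive measurable function $\varphi$, a real $p>1$ with $\mathbf{E}(\varphi^p(\epsilon_0))<\infty$, and $\varsigma>0$ such that $\Big|\frac{1}{f(x)}\frac{\partial^2F(x;a,b)}{\partial a^j\partial b^k}\Big|\le\varphi(x)$ whenever $\max(|a|,|b-1|)<\varsigma$. - $(A_{1.2})$ There are positive functions $V_1,V_2$ such that $\Big|\frac{\partial^2F(x;a,b)}{\partial a^j\partial b^k}-\frac{\partial^2F(x;a',b)}{\partial a^j\partial b^k}\Big|\le V_1(x;a^\star,b)|a-a'|$ and $\Big|\frac{\partial^2F(x;a,b)}{\partial a^j\partial b^k}-\frac{\partial^2F(x;a,b')}{\partial a^j\partial b^k}\Big|\le V_2(x;a,b^\star)|b-b'|$ for some $a^\star$ between $a,a'$ and $b^\star$ between $b,b'$; and there are a positive measurable function $\phi$ with $\mathbf{E}(\phi(\epsilon_0))<\infty$ and $\varsigma'>0$ such that $|V_i(x;\alpha,\beta)/f(x)|\le\phi(x)$, $i=1,2$, whenever $\max(|\alpha|,|\beta-1|)<\varsigma'$. **Assumption $(A_2)$.** $\mathbf{E}\{M_f(\epsilon_0)\}=0$; $\mathbf{E}\{\epsilon_0M_f(\epsilon_0)\}=-1$;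 $\mathbf{E}\{\dot M_f(\epsilon_0)+M_f^2(\epsilon_0)\}=0$; $\mathbf{E}\{\epsilon_0(\dot M_f(\epsilon_0)+M_f^2(\epsilon_0))\}=0$; $\mathbf{E}\{\epsilon_0^2(\dot M_f(\epsilon_0)+M_f^2(\epsilon_0))\}=2$. **Assumption $(A_3)$.** There is $\lambda>0$ such that the following are all finite: $\mathbf{E}|G(Z_0)/\sigma(\theta_0,Z_0)|^{\lambda+2}$, $\mathbf{E}|S(Z_0)/\sigma(\theta_0,Z_0)|^{\lambda+2}$, $\mathbf{E}|M_f(\epsilon_0)|^{\lambda+2}$, $\mathbf{E}|\epsilon_0M_f(\epsilon_0)|^{\lambda+2}$, $\mathbf{E}|\dot M_f(\epsilon_0)|^{\lambda+2}$, $\mathbf{E}|\epsilon_0\dot M_f(\epsilon_0)|^{\lambda+2}$, $\mathbf{E}|\epsilon_0|^{2\lambda+4}$, $\mathbf{E}|\epsilon_0^2M_f(\epsilon_0)|^{\lambda+2}$.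
   Formalization: For s = 0 the statement as written is false; in that case only, ε_i is assumed independent of σ(Z_j, j ≤ i; ε_j, j < i) rather than just of F_i = σ(Z_j, j ≤ i). For s ≥ 1 the independence assumption is as stated. *)

theory Defs
  imports "HOL-Probability.Probability"
begin

section \<open>Stationary ergodic processes and information\<close>

definition path_shift :: "(int \<Rightarrow> 'v) \<Rightarrow> int \<Rightarrow> 'v" where
  "path_shift x = (\<lambda>i. x (i + 1))"

definition stationary_process :: "'w measure \<Rightarrow> 'v measure \<Rightarrow> (int \<Rightarrow> 'w \<Rightarrow> 'v) \<Rightarrow> bool" where
  "stationary_process M N W \<longleftrightarrow>
     (\<forall>i. W i \<in> measurable M N) \<and>
     distr M (PiM UNIV (\<lambda>_. N)) (\<lambda>\<omega>. path_shift (\<lambda>i. W i \<omega>))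
       = distr M (PiM UNIV (\<lambda>_. N)) (\<lambda>\<omega> i. W i \<omega>)"

definition ergodic_process :: "'w measure \<Rightarrow> 'v measure \<Rightarrow> (int \<Rightarrow> 'w \<Rightarrow> 'v) \<Rightarrow> bool" where
  "ergodic_process M N W \<longleftrightarrow>
     (\<forall>i. W i \<in> measurable M N) \<and>
     (\<forall>A \<in> sets (PiM UNIV (\<lambda>_::int. N)).
        path_shift -` A \<inter> space (PiM UNIV (\<lambda>_::int. N)) = A \<longrightarrow>
        measure M {\<omega> \<in> space M. (\<lambda>i. W i \<omega>) \<in> A} \<in> {0, 1})"

definition sigma_past :: "'w measure \<Rightarrow> 'z measure \<Rightarrow> (int \<Rightarrow> 'w \<Rightarrow> 'z) \<Rightarrow> int \<Rightarrow> 'w set set" where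
  "sigma_past M N Z i = sigma_sets (space M)
     (\<Union>j\<in>{..i}. {Z j -` A \<inter> space M | A. A \<in> sets N})"

text \<open>The \<open>\<sigma>\<close>-field generated by \<open>Z j\<close> for \<open>j \<le> i\<close> and \<open>\<epsilon> j\<close> for \<open>j < i\<close>. When \<open>Z j\<close> has the
  component \<open>Y (j - 1)\<close>, this is \<open>sigma_past\<close> again up to null sets, because
  \<open>\<epsilon> j = (Y j - m (Z j)) / \<sigma> (Z j)\<close> almost surely. It is larger when \<open>Z\<close> has no lagged response.\<close>

definition sigma_past_innov ::
  "'w measure \<Rightarrow> 'z measure \<Rightarrow> (int \<Rightarrow> 'w \<Rightarrow> 'z) \<Rightarrow> (int \<Rightarrow> 'w \<Rightarrow> real) \<Rightarrow> int \<Rightarrow> 'w set set" where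
  "sigma_past_innov M N Z \<epsilon> i = sigma_sets (space M)
     ((\<Union>j\<in>{..i}. {Z j -` A \<inter> space M | A. A \<in> sets N})
      \<union> (\<Union>j\<in>{..<i}. {\<epsilon> j -` B \<inter> space M | B. B \<in> sets borel}))"

definition sigma_rv :: "'w measure \<Rightarrow> ('w \<Rightarrow> real) \<Rightarrow> 'w set set" where
  "sigma_rv M e = {e -` B \<inter> space M | B. B \<in> sets borel}"

section \<open>Regressors\<close>

text \<open>A value of \<open>Z i = (Y (i-1), ..., Y (i-s), X i, ..., X (i-q))\<close> is a pair of tuples indexed by
  \<open>{1..s}\<close> and \<open>{0..q}\<close>. Index sets, unlike index types, allow \<open>s = 0\<close>.\<close>

type_synonym 'd regr = "(nat \<Rightarrow> real) \<times> (nat \<Rightarrow> real ^ 'd)"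

definition regr_space :: "nat \<Rightarrow> nat \<Rightarrow> ('d::finite) regr measure" where
  "regr_space s q = PiM {1..s} (\<lambda>_. borel) \<Otimes>\<^sub>M PiM {0..q} (\<lambda>_. borel)"

definition regressor ::
  "nat \<Rightarrow> nat \<Rightarrow> (int \<Rightarrow> 'w \<Rightarrow> real) \<Rightarrow> (int \<Rightarrow> 'w \<Rightarrow> real ^ 'd) \<Rightarrow> int \<Rightarrow> 'w \<Rightarrow> ('d::finite) regr" where
  "regressor s q Y X i \<omega> =
     (\<lambda>k\<in>{1..s}. Y (i - int k) \<omega>, \<lambda>k\<in>{0..q}. X (i - int k) \<omega>)"

section \<open>The location-scale family and the assumptions\<close>

definition loc_scale :: "(real \<Rightarrow> real) \<Rightarrow> real \<Rightarrow> real \<Rightarrow> real \<Rightarrow> real" where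
  "loc_scale f x a b = (1 / b) * f ((x - a) / b)"

text \<open>\<open>\<partial>\<^sup>j\<^sup>+\<^sup>k F(x; a, b) / \<partial>a\<^sup>j \<partial>b\<^sup>k\<close> for \<open>F = loc_scale f\<close>; all the derivatives of total order
  at most two exist for \<open>b > 0\<close> when \<open>f\<close> and \<open>score f\<close> are differentiable.\<close>

definition dF :: "(real \<Rightarrow> real) \<Rightarrow> nat \<Rightarrow> nat \<Rightarrow> real \<Rightarrow> real \<Rightarrow> real \<Rightarrow> real" where
  "dF f j k x a b = (deriv ^^ j) (\<lambda>a'. (deriv ^^ k) (\<lambda>b'. loc_scale f x a' b') b) a"

definition score :: "(real \<Rightarrow> real) \<Rightarrow> real \<Rightarrow> real" where
  "score f x = deriv f x / f x"

text \<open>In the assumptions below, \<open>e\<close> is the innovation \<open>\<epsilon> 0\<close> and \<open>Z0\<close> is \<open>Z 0\<close>. The family is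
  only considered for scales \<open>b > 0\<close>, also when the radius of the neighbourhood of \<open>(0, 1)\<close>
  exceeds 1.\<close>

definition assumption_A1_1 :: "'w measure \<Rightarrow> (real \<Rightarrow> real) \<Rightarrow> ('w \<Rightarrow> real) \<Rightarrow> bool" where
  "assumption_A1_1 M f e \<longleftrightarrow>
     (\<exists>\<phi> \<in> borel_measurable borel. \<exists>p>1. \<exists>r>0.
        (\<forall>x::real. 0 < \<phi> x) \<and> integrable M (\<lambda>\<omega>. \<phi> (e \<omega>) powr p) \<and>
        (\<forall>j k x a b. j + k = 2 \<longrightarrow> 0 < b \<longrightarrow> max \<bar>a\<bar> \<bar>b - 1\<bar> < r \<longrightarrow>
           \<bar>1 / f x * dF f j k x a b\<bar> \<le> \<phi> x))"

definition assumption_A1_2 :: "'w measure \<Rightarrow> (real \<Rightarrow> real) \<Rightarrow> ('w \<Rightarrow> real) \<Rightarrow> bool" where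
  "assumption_A1_2 M f e \<longleftrightarrow>
     (\<exists>V1 V2 :: real \<Rightarrow> real \<Rightarrow> real \<Rightarrow> real.
        (\<forall>x a b. 0 < b \<longrightarrow> 0 < V1 x a b \<and> 0 < V2 x a b) \<and>
        (\<forall>j k x a a' b. j + k = 2 \<longrightarrow> 0 < b \<longrightarrow>
           (\<exists>a0 \<in> closed_segment a a'.
              \<bar>dF f j k x a b - dF f j k x a' b\<bar> \<le> V1 x a0 b * \<bar>a - a'\<bar>)) \<and>
        (\<forall>j k x a b b'. j + k = 2 \<longrightarrow> 0 < b \<longrightarrow> 0 < b' \<longrightarrow>
           (\<exists>b0 \<in> closed_segment b b'.
              \<bar>dF f j k x a b - dF f j k x a b'\<bar> \<le> V2 x a b0 * \<bar>b - b'\<bar>)) \<and>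
        (\<exists>\<phi> \<in> borel_measurable borel. \<exists>r>0.
           (\<forall>x::real. 0 < \<phi> x) \<and> integrable M (\<lambda>\<omega>. \<phi> (e \<omega>)) \<and>
           (\<forall>x a b. 0 < b \<longrightarrow> max \<bar>a\<bar> \<bar>b - 1\<bar> < r \<longrightarrow>
              \<bar>V1 x a b / f x\<bar> \<le> \<phi> x \<and> \<bar>V2 x a b / f x\<bar> \<le> \<phi> x)))"

definition assumption_A2 :: "'w measure \<Rightarrow> (real \<Rightarrow> real) \<Rightarrow> ('w \<Rightarrow> real) \<Rightarrow> bool" where
  "assumption_A2 M f e \<longleftrightarrow>
     has_bochner_integral M (\<lambda>\<omega>. score f (e \<omega>)) 0 \<and>
     has_bochner_integral M (\<lambda>\<omega>. e \<omega> * score f (e \<omega>)) (- 1) \<and>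
     has_bochner_integral M (\<lambda>\<omega>. deriv (score f) (e \<omega>) + (score f (e \<omega>))\<^sup>2) 0 \<and>
     has_bochner_integral M (\<lambda>\<omega>. e \<omega> * (deriv (score f) (e \<omega>) + (score f (e \<omega>))\<^sup>2)) 0 \<and>
     has_bochner_integral M (\<lambda>\<omega>. (e \<omega>)\<^sup>2 * (deriv (score f) (e \<omega>) + (score f (e \<omega>))\<^sup>2)) 2"

definition assumption_A3 ::
  "'w measure \<Rightarrow> (real \<Rightarrow> real) \<Rightarrow> ('w \<Rightarrow> real) \<Rightarrow> ('w \<Rightarrow> 'z) \<Rightarrow>
   ('z \<Rightarrow> real) \<Rightarrow> ('z \<Rightarrow> real) \<Rightarrow> ('z \<Rightarrow> real) \<Rightarrow> bool" where
  "assumption_A3 M f e Z0 \<sigma>\<^sub>0 G S \<longleftrightarrow>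
     (\<exists>l>0.
        integrable M (\<lambda>\<omega>. \<bar>G (Z0 \<omega>) / \<sigma>\<^sub>0 (Z0 \<omega>)\<bar> powr (l + 2)) \<and>
        integrable M (\<lambda>\<omega>. \<bar>S (Z0 \<omega>) / \<sigma>\<^sub>0 (Z0 \<omega>)\<bar> powr (l + 2)) \<and>
        integrable M (\<lambda>\<omega>. \<bar>score f (e \<omega>)\<bar> powr (l + 2)) \<and>
        integrable M (\<lambda>\<omega>. \<bar>e \<omega> * score f (e \<omega>)\<bar> powr (l + 2)) \<and>
        integrable M (\<lambda>\<omega>. \<bar>deriv (score f) (e \<omega>)\<bar> powr (l + 2)) \<and>
        integrable M (\<lambda>\<omega>. \<bar>e \<omega> * deriv (score f) (e \<omega>)\<bar> powr (l + 2)) \<and>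
        integrable M (\<lambda>\<omega>. \<bar>e \<omega>\<bar> powr (2 * l + 4)) \<and>
        integrable M (\<lambda>\<omega>. \<bar>(e \<omega>)\<^sup>2 * score f (e \<omega>)\<bar> powr (l + 2)))"

section \<open>The log-likelihood ratio and its approximation\<close>

definition loglik_ratio ::
  "(real \<Rightarrow> real) \<Rightarrow> (int \<Rightarrow> 'w \<Rightarrow> real) \<Rightarrow> (int \<Rightarrow> 'w \<Rightarrow> 'z) \<Rightarrow> ('z \<Rightarrow> real) \<Rightarrow>
   ('z \<Rightarrow> real) \<Rightarrow> ('z \<Rightarrow> real) \<Rightarrow> real \<Rightarrow> real \<Rightarrow> nat \<Rightarrow> 'w \<Rightarrow> real" where
  "loglik_ratio f \<epsilon> Z \<sigma>\<^sub>0 G S h h' n \<omega> =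
     (\<Sum>i = 1..int n.
        let \<alpha> = h * real n powr (- 1 / 2) * (G (Z i \<omega>) / \<sigma>\<^sub>0 (Z i \<omega>));
            \<beta> = 1 + h' * real n powr (- 1 / 2) * (S (Z i \<omega>) / \<sigma>\<^sub>0 (Z i \<omega>))
        in ln (loc_scale f (\<epsilon> i \<omega>) \<alpha> \<beta> / f (\<epsilon> i \<omega>)))"

definition central_seq ::
  "(real \<Rightarrow> real) \<Rightarrow> (int \<Rightarrow> 'w \<Rightarrow> real) \<Rightarrow> (int \<Rightarrow> 'w \<Rightarrow> 'z) \<Rightarrow> ('z \<Rightarrow> real) \<Rightarrow>
   ('z \<Rightarrow> real) \<Rightarrow> ('z \<Rightarrow> real) \<Rightarrow> real \<Rightarrow> real \<Rightarrow> nat \<Rightarrow> 'w \<Rightarrow> real" where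
  "central_seq f \<epsilon> Z \<sigma>\<^sub>0 G S h h' n \<omega> =
     - (real n powr (- 1 / 2)) *
       (\<Sum>i = 1..int n.
          h * score f (\<epsilon> i \<omega>) * (G (Z i \<omega>) / \<sigma>\<^sub>0 (Z i \<omega>))
          + h' * (1 + \<epsilon> i \<omega> * score f (\<epsilon> i \<omega>)) * (S (Z i \<omega>) / \<sigma>\<^sub>0 (Z i \<omega>)))"

definition fisher_mom :: "'w measure \<Rightarrow> (real \<Rightarrow> real) \<Rightarrow> ('w \<Rightarrow> real) \<Rightarrow> nat \<Rightarrow> real" where
  "fisher_mom M f e j = (\<integral>\<omega>. (e \<omega>) ^ j * (score f (e \<omega>))\<^sup>2 \<partial>M)"

definition lan_variance ::
  "'w measure \<Rightarrow> (real \<Rightarrow> real) \<Rightarrow> ('w \<Rightarrow> real) \<Rightarrow> ('w \<Rightarrow> 'z) \<Rightarrow>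
   ('z \<Rightarrow> real) \<Rightarrow> ('z \<Rightarrow> real) \<Rightarrow> ('z \<Rightarrow> real) \<Rightarrow> real \<Rightarrow> real \<Rightarrow> real" where
  "lan_variance M f e Z0 \<sigma>\<^sub>0 G S h h' =
     h\<^sup>2 * fisher_mom M f e 0 * (\<integral>\<omega>. (G (Z0 \<omega>) / \<sigma>\<^sub>0 (Z0 \<omega>))\<^sup>2 \<partial>M)
     + h'\<^sup>2 * (fisher_mom M f e 2 - 1) * (\<integral>\<omega>. (S (Z0 \<omega>) / \<sigma>\<^sub>0 (Z0 \<omega>))\<^sup>2 \<partial>M)
     + 2 * h * h' * fisher_mom M f e 1 *
         (\<integral>\<omega>. G (Z0 \<omega>) * S (Z0 \<omega>) / (\<sigma>\<^sub>0 (Z0 \<omega>))\<^sup>2 \<partial>M)"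

section \<open>Modes of convergence\<close>

text \<open>Measurability is part of the definition since \<open>measure\<close> vanishes on non-measurable sets.\<close>

definition o_P_one :: "'w measure \<Rightarrow> (nat \<Rightarrow> 'w \<Rightarrow> real) \<Rightarrow> bool" where
  "o_P_one M R \<longleftrightarrow>
     (\<forall>n. R n \<in> borel_measurable M) \<and>
     (\<forall>\<delta>>0. (\<lambda>n. measure M {\<omega> \<in> space M. \<bar>R n \<omega>\<bar> > \<delta>}) \<longlonglongrightarrow> 0)"

text \<open>The normal law with mean \<open>\<mu>\<close> and variance \<open>v \<ge> 0\<close>; for \<open>v = 0\<close>, which is possible here
  (for instance \<open>G = S = 0\<close>), it is the point mass at \<open>\<mu>\<close>.\<close>

definition normal_law :: "real \<Rightarrow> real \<Rightarrow> real measure" where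
  "normal_law \<mu> v =
     (if v = 0 then return borel \<mu> else density lborel (\<lambda>x. ennreal (normal_density \<mu> (sqrt v) x)))"

definition conv_in_distr :: "'w measure \<Rightarrow> (nat \<Rightarrow> 'w \<Rightarrow> real) \<Rightarrow> real measure \<Rightarrow> bool" where
  "conv_in_distr M V L \<longleftrightarrow>
     (\<forall>n. V n \<in> borel_measurable M) \<and> weak_conv_m (\<lambda>n. distr M borel (V n)) L"

end

theory Submission
  imports Defs
begin

text \<open>The expansion even holds almost surely. The innovation \<open>\<epsilon> i\<close> is almost surely a function of the
  path of \<open>(Y, X)\<close>, so Birkhoff's theorem (obtained from the maximal ergodic inequality) applies to
  averages of functions of \<open>(\<epsilon> i, Z i)\<close>. A second-order Taylor expansion of the location-scale family
  writes each likelihood ratio as one plus a linear term, a quadratic term of mean zero and a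
  cubic remainder; convergence of averages makes the maximum of the linear terms negligible, so the
  remainder vanishes with integrability of the dominating function alone, and \<open>ln (1 + x)\<close> contributes
  \<open>-x\<^sup>2 / 2\<close> of the linear terms only, whose sum of squares converges to the variance. The central
  sequence is a sum of martingale differences; McLeish's product \<open>\<Prod>(1 + \<i> t x\<^sub>k)\<close>, stopped when the sum
  of squares gets too large, has expectation one and yields the characteristic function.\<close>

section \<open>The ergodic theorem\<close>

text \<open>Moments shape the expansion. The size of the perturbation,
  \<open>\<bar>h * u z\<bar> + \<bar>h' * v z\<bar>\<close>, has little more than second moments,
  while the Taylor remainder is cubic in it. Two of the three factors are averaged together with the
  dominating function, which is possible because innovation and regressor are independent; the
  third, divided by \<open>sqrt n\<close>, is uniformly small because the terms of a convergent
  average are of smaller order than \<open>n\<close>. In the limit theorem, the squared modulus of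
  the product is \<open>\<Prod>(1 + t\<^sup>2 * x\<^sub>k\<^sup>2)\<close>, which second moments
  alone do not control. Stopping bounds its expectation uniformly, and it is eventually inactive
  since the sums of squares converge almost surely. The martingale property enters as orthogonality
  to square integrable functions of the past, so conditional expectations never appear. A last
  obstacle is measurability: the innovations are functions of the observations only up to null sets,
  whereas the \<sigma>-fields of the past are not completed. The martingale is therefore built from
  an exactly adapted version of the innovations.\<close>

fun birkhoff_max :: "('a \<Rightarrow> 'a) \<Rightarrow> ('a \<Rightarrow> real) \<Rightarrow> nat \<Rightarrow> 'a \<Rightarrow> real" where
  "birkhoff_max T \<psi> 0 x = 0"
| "birkhoff_max T \<psi> (Suc n) x = max 0 (\<psi> x + birkhoff_max T \<psi> n (T x))"

lemma birkhoff_max_mono: "mono (\<lambda>n. birkhoff_max T \<psi> n x)"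
proof (rule incseq_SucI)
  show "birkhoff_max T \<psi> n x \<le> birkhoff_max T \<psi> (Suc n) x" for n
  proof (induction n arbitrary: x)
    case (Suc n)
    from Suc[of "T x"] show ?case by simp
  qed simp
qed

lemma birkhoff_max_nonneg: "0 \<le> birkhoff_max T \<psi> n x"
  by (cases n) auto

text \<open>\<open>birkhoff_max\<close> is the maximum of 0 and of the first \<open>n\<close>
  partial sums along the orbit. Its recursion peels off the first summand rather than the last,
  which exposes the maximum at \<open>T x\<close> for the maximal inequality.\<close>

lemma birkhoff_sum_le_max: "(\<Sum>k<n. \<psi> ((T ^^ k) x)) \<le> birkhoff_max T \<psi> n x"
proof (induction n arbitrary: x)
  case (Suc n)
  have "(\<Sum>k<Suc n. \<psi> ((T ^^ k) x)) = \<psi> x + (\<Sum>k<n. \<psi> ((T ^^ k) (T x)))"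
    by (simp only: sum.lessThan_Suc_shift) (simp add: funpow_swap1)
  with Suc[of "T x"] show ?case by simp
qed simp

lemma integrable_measure_preserving:
  fixes \<psi> :: "'a \<Rightarrow> 'b::{banach, second_countable_topology}"
  assumes T: "T \<in> measurable M M" "distr M M T = M" and "integrable M \<psi>"
  shows "integrable M (\<lambda>x. \<psi> (T x))" "(\<integral>x. \<psi> (T x) \<partial>M) = (\<integral>x. \<psi> x \<partial>M)"
  using integrable_distr[OF T(1), of \<psi>] integral_distr[OF T(1), of \<psi>] assms
  by simp_all

lemma birkhoff_max_integrable:
  assumes T: "T \<in> measurable M M" "distr M M T = M" and \<psi>: "integrable M \<psi>"
  shows "integrable M (birkhoff_max T \<psi> n)"
proof (induction n)
  case (Suc n)
  have "integrable M (\<lambda>x. max 0 (\<psi> x + birkhoff_max T \<psi> n (T x)))"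
    using integrable_measure_preserving(1)[OF T Suc] \<psi> by auto
  also have "(\<lambda>x. max 0 (\<psi> x + birkhoff_max T \<psi> n (T x))) = birkhoff_max T \<psi> (Suc n)"
    by (rule ext) simp
  finally show ?case .
qed (simp add: birkhoff_max.simps(1)[abs_def])

text \<open>Garsia's argument: where the maximum is positive, it equals \<open>\<psi> x\<close> plus
  the previous maximum at \<open>T x\<close>, so by monotonicity in \<open>n\<close> it exceeds the
  maximum at \<open>T x\<close> by at most \<open>\<psi> x\<close>; elsewhere it is 0 and the
  difference is nonpositive. Since \<open>T\<close> preserves the measure, the difference integrates
  to 0.\<close>

lemma maximal_ergodic:
  assumes T: "T \<in> measurable M M" "distr M M T = M" and \<psi>: "integrable M \<psi>"
  shows "0 \<le> (\<integral>x. indicator {x. 0 < birkhoff_max T \<psi> n x} x * \<psi> x \<partial>M)"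
proof -
  note int = birkhoff_max_integrable[OF T \<psi>]
  have [measurable]: "birkhoff_max T \<psi> k \<in> borel_measurable M" for k
    using int by (rule borel_measurable_integrable)
  have [measurable]: "\<psi> \<in> borel_measurable M" using \<psi> by auto
  have pw: "birkhoff_max T \<psi> n x - birkhoff_max T \<psi> n (T x)
      \<le> indicator {x. 0 < birkhoff_max T \<psi> n x} x * \<psi> x" for x
  proof (cases "0 < birkhoff_max T \<psi> n x")
    case True
    then obtain k where n: "n = Suc k" by (cases n) auto
    have "birkhoff_max T \<psi> n x = \<psi> x + birkhoff_max T \<psi> k (T x)"
      using True by (simp add: n max_def split: if_splits)
    moreover have "birkhoff_max T \<psi> k (T x) \<le> birkhoff_max T \<psi> n (T x)"
      using monoD[OF birkhoff_max_mono, of k n T \<psi> "T x"] n by simp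
    ultimately show ?thesis using True by simp
  qed (use birkhoff_max_nonneg[of T \<psi> n "T x"] in auto)
  have "0 = (\<integral>x. birkhoff_max T \<psi> n x - birkhoff_max T \<psi> n (T x) \<partial>M)"
    using integrable_measure_preserving[OF T int] int by simp
  also have "\<dots> \<le> (\<integral>x. indicator {x. 0 < birkhoff_max T \<psi> n x} x * \<psi> x \<partial>M)"
  proof (rule integral_mono)
    show "integrable M (\<lambda>x. indicator {x. 0 < birkhoff_max T \<psi> n x} x * \<psi> x)"
      by (rule Bochner_Integration.integrable_bound[OF \<psi>]) (auto simp: indicator_def)
  qed (use integrable_measure_preserving[OF T int] int pw in auto)
  finally show ?thesis .
qed

text \<open>The set where the maxima are unbounded is invariant, hence of probability 0 or 1. If it
  were 1, the indicators in \<open>maximal_ergodic\<close> would tend to 1, and dominated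
  convergence would make the integral of \<open>\<psi>\<close> nonnegative.\<close>

lemma birkhoff_sums_bounded_above:
  fixes \<psi> :: "'a \<Rightarrow> real"
  assumes M: "prob_space M"
    and T: "T \<in> measurable M M" "distr M M T = M"
    and erg: "\<And>A. A \<in> sets M \<Longrightarrow> T -` A \<inter> space M = A \<Longrightarrow> measure M A \<in> {0, 1}"
    and \<psi>: "integrable M \<psi>" and neg: "(\<integral>x. \<psi> x \<partial>M) < 0"
  shows "AE x in M. \<exists>B. \<forall>n. (\<Sum>k<n. \<psi> ((T ^^ k) x)) \<le> B"
proof -
  interpret prob_space M by fact
  let ?b = "birkhoff_max T \<psi>"
  have [measurable]: "?b k \<in> borel_measurable M" for k
    using birkhoff_max_integrable[OF T \<psi>] by (rule borel_measurable_integrable)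
  have [measurable]: "\<psi> \<in> borel_measurable M" using \<psi> by auto
  define A where "A = {x \<in> space M. \<forall>N::nat. \<exists>n. real N < ?b n x}"
  have A_sets [measurable]: "A \<in> sets M" unfolding A_def by measurable
  \<comment> \<open>Up to an index shift and truncation at 0, the maxima at \<open>x\<close> and at
    \<open>T x\<close> differ by the finite number \<open>\<psi> x\<close>; \<open>K\<close> leaves
    room for it. The equivalence holds at every point because \<open>erg\<close> speaks of strictly
    invariant sets.\<close>
  have inv_iff: "(\<forall>N::nat. \<exists>n. real N < ?b n (T x)) \<longleftrightarrow> (\<forall>N::nat. \<exists>n. real N < ?b n x)" for x
  proof safe
    fix N :: nat assume *: "\<forall>N::nat. \<exists>n. real N < ?b n (T x)"
    obtain K :: nat where K: "real N + \<bar>\<psi> x\<bar> < real K" using reals_Archimedean2 by blast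
    obtain n where "real K < ?b n (T x)" using * by blast
    then have "real N < ?b (Suc n) x" using K by (auto simp: max_def)
    then show "\<exists>n. real N < ?b n x" ..
  next
    fix N :: nat assume *: "\<forall>N::nat. \<exists>n. real N < ?b n x"
    obtain K :: nat where K: "real N + \<bar>\<psi> x\<bar> < real K" using reals_Archimedean2 by blast
    obtain n where n: "real K < ?b n x" using * by blast
    with K obtain k where "n = Suc k" by (cases n) auto
    with n K have "real N < ?b k (T x)" by (auto simp: max_def split: if_splits)
    then show "\<exists>n. real N < ?b n (T x)" ..
  qed
  have "T -` A \<inter> space M = A"
    unfolding A_def using measurable_space[OF T(1)] inv_iff by auto
  from erg[OF A_sets this] have "prob A = 0 \<or> prob A = 1" by auto
  moreover have "prob A \<noteq> 1"
  proof
    assume "prob A = 1"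
    then have "AE x in M. x \<in> A" using prob_eq_1[OF A_sets] by simp
    then have lim: "AE x in M. (\<lambda>n. indicator {x. 0 < ?b n x} x * \<psi> x) \<longlonglongrightarrow> \<psi> x"
    proof eventually_elim
      case (elim x)
      then obtain N where "real 0 < ?b N x" unfolding A_def by blast
      then have "0 < ?b n x" if "N \<le> n" for n
        using monoD[OF birkhoff_max_mono that, of T \<psi> x] by simp
      then have "eventually (\<lambda>n. indicator {x. 0 < ?b n x} x * \<psi> x = \<psi> x) sequentially"
        unfolding eventually_sequentially by (intro exI[of _ N]) (auto simp: indicator_def)
      then show ?case by (rule tendsto_eventually)
    qed
    have "(\<lambda>n. \<integral>x. indicator {x. 0 < ?b n x} x * \<psi> x \<partial>M) \<longlonglongrightarrow> (\<integral>x. \<psi> x \<partial>M)"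
      by (rule integral_dominated_convergence[where w = "\<lambda>x. \<bar>\<psi> x\<bar>"])
        (use \<psi> lim in \<open>auto simp: indicator_def\<close>)
    then have "0 \<le> (\<integral>x. \<psi> x \<partial>M)"
      by (rule LIMSEQ_le_const) (use maximal_ergodic[OF T \<psi>] in auto)
    with neg show False by simp
  qed
  ultimately have "prob A = 0" by blast
  then have "AE x in M. x \<notin> A" using A_sets prob_eq_0 by auto
  with AE_space show ?thesis
  proof eventually_elim
    case (elim x)
    then obtain N :: nat where "\<And>n. ?b n x \<le> real N" unfolding A_def by (auto simp: not_less)
    then show ?case using birkhoff_sum_le_max[of \<psi> T] order_trans by blast
  qed
qed

text \<open>Centring by slightly more than the mean makes the integral negative, so the centred sums
  stay below a constant. Half of \<open>\<delta>\<close> pays for the centring, the other half for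
  that constant divided by \<open>n\<close>.\<close>

lemma birkhoff_limsup:
  fixes \<psi> :: "'a \<Rightarrow> real"
  assumes M: "prob_space M"
    and T: "T \<in> measurable M M" "distr M M T = M"
    and erg: "\<And>A. A \<in> sets M \<Longrightarrow> T -` A \<inter> space M = A \<Longrightarrow> measure M A \<in> {0, 1}"
    and \<psi>: "integrable M \<psi>" and \<delta>: "0 < \<delta>"
  shows "AE x in M. eventually (\<lambda>n. (\<Sum>k<n. \<psi> ((T ^^ k) x)) / real n \<le> (\<integral>x. \<psi> x \<partial>M) + \<delta>) sequentially"
proof -
  interpret prob_space M by fact
  define c where "c = (\<integral>x. \<psi> x \<partial>M) + \<delta> / 2"
  have "AE x in M. \<exists>B. \<forall>n. (\<Sum>k<n. \<psi> ((T ^^ k) x) - c) \<le> B"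
    by (rule birkhoff_sums_bounded_above[OF M T erg])
      (use \<psi> \<delta> in \<open>auto simp: c_def prob_space\<close>)
  then show ?thesis
  proof eventually_elim
    case (elim x)
    then obtain B where B: "\<And>n. (\<Sum>k<n. \<psi> ((T ^^ k) x)) - real n * c \<le> B"
      by (auto simp: sum_subtractf)
    have "eventually (\<lambda>n. \<bar>B\<bar> / (\<delta> / 2) \<le> real n) sequentially"
      using filterlim_real_sequentially by (auto simp: filterlim_at_top)
    with eventually_gt_at_top[of 0] show ?case
    proof eventually_elim
      case (elim n)
      have "(\<Sum>k<n. \<psi> ((T ^^ k) x)) \<le> real n * c + real n * (\<delta> / 2)"
        using B[of n] elim(2) \<delta> by (simp add: field_simps)
      then show ?case using elim(1) by (simp add: c_def field_simps)
    qed
  qed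
qed

text \<open>The upper bound is applied to \<open>\<psi>\<close> and to its negative; the tolerances
  \<open>1 / real (Suc j)\<close> are countably many, so the exceptional set stays null.\<close>

theorem birkhoff_ergodic:
  fixes \<psi> :: "'a \<Rightarrow> real"
  assumes M: "prob_space M"
    and T: "T \<in> measurable M M" "distr M M T = M"
    and erg: "\<And>A. A \<in> sets M \<Longrightarrow> T -` A \<inter> space M = A \<Longrightarrow> measure M A \<in> {0, 1}"
    and \<psi>: "integrable M \<psi>"
  shows "AE x in M. (\<lambda>n. (\<Sum>k<n. \<psi> ((T ^^ k) x)) / real n) \<longlonglongrightarrow> (\<integral>x. \<psi> x \<partial>M)"
proof -
  let ?c = "\<integral>x. \<psi> x \<partial>M"
  have "AE x in M. \<forall>j. eventually (\<lambda>n. (\<Sum>k<n. \<psi> ((T ^^ k) x)) / real n \<le> ?c + 1 / real (Suc j)) sequentially"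
    unfolding AE_all_countable
    by (intro allI birkhoff_limsup[OF M T erg \<psi>]) auto
  moreover have "AE x in M. \<forall>j. eventually (\<lambda>n. (\<Sum>k<n. - \<psi> ((T ^^ k) x)) / real n \<le> (\<integral>x. - \<psi> x \<partial>M) + 1 / real (Suc j)) sequentially"
    unfolding AE_all_countable
    by (intro allI birkhoff_limsup[OF M T erg]) (use \<psi> in auto)
  ultimately show ?thesis
  proof eventually_elim
    case (elim x)
    show ?case
    proof (rule LIMSEQ_I)
      fix r :: real assume "0 < r"
      then obtain j where j: "1 / real (Suc j) < r" using nat_approx_posE by blast
      have "eventually (\<lambda>n. norm ((\<Sum>k<n. \<psi> ((T ^^ k) x)) / real n - ?c) < r) sequentially"
        using elim(1)[rule_format, of j] elim(2)[rule_format, of j]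
        by eventually_elim (use j in \<open>auto simp: sum_negf abs_less_iff\<close>)
      then show "\<exists>no. \<forall>n\<ge>no. norm ((\<Sum>k<n. \<psi> ((T ^^ k) x)) / real n - ?c) < r"
        by (simp add: eventually_sequentially)
    qed
  qed
qed

section \<open>Transfer between path space and a stationary process\<close>

lemma path_shift_funpow: "(path_shift ^^ k) x = (\<lambda>i. x (i + int k))"
  by (induction k) (auto simp: path_shift_def algebra_simps)

lemma path_shift_measurable [measurable]:
  "path_shift \<in> measurable (PiM UNIV (\<lambda>_. N)) (PiM UNIV (\<lambda>_. N))"
  unfolding path_shift_def by (rule measurable_PiM_single') (auto simp: space_PiM PiE_def Pi_def)

lemma path_measurable:
  assumes "\<And>i. W i \<in> measurable M N"
  shows "(\<lambda>\<omega> i. W i \<omega>) \<in> measurable M (PiM UNIV (\<lambda>_. N))"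
  by (rule measurable_PiM_single') (use assms in \<open>auto dest: measurable_space\<close>)

lemma stationary_shift:
  fixes \<Psi> :: "(int \<Rightarrow> 'v) \<Rightarrow> real"
  assumes st: "stationary_process M N W"
    and [measurable]: "\<Psi> \<in> borel_measurable (PiM UNIV (\<lambda>_. N))"
    and int: "integrable M (\<lambda>\<omega>. \<Psi> (\<lambda>i. W i \<omega>))"
  shows "integrable M (\<lambda>\<omega>. \<Psi> (\<lambda>i. W (i + int k) \<omega>))"
    and "(\<integral>\<omega>. \<Psi> (\<lambda>i. W (i + int k) \<omega>) \<partial>M) = (\<integral>\<omega>. \<Psi> (\<lambda>i. W i \<omega>) \<partial>M)"
proof -
  let ?P = "PiM UNIV (\<lambda>_::int. N)"
  have W [measurable]: "(\<lambda>\<omega> i. W i \<omega>) \<in> measurable M ?P"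
    using st by (intro path_measurable) (simp add: stationary_process_def)
  define \<mu> where "\<mu> = distr M ?P (\<lambda>\<omega> i. W i \<omega>)"
  have sets [measurable_cong]: "sets \<mu> = sets ?P" by (simp add: \<mu>_def)
  have pres: "distr \<mu> \<mu> path_shift = \<mu>"
    using st unfolding \<mu>_def stationary_process_def
    by (subst distr_cong[OF refl _ refl, of _ ?P]) (auto simp: distr_distr comp_def)
  have int_\<mu>: "integrable \<mu> \<Psi>" unfolding \<mu>_def using int by (subst integrable_distr_eq) auto
  have "integrable \<mu> (\<lambda>x. \<Psi> ((path_shift ^^ k) x)) \<and> (\<integral>x. \<Psi> ((path_shift ^^ k) x) \<partial>\<mu>) = (\<integral>x. \<Psi> x \<partial>\<mu>)"
  proof (induction k)
    case (Suc k)
    then show ?case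
      using integrable_measure_preserving[of path_shift \<mu>, OF _ pres, of "\<lambda>x. \<Psi> ((path_shift ^^ k) x)"]
      by (simp add: funpow_swap1)
  qed (use int_\<mu> in simp)
  moreover have [measurable]: "(\<lambda>x. \<Psi> ((path_shift ^^ k) x)) \<in> borel_measurable ?P"
    by (rule measurable_compose[OF measurable_compose_n[OF path_shift_measurable]]) simp
  ultimately show "integrable M (\<lambda>\<omega>. \<Psi> (\<lambda>i. W (i + int k) \<omega>))"
    and "(\<integral>\<omega>. \<Psi> (\<lambda>i. W (i + int k) \<omega>) \<partial>M) = (\<integral>\<omega>. \<Psi> (\<lambda>i. W i \<omega>) \<partial>M)"
    unfolding \<mu>_def by (simp_all add: integrable_distr_eq integral_distr path_shift_funpow)
qed

lemma stationary_ergodic_lln: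
  fixes \<Psi> :: "(int \<Rightarrow> 'v) \<Rightarrow> real"
  assumes M: "prob_space M" and st: "stationary_process M N W" and erg: "ergodic_process M N W"
    and \<Psi> [measurable]: "\<Psi> \<in> borel_measurable (PiM UNIV (\<lambda>_. N))"
    and int: "integrable M (\<lambda>\<omega>. \<Psi> (\<lambda>i. W i \<omega>))"
  shows "AE \<omega> in M. (\<lambda>n. (\<Sum>k<n. \<Psi> (\<lambda>i. W (i + (int k + 1)) \<omega>)) / real n) \<longlonglongrightarrow> (\<integral>\<omega>. \<Psi> (\<lambda>i. W i \<omega>) \<partial>M)"
proof -
  interpret prob_space M by fact
  let ?P = "PiM UNIV (\<lambda>_::int. N)"
  have W [measurable]: "(\<lambda>\<omega> i. W i \<omega>) \<in> measurable M ?P"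
    using st by (intro path_measurable) (simp add: stationary_process_def)
  define \<mu> where "\<mu> = distr M ?P (\<lambda>\<omega> i. W i \<omega>)"
  have sets [measurable_cong]: "sets \<mu> = sets ?P" by (simp add: \<mu>_def)
  have pres: "distr \<mu> \<mu> path_shift = \<mu>"
    using st unfolding \<mu>_def stationary_process_def
    by (subst distr_cong[OF refl _ refl, of _ ?P]) (auto simp: distr_distr comp_def)
  \<comment> \<open>One extra shift: Birkhoff sums start at index 0, whereas the observations start
    at time 1.\<close>
  have shifted [measurable]: "(\<lambda>x. \<Psi> (path_shift x)) \<in> borel_measurable ?P" by measurable
  have "AE x in \<mu>. (\<lambda>n. (\<Sum>k<n. \<Psi> (path_shift ((path_shift ^^ k) x))) / real n) \<longlonglongrightarrow> (\<integral>x. \<Psi> (path_shift x) \<partial>\<mu>)"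
  proof (rule birkhoff_ergodic)
    show "prob_space \<mu>" unfolding \<mu>_def by (rule prob_space_distr[OF W])
    show "path_shift \<in> measurable \<mu> \<mu>" by measurable
    show "distr \<mu> \<mu> path_shift = \<mu>" by (rule pres)
    show "measure \<mu> A \<in> {0, 1}" if "A \<in> sets \<mu>" "path_shift -` A \<inter> space \<mu> = A" for A
    proof -
      have "measure \<mu> A = prob {\<omega> \<in> space M. (\<lambda>i. W i \<omega>) \<in> A}"
        using that(1) unfolding \<mu>_def
        by (subst measure_distr[OF W]) (auto intro!: arg_cong[where f = prob])
      then show ?thesis using erg that unfolding ergodic_process_def \<mu>_def by simp
    qed
    show "integrable \<mu> (\<lambda>x. \<Psi> (path_shift x))"
      unfolding \<mu>_def using stationary_shift(1)[OF st \<Psi> int, of 1]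
      by (subst integrable_distr_eq[OF W shifted]) (simp add: path_shift_def)
  qed
  then have "AE \<omega> in M. (\<lambda>n. (\<Sum>k<n. \<Psi> (path_shift ((path_shift ^^ k) (\<lambda>i. W i \<omega>)))) / real n)
      \<longlonglongrightarrow> (\<integral>x. \<Psi> (path_shift x) \<partial>\<mu>)"
    unfolding \<mu>_def by (rule AE_distrD[OF W])
  moreover have "(\<integral>x. \<Psi> (path_shift x) \<partial>\<mu>) = (\<integral>\<omega>. \<Psi> (\<lambda>i. W i \<omega>) \<partial>M)"
    unfolding \<mu>_def using stationary_shift(2)[OF st \<Psi> int, of 1]
    by (subst integral_distr[OF W shifted]) (simp add: path_shift_def)
  moreover have "path_shift ((path_shift ^^ k) x) = (\<lambda>i. x (i + (int k + 1)))" for x :: "int \<Rightarrow> 'v" and k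
    by (simp add: path_shift_funpow) (simp add: path_shift_def algebra_simps)
  ultimately show ?thesis by simp
qed

section \<open>Triangular arrays of real numbers\<close>

text \<open>\<open>a n / (n + 1)\<close> is the difference of two sequences with the same limit
  \<open>L\<close>, so it tends to 0. Late terms are then at most
  \<open>\<delta> * (k + 1) \<le> \<delta> * n\<close>, and the finitely many early ones are
  absorbed by large \<open>n\<close>. Every uniform smallness statement below comes from
  here.\<close>

lemma average_convergent_imp_max_negligible:
  fixes a :: "nat \<Rightarrow> real"
  assumes lim: "(\<lambda>n. (\<Sum>k<n. a k) / real n) \<longlonglongrightarrow> L" and \<delta>: "0 < \<delta>"
  shows "eventually (\<lambda>n. \<forall>k<n. \<bar>a k\<bar> \<le> \<delta> * real n) sequentially"
proof -
  let ?s = "\<lambda>n. (\<Sum>k<n. a k) / real n"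
  have "(\<lambda>n. ?s (Suc n) - ?s n * (real n / real (Suc n))) \<longlonglongrightarrow> L - L * 1"
    by (intro tendsto_intros LIMSEQ_Suc lim LIMSEQ_n_over_Suc_n)
  moreover have "?s (Suc n) - ?s n * (real n / real (Suc n)) = a n / real (Suc n)" for n
    by (cases "n = 0") (simp_all add: diff_divide_distrib[symmetric])
  ultimately have "(\<lambda>n. a n / real (Suc n)) \<longlonglongrightarrow> 0" by simp
  from LIMSEQ_D[OF this \<delta>] obtain N where N: "\<And>n. n \<ge> N \<Longrightarrow> \<bar>a n / real (Suc n)\<bar> < \<delta>" by auto
  have "eventually (\<lambda>n. (\<Sum>k<N. \<bar>a k\<bar>) / \<delta> \<le> real n) sequentially"
    using filterlim_real_sequentially by (auto simp: filterlim_at_top)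
  then show ?thesis
  proof eventually_elim
    case (elim n)
    show ?case
    proof (intro allI impI)
      fix k assume "k < n"
      show "\<bar>a k\<bar> \<le> \<delta> * real n"
      proof (cases "k < N")
        case True
        then have "\<bar>a k\<bar> \<le> (\<Sum>k<N. \<bar>a k\<bar>)" by (intro member_le_sum) auto
        also have "\<dots> \<le> \<delta> * real n" using elim \<delta> by (simp add: field_simps)
        finally show ?thesis .
      next
        case False
        then have "\<bar>a k\<bar> \<le> \<delta> * real (Suc k)" using N[of k] by (simp add: field_simps)
        also have "\<dots> \<le> \<delta> * real n" using \<delta> \<open>k < n\<close> by (intro mult_left_mono) auto
        finally show ?thesis .
      qed
    qed
  qed
qed

text \<open>The derivative of the expression is \<open>y\<^sup>2 / (1 + y)\<close>, which is at most
  \<open>2 * x\<^sup>2\<close> between 0 and \<open>x\<close> because \<open>1 + y\<close> is at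
  least 1/2 there; the mean value inequality concludes.\<close>

lemma ln_one_plus_quadratic_bound:
  fixes x :: real
  assumes "\<bar>x\<bar> \<le> 1 / 2"
  shows "\<bar>ln (1 + x) - x + x\<^sup>2 / 2\<bar> \<le> 2 * \<bar>x\<bar> ^ 3"
proof -
  have "norm ((ln (1 + x) - x + x\<^sup>2 / 2) - (ln (1 + 0) - 0 + 0\<^sup>2 / 2)) \<le> 2 * x\<^sup>2 * norm (x - 0)"
  proof (rule field_differentiable_bound[where S = "closed_segment 0 x" and f = "\<lambda>x. ln (1 + x) - x + x\<^sup>2 / 2" and f' = "\<lambda>y. y\<^sup>2 / (1 + y)"])
    fix y assume "y \<in> closed_segment 0 x"
    then have y: "\<bar>y\<bar> \<le> \<bar>x\<bar>" by (auto simp: closed_segment_eq_real_ivl split: if_splits)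
    then have y': "1 / 2 \<le> 1 + y" using assms by linarith
    show "((\<lambda>x. ln (1 + x) - x + x\<^sup>2 / 2) has_field_derivative y\<^sup>2 / (1 + y)) (at y within closed_segment 0 x)"
      by (rule has_field_derivative_at_within)
        (use y' in \<open>auto intro!: derivative_eq_intros simp: field_simps power2_eq_square\<close>)
    have "y\<^sup>2 / (1 + y) \<le> x\<^sup>2 / (1 / 2)"
      by (rule frac_le) (use y y' in \<open>auto simp: abs_le_square_iff\<close>)
    then show "norm (y\<^sup>2 / (1 + y)) \<le> 2 * x\<^sup>2" using y' by simp
  qed auto
  then show ?thesis by (simp add: power3_eq_cube power2_eq_square abs_mult_self_eq mult.assoc)
qed

text \<open>\<open>X\<close> holds the terms of order \<open>1 / sqrt n\<close>, \<open>E\<close>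
  all that is smaller. The absolute sums of \<open>E\<close> stay bounded without tending to 0; it
  is the signed sum that vanishes. What the logarithm adds beyond
  \<open>X + E - X\<^sup>2 / 2\<close> is a uniformly small multiple of
  \<open>X\<^sup>2 + \<bar>E\<bar>\<close>.\<close>

lemma sum_ln_expansion:
  fixes X E :: "nat \<Rightarrow> nat \<Rightarrow> real"
  assumes X_max: "\<And>\<delta>. 0 < \<delta> \<Longrightarrow> eventually (\<lambda>n. \<forall>k<n. \<bar>X n k\<bar> \<le> \<delta>) sequentially"
    and X_sq: "(\<lambda>n. \<Sum>k<n. (X n k)\<^sup>2) \<longlonglongrightarrow> v"
    and E_max: "\<And>\<delta>. 0 < \<delta> \<Longrightarrow> eventually (\<lambda>n. \<forall>k<n. \<bar>E n k\<bar> \<le> \<delta>) sequentially"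
    and E_sum: "(\<lambda>n. \<Sum>k<n. E n k) \<longlonglongrightarrow> 0"
    and E_abs: "eventually (\<lambda>n. (\<Sum>k<n. \<bar>E n k\<bar>) \<le> B) sequentially"
  shows "(\<lambda>n. (\<Sum>k<n. ln (1 + X n k + E n k)) - (\<Sum>k<n. X n k)) \<longlonglongrightarrow> - v / 2"
proof -
  let ?R = "\<lambda>n. \<Sum>k<n. ln (1 + X n k + E n k) - X n k - E n k + (X n k)\<^sup>2 / 2"
  have "?R \<longlonglongrightarrow> 0"
  proof (rule LIMSEQ_I)
    fix r :: real assume r: "0 < r"
    define C where "C = \<bar>v\<bar> + 1 + \<bar>B\<bar>"
    have C: "C > 0" by (simp add: C_def)
    \<comment> \<open>The bound 1/4 keeps \<open>\<bar>X + E\<bar>\<close> within the range 1/2 of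
      the logarithm estimate; the 20 gives \<open>10 * \<delta> * C \<le> r / 2\<close>.\<close>
    define \<delta> where "\<delta> = min (1 / 4) (r / (20 * C))"
    have \<delta>: "0 < \<delta>" "\<delta> \<le> 1 / 4" "10 * \<delta> * C < r"
    proof -
      have "10 * \<delta> * C \<le> 10 * (r / (20 * C)) * C"
        using C r by (intro mult_mono) (auto simp: \<delta>_def)
      also have "\<dots> < r" using C r by simp
      finally show "10 * \<delta> * C < r" .
    qed (use r C in \<open>auto simp: \<delta>_def\<close>)
    have "eventually (\<lambda>n. (\<Sum>k<n. (X n k)\<^sup>2) < \<bar>v\<bar> + 1) sequentially"
      by (rule order_tendstoD(2)[OF X_sq]) auto
    with E_abs X_max[OF \<delta>(1)] E_max[OF \<delta>(1)]
    have "eventually (\<lambda>n. norm (?R n - 0) < r) sequentially"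
    proof eventually_elim
      case (elim n)
      \<comment> \<open>The constant is 8 + 1 + 1: the 8 comes from the cubic estimate at
        \<open>x + e\<close>, the others from \<open>x * e\<close> and \<open>e\<^sup>2 / 2\<close>,
        which appear when the square of \<open>x + e\<close> is expanded.\<close>
      have pw: "\<bar>ln (1 + X n k + E n k) - X n k - E n k + (X n k)\<^sup>2 / 2\<bar>
          \<le> 10 * \<delta> * ((X n k)\<^sup>2 + \<bar>E n k\<bar>)" if "k < n" for k
      proof -
        define x where "x = X n k"
        define e where "e = E n k"
        have x: "\<bar>x\<bar> \<le> \<delta>" and e: "\<bar>e\<bar> \<le> \<delta>" using elim that by (auto simp: x_def e_def)
        have d: "\<bar>x + e\<bar> \<le> 2 * \<delta>" using x e by linarith
        have "\<bar>ln (1 + (x + e)) - (x + e) + (x + e)\<^sup>2 / 2\<bar> \<le> 2 * \<bar>x + e\<bar> ^ 3"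
          by (rule ln_one_plus_quadratic_bound) (use d \<delta> in linarith)
        also have "2 * \<bar>x + e\<bar> ^ 3 = 2 * \<bar>x + e\<bar> * (x + e)\<^sup>2"
          by (simp add: power3_eq_cube power2_eq_square abs_mult_self_eq mult.assoc)
        also have "\<dots> \<le> 2 * (2 * \<delta>) * (2 * (x\<^sup>2 + \<bar>e\<bar>))"
        proof (intro mult_mono)
          have "(x + e)\<^sup>2 \<le> 2 * (x\<^sup>2 + e\<^sup>2)" 
            using sum_squares_bound[of x e] by (simp add: power2_sum)
          moreover have "e\<^sup>2 \<le> \<bar>e\<bar>"
          proof -
            have "\<bar>e\<bar> * \<bar>e\<bar> \<le> \<bar>e\<bar> * 1" using e \<delta> by (intro mult_left_mono) auto
            then show ?thesis by (simp add: power2_eq_square)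
          qed
          then have "2 * (x\<^sup>2 + e\<^sup>2) \<le> 2 * (x\<^sup>2 + \<bar>e\<bar>)" by simp
          ultimately show "(x + e)\<^sup>2 \<le> 2 * (x\<^sup>2 + \<bar>e\<bar>)" by (rule order_trans)
        qed (use d \<delta> in auto)
        finally have 1: "\<bar>ln (1 + (x + e)) - (x + e) + (x + e)\<^sup>2 / 2\<bar> \<le> 8 * \<delta> * (x\<^sup>2 + \<bar>e\<bar>)"
          by (simp add: algebra_simps)
        have 2: "\<bar>x * e\<bar> \<le> \<delta> * \<bar>e\<bar>" using x by (simp add: abs_mult mult_right_mono)
        have 3: "\<bar>e\<^sup>2 / 2\<bar> \<le> \<delta> * \<bar>e\<bar>"
        proof -
          have "\<bar>e\<bar> * \<bar>e\<bar> \<le> \<delta> * \<bar>e\<bar>" using e by (intro mult_right_mono) auto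
          moreover have "0 \<le> \<delta> * \<bar>e\<bar>" using \<delta>(1) by simp
          ultimately have "e * e / 2 \<le> \<delta> * \<bar>e\<bar>" by simp
          then show ?thesis using zero_le_square[of e] by (simp add: power2_eq_square)
        qed
        have "ln (1 + x + e) - x - e + x\<^sup>2 / 2
           = (ln (1 + (x + e)) - (x + e) + (x + e)\<^sup>2 / 2) - x * e - e\<^sup>2 / 2"
          by (simp add: power2_sum add.assoc field_simps)
        with 1 2 3 have "\<bar>ln (1 + x + e) - x - e + x\<^sup>2 / 2\<bar> \<le> 8 * \<delta> * (x\<^sup>2 + \<bar>e\<bar>) + 2 * (\<delta> * \<bar>e\<bar>)"
          by linarith
        also have "\<dots> \<le> 10 * \<delta> * (x\<^sup>2 + \<bar>e\<bar>)" using \<delta>(1) by (simp add: algebra_simps)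
        finally show ?thesis by (simp add: x_def e_def)
      qed
      have "\<bar>?R n\<bar> \<le> (\<Sum>k<n. 10 * \<delta> * ((X n k)\<^sup>2 + \<bar>E n k\<bar>))"
        by (rule order_trans[OF sum_abs]) (intro sum_mono pw, simp)
      also have "\<dots> = 10 * \<delta> * ((\<Sum>k<n. (X n k)\<^sup>2) + (\<Sum>k<n. \<bar>E n k\<bar>))"
        by (simp add: sum_distrib_left sum.distrib distrib_left)
      also have "\<dots> \<le> 10 * \<delta> * C"
        using elim \<delta>(1) by (intro mult_left_mono) (auto simp: C_def)
      finally show ?case using \<delta>(3) by simp
    qed
    then show "\<exists>no. \<forall>n\<ge>no. norm (?R n - 0) < r" by (simp add: eventually_sequentially)
  qed
  then have "(\<lambda>n. ?R n + (\<Sum>k<n. E n k) - (\<Sum>k<n. (X n k)\<^sup>2) / 2) \<longlonglongrightarrow> 0 + 0 - v / 2"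
    by (intro tendsto_intros E_sum X_sq) auto
  then show ?thesis
    by (simp add: sum.distrib sum_subtractf sum_divide_distrib algebra_simps)
qed

text \<open>\<open>q k / n\<close> is the second-order term, \<open>p k\<close> the dominating
  factor and \<open>w k\<close> the unscaled size of the perturbation. Of the cube of
  \<open>w k / sqrt n\<close>, one factor is uniformly below \<open>\<eta>\<close>; the other two,
  multiplied by \<open>p k\<close>, form a convergent average.\<close>

lemma array_remainder:
  fixes p q w :: "nat \<Rightarrow> real" and E :: "nat \<Rightarrow> nat \<Rightarrow> real"
  assumes q_avg: "(\<lambda>n. (\<Sum>k<n. q k) / real n) \<longlonglongrightarrow> 0"
    and q_abs: "(\<lambda>n. (\<Sum>k<n. \<bar>q k\<bar>) / real n) \<longlonglongrightarrow> Lq"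
    and w_sq: "(\<lambda>n. (\<Sum>k<n. (w k)\<^sup>2) / real n) \<longlonglongrightarrow> Lw"
    and pw: "(\<lambda>n. (\<Sum>k<n. p k * (w k)\<^sup>2) / real n) \<longlonglongrightarrow> Lp"
    and p: "\<And>k. 0 \<le> p k" and w: "\<And>k. 0 \<le> w k" and r: "0 < r"
    and E: "\<And>n k. 0 < n \<Longrightarrow> k < n \<Longrightarrow> w k / sqrt (real n) < r \<Longrightarrow>
      \<bar>E n k - q k / real n\<bar> \<le> p k * (w k / sqrt (real n)) ^ 3"
  shows "\<And>\<delta>. 0 < \<delta> \<Longrightarrow> eventually (\<lambda>n. \<forall>k<n. \<bar>E n k\<bar> \<le> \<delta>) sequentially"
    and "(\<lambda>n. \<Sum>k<n. E n k) \<longlonglongrightarrow> 0"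
    and "eventually (\<lambda>n. (\<Sum>k<n. \<bar>E n k\<bar>) \<le> Lq + 2) sequentially"
proof -
  have rem: "eventually (\<lambda>n. 0 < n \<and> (\<Sum>k<n. \<bar>E n k - q k / real n\<bar>) < \<delta>) sequentially" if \<delta>: "0 < \<delta>" for \<delta>
  proof -
    define K where "K = \<bar>Lp\<bar> + 1"
    have K: "0 < K" by (simp add: K_def)
    \<comment> \<open>\<open>r / 2\<close> puts every perturbation strictly inside the neighbourhood
      where \<open>E\<close> is estimated; \<open>\<delta> / (2 * K)\<close> pays for an average
      that stays below \<open>K\<close>.\<close>
    define \<eta> where "\<eta> = min (r / 2) (\<delta> / (2 * K))"
    have \<eta>: "0 < \<eta>" "\<eta> < r" "\<eta> * K < \<delta>"
    proof -
      have "\<eta> * K \<le> \<delta> / (2 * K) * K" using K by (intro mult_right_mono) (auto simp: \<eta>_def)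
      also have "\<dots> < \<delta>" using K \<delta> by simp
      finally show "\<eta> * K < \<delta>" .
    qed (use r K \<delta> in \<open>auto simp: \<eta>_def\<close>)
    have "eventually (\<lambda>n. (\<Sum>k<n. p k * (w k)\<^sup>2) / real n < K) sequentially"
      by (rule order_tendstoD(2)[OF pw]) (simp add: K_def)
    moreover have "eventually (\<lambda>n. \<forall>k<n. \<bar>(w k)\<^sup>2\<bar> \<le> \<eta>\<^sup>2 * real n) sequentially"
      by (rule average_convergent_imp_max_negligible[OF w_sq]) (use \<eta> in simp)
    ultimately show ?thesis using eventually_gt_at_top[of 0]
    proof eventually_elim
      case (elim n)
      have small: "w k / sqrt (real n) \<le> \<eta>" if "k < n" for k
      proof -
        have "(w k)\<^sup>2 \<le> \<eta>\<^sup>2 * real n" using elim that by auto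
        then have "(w k)\<^sup>2 \<le> (\<eta> * sqrt (real n))\<^sup>2" by (simp add: power_mult_distrib)
        then have "w k \<le> \<eta> * sqrt (real n)" by (rule power2_le_imp_le) (use \<eta> in auto)
        then show ?thesis using elim by (simp add: pos_divide_le_eq)
      qed
      have "(\<Sum>k<n. \<bar>E n k - q k / real n\<bar>) \<le> (\<Sum>k<n. \<eta> * (p k * (w k)\<^sup>2 / real n))"
      proof (rule sum_mono)
        fix k assume "k \<in> {..<n}"
        then have k: "k < n" by simp
        define y where "y = w k / sqrt (real n)"
        have y: "0 \<le> y" "y \<le> \<eta>" using small[OF k] w[of k] by (auto simp: y_def)
        have "\<bar>E n k - q k / real n\<bar> \<le> p k * y ^ 3"
          unfolding y_def using E[of n k] k elim small[OF k] \<eta> by simp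
        also have "p k * y ^ 3 = y * (p k * y\<^sup>2)" by (simp add: power3_eq_cube power2_eq_square)
        also have "\<dots> \<le> \<eta> * (p k * y\<^sup>2)" using y p[of k] by (intro mult_right_mono) auto
        also have "y\<^sup>2 = (w k)\<^sup>2 / real n" by (simp add: y_def power_divide)
        finally show "\<bar>E n k - q k / real n\<bar> \<le> \<eta> * (p k * (w k)\<^sup>2 / real n)" by simp
      qed
      also have "\<dots> = \<eta> * ((\<Sum>k<n. p k * (w k)\<^sup>2) / real n)"
        by (simp add: sum_distrib_left sum_divide_distrib)
      also have "\<dots> \<le> \<eta> * K" using elim \<eta> by (intro mult_left_mono) auto
      finally show ?case using \<eta>(3) elim by simp
    qed
  qed
  show "eventually (\<lambda>n. \<forall>k<n. \<bar>E n k\<bar> \<le> \<delta>) sequentially" if \<delta>: "0 < \<delta>" for \<delta>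
  proof -
    have half: "0 < \<delta> / 2" using \<delta> by simp
    from rem[OF half] average_convergent_imp_max_negligible[OF q_abs half] show ?thesis
    proof eventually_elim
      case (elim n)
      show ?case
      proof (intro allI impI)
        fix k assume k: "k < n"
        have "\<bar>E n k - q k / real n\<bar> \<le> (\<Sum>k<n. \<bar>E n k - q k / real n\<bar>)"
          using k by (intro member_le_sum) auto
        moreover have "\<bar>q k / real n\<bar> \<le> \<delta> / 2" using elim k by (auto simp: pos_divide_le_eq)
        ultimately show "\<bar>E n k\<bar> \<le> \<delta>" using elim by linarith
      qed
    qed
  qed
  have "(\<lambda>n. (\<Sum>k<n. E n k) - (\<Sum>k<n. q k) / real n) \<longlonglongrightarrow> 0"
  proof (rule LIMSEQ_I)
    fix \<delta> :: real assume "0 < \<delta>"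
    from rem[OF this] have "eventually (\<lambda>n. norm ((\<Sum>k<n. E n k) - (\<Sum>k<n. q k) / real n - 0) < \<delta>) sequentially"
    proof eventually_elim
      case (elim n)
      have "(\<Sum>k<n. E n k) - (\<Sum>k<n. q k) / real n = (\<Sum>k<n. E n k - q k / real n)"
        by (simp add: sum_subtractf sum_divide_distrib)
      also have "\<bar>\<dots>\<bar> \<le> (\<Sum>k<n. \<bar>E n k - q k / real n\<bar>)" by (rule sum_abs)
      finally show ?case using elim by simp
    qed
    then show "\<exists>no. \<forall>n\<ge>no. norm ((\<Sum>k<n. E n k) - (\<Sum>k<n. q k) / real n - 0) < \<delta>"
      by (simp only: eventually_sequentially)
  qed
  from tendsto_add[OF this q_avg] show "(\<lambda>n. \<Sum>k<n. E n k) \<longlonglongrightarrow> 0" by simp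
  \<comment> \<open>The 2 in the bound is one unit for the remainder and one for the deviation of
    this average from its limit \<open>Lq\<close>.\<close>
  have "eventually (\<lambda>n. (\<Sum>k<n. \<bar>q k\<bar>) / real n < Lq + 1) sequentially"
    by (rule order_tendstoD(2)[OF q_abs]) simp
  with rem[OF zero_less_one] show "eventually (\<lambda>n. (\<Sum>k<n. \<bar>E n k\<bar>) \<le> Lq + 2) sequentially"
  proof eventually_elim
    case (elim n)
    have "(\<Sum>k<n. \<bar>E n k\<bar>) \<le> (\<Sum>k<n. \<bar>E n k - q k / real n\<bar> + \<bar>q k\<bar> / real n)"
    proof (rule sum_mono)
      fix k
      have "\<bar>q k / real n\<bar> = \<bar>q k\<bar> / real n" by simp
      then show "\<bar>E n k\<bar> \<le> \<bar>E n k - q k / real n\<bar> + \<bar>q k\<bar> / real n" by linarith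
    qed
    also have "\<dots> = (\<Sum>k<n. \<bar>E n k - q k / real n\<bar>) + (\<Sum>k<n. \<bar>q k\<bar>) / real n"
      by (simp add: sum.distrib sum_divide_distrib)
    finally show ?case using elim by linarith
  qed
qed

section \<open>The martingale central limit theorem\<close>

text \<open>The squared modulus of \<open>1 + \<i> * x\<close> is
  \<open>1 + x\<^sup>2 \<le> exp (x\<^sup>2)\<close>. With factors of modulus at most 1, products
  can be compared factor by factor.\<close>

lemma cmod_one_plus_i_mult_exp_le:
  fixes x :: real
  shows "cmod ((1 + \<i> * x) * exp (- x\<^sup>2 / 2)) \<le> 1"
proof -
  have "(1 + x\<^sup>2) \<le> (exp (x\<^sup>2 / 2))\<^sup>2"
    using exp_ge_add_one_self[of "x\<^sup>2"] by (simp add: power2_eq_square exp_add[symmetric])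
  then have "cmod (1 + \<i> * x) \<le> exp (x\<^sup>2 / 2)"
    by (simp add: cmod_def real_le_lsqrt)
  then have "cmod ((1 + \<i> * x) * exp (- x\<^sup>2 / 2)) \<le> exp (x\<^sup>2 / 2) * exp (- x\<^sup>2 / 2)"
    unfolding norm_mult by (intro mult_mono) auto
  also have "\<dots> = 1" by (simp add: exp_minus)
  finally show ?thesis .
qed

text \<open>For \<open>\<bar>x\<bar> \<le> 1\<close> the two functions agree to second order:
  \<open>(1 + \<i> * x) * (1 - x\<^sup>2 / 2)\<close> exceeds the quadratic Taylor polynomial only
  by \<open>- \<i> * x ^ 3 / 2\<close>, and the constants 1/6 + 1/2 + 1/2 add up to less than 2. For
  larger \<open>\<bar>x\<bar>\<close> both have modulus at most 1.\<close>

lemma iexp_quadratic_approx: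
  fixes x :: real
  shows "cmod (iexp x - (1 + \<i> * x) * exp (- x\<^sup>2 / 2)) \<le> 2 * \<bar>x\<bar> ^ 3"
proof (cases "\<bar>x\<bar> \<le> 1")
  case True
  have cube: "\<bar>x\<bar> ^ 3 = \<bar>x\<bar> * x\<^sup>2" by (simp add: power3_eq_cube power2_eq_square mult.assoc)
  have fourth: "x ^ 4 = x\<^sup>2 * x\<^sup>2" by (simp add: power2_eq_square numeral_eq_Suc)
  have le1: "x ^ 4 \<le> \<bar>x\<bar> ^ 3"
    using power_decreasing[of 3 4 "\<bar>x\<bar>"] True by simp
  define p where "p = exp (- x\<^sup>2 / 2) - (1 - x\<^sup>2 / 2)"
  have p: "\<bar>p\<bar> \<le> x ^ 4 / 4"
  proof -
    have 1: "0 \<le> p" using exp_ge_add_one_self[of "- x\<^sup>2 / 2"] by (simp add: p_def)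
    have pos: "0 < 1 + x\<^sup>2 / 2" using zero_le_power2[of x] by linarith
    \<comment> \<open>With \<open>y = x\<^sup>2 / 2\<close>, the chain is
      \<open>exp (- y) \<le> 1 / (1 + y) \<le> 1 - y + y\<^sup>2\<close>; the last term is the
      \<open>x ^ 4 / 4\<close> in the bound of \<open>p\<close>.\<close>
    have "exp (- (x\<^sup>2 / 2)) \<le> 1 / (1 + x\<^sup>2 / 2)"
      using exp_ge_add_one_self[of "x\<^sup>2 / 2"] pos
      by (simp add: exp_minus inverse_eq_divide) (intro divide_left_mono, auto)
    also have "\<dots> \<le> 1 - x\<^sup>2 / 2 + (x\<^sup>2 / 2)\<^sup>2"
    proof -
      have "1 \<le> (1 - y + y\<^sup>2) * (1 + y)" if "0 \<le> y" for y :: real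
        using that by (simp add: algebra_simps power2_eq_square)
      from this[of "x\<^sup>2 / 2"] show ?thesis using pos by (subst pos_divide_le_eq) auto
    qed
    also have "(x\<^sup>2 / 2)\<^sup>2 = x ^ 4 / 4" by (simp add: power_divide fourth power2_eq_square)
    finally have "exp (- (x\<^sup>2 / 2)) \<le> 1 - x\<^sup>2 / 2 + x ^ 4 / 4" .
    then have "p \<le> x ^ 4 / 4" by (simp add: p_def)
    with 1 show ?thesis by simp
  qed
  have "cmod (iexp x - (\<Sum>k \<le> 2. (\<i> * x)^k / fact k)) \<le> \<bar>x\<bar> ^ 3 / fact 3"
    using iexp_approx1[of x 2] by (simp add: numeral_3_eq_3)
  moreover have "(\<Sum>k \<le> 2. (\<i> * x)^k / fact k) = 1 + \<i> * x - x\<^sup>2 / 2"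
    by (simp add: numeral_2_eq_2 complex_eq_iff)
  ultimately have 1: "cmod (iexp x - (1 + \<i> * x - x\<^sup>2 / 2)) \<le> \<bar>x\<bar> ^ 3 / 6"
    by (simp add: fact_numeral)
  have "iexp x - (1 + \<i> * x) * exp (- x\<^sup>2 / 2)
     = (iexp x - (1 + \<i> * x - x\<^sup>2 / 2)) + \<i> * of_real (x ^ 3 / 2) - (1 + \<i> * x) * of_real p"
    by (simp add: p_def algebra_simps power2_eq_square power3_eq_cube exp_of_real)
  also have "cmod \<dots> \<le> \<bar>x\<bar> ^ 3 / 6 + \<bar>x\<bar> ^ 3 / 2 + 2 * (x ^ 4 / 4)"
  proof (rule order_trans[OF norm_triangle_ineq4 add_mono[OF order_trans[OF norm_triangle_ineq add_mono[OF 1]]]])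
    show "cmod (\<i> * of_real (x ^ 3 / 2)) \<le> \<bar>x\<bar> ^ 3 / 2"
      by (simp add: norm_mult norm_divide norm_power)
    have "cmod (1 + \<i> * x) \<le> 2"
      using norm_triangle_ineq[of 1 "\<i> * x"] True by (simp add: norm_mult)
    then show "cmod ((1 + \<i> * x) * of_real p) \<le> 2 * (x ^ 4 / 4)"
      unfolding norm_mult using p by (intro mult_mono) auto
  qed
  also have "\<dots> \<le> 2 * \<bar>x\<bar> ^ 3" using le1 zero_le_power[of "\<bar>x\<bar>" 3] by linarith
  finally show ?thesis .
next
  case False
  have "cmod (iexp x - (1 + \<i> * x) * exp (- x\<^sup>2 / 2)) \<le> 1 + 1"
    by (rule order_trans[OF norm_triangle_ineq4 add_mono[OF _ cmod_one_plus_i_mult_exp_le]]) simp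
  also have "\<dots> \<le> 2 * \<bar>x\<bar> ^ 3" using False one_le_power[of "\<bar>x\<bar>" 3] by simp
  finally show ?thesis .
qed

lemma real_distribution_normal_law: "0 \<le> v \<Longrightarrow> real_distribution (normal_law \<mu> v)"
  by (auto simp: normal_law_def real_distribution_def real_distribution_axioms_def
      intro!: prob_space_return prob_space_normal_density)

text \<open>Rescaling by \<open>sqrt v\<close> reduces to the standard normal law; for
  \<open>v = 0\<close> the point mass at 0 has characteristic function 1, as the formula
  says.\<close>

lemma char_normal_law:
  assumes "0 \<le> v"
  shows "char (normal_law 0 v) t = exp (- t\<^sup>2 * v / 2)"
proof (cases "v = 0")
  case True
  then show ?thesis by (simp add: normal_law_def char_def integral_return)
next
  case False
  with assms have v: "0 < sqrt v" by simp
  have "char (normal_law 0 v) t = (\<integral>x. normal_density 0 (sqrt v) x *\<^sub>R iexp (t * x) \<partial>lborel)"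
    using False unfolding normal_law_def char_def
    by (simp, subst integral_density) auto
  also have "\<dots> = sqrt v *\<^sub>R (\<integral>x. normal_density 0 (sqrt v) (0 + sqrt v * x) *\<^sub>R iexp (t * (0 + sqrt v * x)) \<partial>lborel)"
    using v by (subst lborel_integral_real_affine[where c = "sqrt v" and t = 0]) auto
  also have "\<dots> = (\<integral>x. std_normal_density x *\<^sub>R iexp ((t * sqrt v) * x) \<partial>lborel)"
    using v assms by (subst integral_scaleR_right[symmetric])
      (intro Bochner_Integration.integral_cong, auto simp: normal_density_def real_sqrt_mult field_simps power_mult_distrib)
  also have "\<dots> = char std_normal_distribution (t * sqrt v)"
    unfolding char_def by (subst integral_density) auto
  also have "\<dots> = exp (- t\<^sup>2 * v / 2)"
    using assms by (simp add: char_std_normal_distribution power_mult_distrib exp_of_real)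
  finally show ?thesis .
qed

text \<open>The stopping test looks at the sum before \<open>k\<close>, so at most one retained term
  overshoots the level \<open>K\<close>. The factors before it are bounded by exponentials, together
  at most \<open>exp (a * K)\<close>; the overshooting factor is kept linear, so the bound is
  integrable as soon as the \<open>y k\<close> are. The second conjunct carries the induction while
  the sum is still at most \<open>K\<close>.\<close>

lemma stopped_product_bound:
  fixes y :: "nat \<Rightarrow> real"
  assumes y: "\<And>k. 0 \<le> y k" and a: "0 \<le> a" and K: "0 \<le> K"
  defines "z \<equiv> \<lambda>k. if (\<Sum>j<k. y j) \<le> K then y k else 0"
  shows "(\<Prod>k<m. 1 + a * z k) \<le> exp (a * K) * (1 + a * (\<Sum>k<m. y k)) \<and>
    ((\<Sum>k<m. y k) \<le> K \<longrightarrow> (\<Prod>k<m. 1 + a * z k) \<le> exp (a * (\<Sum>k<m. y k)))"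
proof (induction m)
  case 0
  show ?case using a K by simp
next
  case (Suc m)
  let ?P = "\<Prod>k<m. 1 + a * z k" and ?s = "\<Sum>k<m. y k"
  have P0: "0 \<le> ?P" using a y by (intro prod_nonneg) (auto simp: z_def)
  have s0: "0 \<le> ?s" using y by (intro sum_nonneg) auto
  show ?case
  proof (cases "?s \<le> K")
    case True
    then have z: "z m = y m" by (simp add: z_def)
    have P: "?P \<le> exp (a * ?s)" using Suc True by blast
    have f0: "0 \<le> 1 + a * y m" using a y by (simp add: add_nonneg_nonneg)
    have "?P * (1 + a * y m) \<le> exp (a * K) * (1 + a * (?s + y m))"
    proof (rule mult_mono)
      show "?P \<le> exp (a * K)" using P True a by (meson exp_le_cancel_iff mult_left_mono order_trans)
      show "1 + a * y m \<le> 1 + a * (?s + y m)" using s0 a by (intro add_mono mult_left_mono) auto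
    qed (use f0 in auto)
    moreover have "?P * (1 + a * y m) \<le> exp (a * ?s) * exp (a * y m)"
      using P f0 exp_ge_add_one_self[of "a * y m"] by (intro mult_mono) auto
    ultimately show ?thesis using z by (simp add: exp_add[symmetric] distrib_left add.commute)
  next
    case False
    then have z: "z m = 0" by (simp add: z_def)
    have "?P \<le> exp (a * K) * (1 + a * ?s)" using Suc by blast
    also have "\<dots> \<le> exp (a * K) * (1 + a * (?s + y m))"
      using a y[of m] by (intro mult_left_mono add_left_mono) auto
    finally show ?thesis using z False y[of m] by simp
  qed
qed

text \<open>With \<open>e\<close> the exponential of minus half the stopped sum of squares,
  \<open>T * e\<close> is close to the complex exponential of the normalised sum. Since
  \<open>e\<close> tends to the constant \<open>c\<close>, and \<open>T\<close> has expectation 1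
  and bounded second moments, the expectation of \<open>T * e\<close> tends to \<open>c\<close>, the
  Gaussian characteristic function at \<open>t\<close>. \<open>orth\<close> is the martingale
  difference property, tested against square integrable functions of the past.\<close>

theorem martingale_difference_clt:
  fixes \<xi> :: "nat \<Rightarrow> 'w \<Rightarrow> real" and F :: "nat \<Rightarrow> 'w measure"
  assumes M: "prob_space M"
    and sub: "\<And>k. subalgebra M (F k)"
    and adapted: "\<And>j k. j < k \<Longrightarrow> \<xi> j \<in> borel_measurable (F k)"
    and sq: "\<And>k. integrable M (\<lambda>\<omega>. (\<xi> k \<omega>)\<^sup>2)"
    and sq_le: "\<And>k. (\<integral>\<omega>. (\<xi> k \<omega>)\<^sup>2 \<partial>M) \<le> C"
    and orth: "\<And>k W. W \<in> borel_measurable (F k) \<Longrightarrow> integrable M (\<lambda>\<omega>. (W \<omega>)\<^sup>2) \<Longrightarrow>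
      (\<integral>\<omega>. \<xi> k \<omega> * W \<omega> \<partial>M) = 0"
    and lln: "AE \<omega> in M. (\<lambda>n. (\<Sum>k<n. (\<xi> k \<omega>)\<^sup>2) / real n) \<longlonglongrightarrow> v"
  shows "weak_conv_m (\<lambda>n. distr M borel (\<lambda>\<omega>. (\<Sum>k<n. \<xi> k \<omega>) / sqrt (real n))) (normal_law 0 v)"
proof -
  interpret prob_space M by fact
  have \<xi>_meas [measurable]: "\<xi> k \<in> borel_measurable M" for k
    using measurable_from_subalg[OF sub adapted[of k "Suc k"]] by simp
  have v: "0 \<le> v"
  proof -
    from lln have "\<exists>\<omega>. (\<lambda>n. (\<Sum>k<n. (\<xi> k \<omega>)\<^sup>2) / real n) \<longlonglongrightarrow> v"
      by (metis (mono_tags, lifting) AE_False always_eventually emeasure_space_1 eventually_mono zero_neq_one)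
    then obtain \<omega> where "(\<lambda>n. (\<Sum>k<n. (\<xi> k \<omega>)\<^sup>2) / real n) \<longlonglongrightarrow> v" ..
    then show ?thesis by (rule LIMSEQ_le_const) (auto intro!: exI[of _ 0] divide_nonneg_nonneg sum_nonneg)
  qed
  have C: "0 \<le> C" using order_trans[OF _ sq_le[of 0]] by auto
  show ?thesis
  proof (rule levy_continuity)
    show "real_distribution (normal_law 0 v)" using v by (rule real_distribution_normal_law)
    show "real_distribution (distr M borel (\<lambda>\<omega>. (\<Sum>k<n. \<xi> k \<omega>) / sqrt (real n)))" for n
      by (rule real_distribution_distr) measurable
  next
    fix t :: real
    define y where "y = (\<lambda>n k \<omega>. (\<xi> k \<omega>)\<^sup>2 / real n)"
    \<comment> \<open>The test involves only indices \<open>j < k\<close>, so the factor of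
      \<open>\<xi> k\<close> is measurable with respect to \<open>F k\<close>. The sums of squares
      tend to \<open>v\<close> almost surely, hence the level \<open>v + 1\<close> is eventually not
      exceeded.\<close>
    define x where "x = (\<lambda>n k \<omega>. if (\<Sum>j<k. y n j \<omega>) \<le> v + 1 then \<xi> k \<omega> / sqrt (real n) else 0)"
    define T where "T = (\<lambda>n m \<omega>. \<Prod>k<m. 1 + \<i> * of_real (t * x n k \<omega>))"
    define e where "e = (\<lambda>n \<omega>. exp (- (\<Sum>k<n. (t * x n k \<omega>)\<^sup>2) / 2))"
    define c where "c = exp (- t\<^sup>2 * v / 2)"
    have y0: "0 \<le> y n k \<omega>" for n k \<omega> by (simp add: y_def)
    have x2: "(x n k \<omega>)\<^sup>2 = (if (\<Sum>j<k. y n j \<omega>) \<le> v + 1 then y n k \<omega> else 0)" for n k \<omega>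
      by (simp add: x_def y_def power_divide)
    have [measurable]: "y n k \<in> borel_measurable M" "x n k \<in> borel_measurable M"
      "T n k \<in> borel_measurable M" "e n \<in> borel_measurable M" for n k
      unfolding e_def T_def x_def y_def by measurable
    have norm_T: "(cmod (T n m \<omega>))\<^sup>2 = (\<Prod>k<m. 1 + t\<^sup>2 * (x n k \<omega>)\<^sup>2)" for n m \<omega>
      unfolding T_def prod_norm[symmetric] prod_power_distrib
      by (intro prod.cong) (auto simp: cmod_power2 power_mult_distrib)
    have T_sq: "(cmod (T n m \<omega>))\<^sup>2 \<le> exp (t\<^sup>2 * (v + 1)) * (1 + t\<^sup>2 * (\<Sum>k<m. y n k \<omega>))" for n m \<omega>
      using stopped_product_bound[where y = "\<lambda>k. y n k \<omega>" and a = "t\<^sup>2" and K = "v + 1" and m = m] y0 v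
      by (simp add: norm_T x2)
    have int_y: "integrable M (y n k)" for n k unfolding y_def using sq by simp
    have int_T_bd: "integrable M (\<lambda>\<omega>. exp (t\<^sup>2 * (v + 1)) * (1 + t\<^sup>2 * (\<Sum>k<m. y n k \<omega>)))" for n m
      using int_y by auto
    have int_T_sq: "integrable M (\<lambda>\<omega>. (cmod (T n m \<omega>))\<^sup>2)" for n m
      by (rule Bochner_Integration.integrable_bound[OF int_T_bd[of n m]])
        (use T_sq[of n m] in \<open>auto intro: order_trans[OF _ abs_ge_self]\<close>)
    have int_T: "integrable M (T n m)" for n m
    proof (rule Bochner_Integration.integrable_bound)
      show "integrable M (\<lambda>\<omega>. 1 + (cmod (T n m \<omega>))\<^sup>2)" using int_T_sq by simp
      have "a \<le> 1 + a\<^sup>2" for a :: real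
      proof -
        have "2 * a \<le> a\<^sup>2 + 1" using sum_squares_bound[of a 1] by simp
        then show ?thesis using zero_le_power2[of a] by linarith
      qed
      then show "AE \<omega> in M. cmod (T n m \<omega>) \<le> norm (1 + (cmod (T n m \<omega>))\<^sup>2)"
        by (intro AE_I2) (simp add: add_nonneg_nonneg)
    qed measurable
    \<comment> \<open>Uniformity in \<open>n\<close> is what stopping achieves: the bound on the
      product is linear in the sum of squares, whose expectation is at most
      \<open>C\<close>.\<close>
    have T_bound: "expectation (\<lambda>\<omega>. (cmod (T n n \<omega>))\<^sup>2) \<le> exp (t\<^sup>2 * (v + 1)) * (1 + t\<^sup>2 * C)" for n
    proof -
      have "expectation (\<lambda>\<omega>. (cmod (T n n \<omega>))\<^sup>2)
          \<le> expectation (\<lambda>\<omega>. exp (t\<^sup>2 * (v + 1)) * (1 + t\<^sup>2 * (\<Sum>k<n. y n k \<omega>)))"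
        by (intro integral_mono int_T_sq int_T_bd T_sq)
      also have "\<dots> = exp (t\<^sup>2 * (v + 1)) * (1 + t\<^sup>2 * (\<Sum>k<n. expectation (y n k)))"
        using int_y by (simp add: prob_space)
      also have "(\<Sum>k<n. expectation (y n k)) \<le> (\<Sum>k<n. C / real n)"
        unfolding y_def using sq_le by (intro sum_mono) (simp add: divide_right_mono)
      also have "(\<Sum>k<n. C / real n) \<le> C" using C by simp
      finally show ?thesis by (simp add: mult_left_mono)
    qed
    have T_F: "T n m \<in> borel_measurable (F m)" for n m
    proof -
      have "\<xi> j \<in> borel_measurable (F m)" if "j < m" for j using adapted that by blast
      then have y_F: "y n j \<in> borel_measurable (F m)" if "j < m" for j
        unfolding y_def using that by measurable
      have "x n k \<in> borel_measurable (F m)" if "k < m" for k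
      proof -
        have [measurable]: "(\<lambda>\<omega>. \<Sum>j<k. y n j \<omega>) \<in> borel_measurable (F m)"
          using y_F that by (intro borel_measurable_sum) auto
        have [measurable]: "\<xi> k \<in> borel_measurable (F m)" using adapted that by blast
        show ?thesis unfolding x_def by measurable
      qed
      then show ?thesis unfolding T_def
        by (intro borel_measurable_prod borel_measurable_add borel_measurable_times borel_measurable_of_real) auto
    qed
    \<comment> \<open>The increment from \<open>T n m\<close> to \<open>T n (Suc m)\<close> is
      \<open>\<i> * t * \<xi> m * W\<close>, with \<open>W\<close> square integrable and measurable
      in the past; \<open>orth\<close> annihilates its real and imaginary parts.\<close>
    have ET: "expectation (T n m) = 1" for n m
    proof (induction m)
      case 0
      show ?case by (simp add: T_def prob_space)
    next
      case (Suc m)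
      define W where "W = (\<lambda>\<omega>. (if (\<Sum>j<m. y n j \<omega>) \<le> v + 1 then 1 / sqrt (real n) else 0) *\<^sub>R T n m \<omega>)"
      have W_F: "W \<in> borel_measurable (F m)"
      proof -
        have [measurable]: "y n j \<in> borel_measurable (F m)" if "j < m" for j
          unfolding y_def using adapted[OF that] by measurable
        have [measurable]: "(\<lambda>\<omega>. \<Sum>j<m. y n j \<omega>) \<in> borel_measurable (F m)"
          by (intro borel_measurable_sum) auto
        note T_F[of n m, measurable]
        show ?thesis unfolding W_def by measurable
      qed
      have W_M [measurable]: "W \<in> borel_measurable M" using measurable_from_subalg[OF sub W_F] .
      have W_sq: "integrable M (\<lambda>\<omega>. (cmod (W \<omega>))\<^sup>2)"
      proof (rule Bochner_Integration.integrable_bound)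
        show "integrable M (\<lambda>\<omega>. (1 / real n) * (cmod (T n m \<omega>))\<^sup>2)" using int_T_sq by simp
        show "AE \<omega> in M. norm ((cmod (W \<omega>))\<^sup>2) \<le> norm ((1 / real n) * (cmod (T n m \<omega>))\<^sup>2)"
          by (auto simp: W_def power_mult_distrib power_divide)
      qed measurable
      have part_sq: "integrable M (\<lambda>\<omega>. (Re (W \<omega>))\<^sup>2)" "integrable M (\<lambda>\<omega>. (Im (W \<omega>))\<^sup>2)"
        by (rule Bochner_Integration.integrable_bound[OF W_sq]; simp add: cmod_power2)+
      have part_F: "(\<lambda>\<omega>. Re (W \<omega>)) \<in> borel_measurable (F m)" "(\<lambda>\<omega>. Im (W \<omega>)) \<in> borel_measurable (F m)"
        using W_F by measurable
      have int_W: "integrable M (\<lambda>\<omega>. \<xi> m \<omega> *\<^sub>R W \<omega>)"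
      proof (rule Bochner_Integration.integrable_bound)
        show "integrable M (\<lambda>\<omega>. (\<xi> m \<omega>)\<^sup>2 + (cmod (W \<omega>))\<^sup>2)" using sq W_sq by simp
        have "\<bar>a\<bar> * b \<le> a\<^sup>2 + b\<^sup>2" if "0 \<le> b" for a b :: real
        proof -
          have "0 \<le> \<bar>a\<bar> * b" using that by simp
          then show ?thesis using sum_squares_bound[of "\<bar>a\<bar>" b] by simp
        qed
        then show "AE \<omega> in M. norm (\<xi> m \<omega> *\<^sub>R W \<omega>) \<le> norm ((\<xi> m \<omega>)\<^sup>2 + (cmod (W \<omega>))\<^sup>2)"
          by (intro AE_I2) simp
      qed measurable
      have "(\<integral>\<omega>. \<xi> m \<omega> *\<^sub>R W \<omega> \<partial>M) = 0"
      proof (rule complex_eqI)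
        show "Re (\<integral>\<omega>. \<xi> m \<omega> *\<^sub>R W \<omega> \<partial>M) = Re 0"
          using orth[OF part_F(1) part_sq(1)] int_W by (simp add: integral_Re[symmetric])
        show "Im (\<integral>\<omega>. \<xi> m \<omega> *\<^sub>R W \<omega> \<partial>M) = Im 0"
          using orth[OF part_F(2) part_sq(2)] int_W by (simp add: integral_Im[symmetric])
      qed
      moreover have "T n (Suc m) = (\<lambda>\<omega>. T n m \<omega> + (\<i> * of_real t) * (\<xi> m \<omega> *\<^sub>R W \<omega>))"
        by (rule ext) (simp add: T_def W_def x_def scaleR_conv_of_real algebra_simps)
      moreover have "expectation (\<lambda>\<omega>. T n m \<omega> + (\<i> * of_real t) * (\<xi> m \<omega> *\<^sub>R W \<omega>))
          = expectation (T n m) + (\<i> * of_real t) * expectation (\<lambda>\<omega>. \<xi> m \<omega> *\<^sub>R W \<omega>)"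
        by (subst Bochner_Integration.integral_add[OF int_T integrable_mult_right[OF int_W]])
          (simp only: integral_mult_right_zero)
      ultimately show ?case by (simp only: Suc mult_zero_right add_0_right)
    qed
    have e01: "0 \<le> e n \<omega>" "e n \<omega> \<le> 1" for n \<omega> unfolding e_def by (auto intro!: sum_nonneg)
    have c01: "0 \<le> c" "c \<le> 1" using v by (auto simp: c_def)
    have ec_le: "(e n \<omega> - c)\<^sup>2 \<le> 1" for n \<omega>
      using e01[of n \<omega>] c01 by (simp add: abs_square_le_1 abs_le_iff)
    \<comment> \<open>Giving each factor its own Gaussian weight makes every factor of modulus at
      most 1, although \<open>T\<close> alone need not be bounded.\<close>
    have Te: "T n n \<omega> * e n \<omega> = (\<Prod>k<n. (1 + \<i> * of_real (t * x n k \<omega>)) * exp (- (t * x n k \<omega>)\<^sup>2 / 2))" for n \<omega>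
    proof -
      have "(\<Prod>k<n. exp (- (t * x n k \<omega>)\<^sup>2 / 2)) = e n \<omega>"
        unfolding e_def by (subst exp_sum[symmetric]) (auto simp: sum_negf sum_divide_distrib)
      then show ?thesis by (simp only: T_def prod.distrib of_real_prod[symmetric])
    qed
    have Te_le: "cmod (T n n \<omega> * e n \<omega>) \<le> 1" for n \<omega>
      unfolding Te prod_norm[symmetric]
      by (intro prod_le_1 conjI norm_ge_zero) (rule cmod_one_plus_i_mult_exp_le)
    have e_lim: "AE \<omega> in M. (\<lambda>n. e n \<omega>) \<longlonglongrightarrow> c"
      and I_lim: "AE \<omega> in M. (\<lambda>n. iexp (t * ((\<Sum>k<n. \<xi> k \<omega>) / sqrt (real n))) - T n n \<omega> * e n \<omega>) \<longlonglongrightarrow> 0"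
    proof -
      have both: "AE \<omega> in M. (\<lambda>n. e n \<omega>) \<longlonglongrightarrow> c \<and>
        (\<lambda>n. iexp (t * ((\<Sum>k<n. \<xi> k \<omega>) / sqrt (real n))) - T n n \<omega> * e n \<omega>) \<longlonglongrightarrow> 0"
        using lln
      proof eventually_elim
        case (elim \<omega>)
        then have ylim: "(\<lambda>n. \<Sum>k<n. y n k \<omega>) \<longlonglongrightarrow> v" by (simp add: y_def sum_divide_distrib)
        then have "eventually (\<lambda>n. (\<Sum>k<n. y n k \<omega>) < v + 1) sequentially"
          by (rule order_tendstoD) simp
        \<comment> \<open>The partial sums of squares increase with \<open>k\<close>, so a total
          below \<open>v + 1\<close> means that no term was stopped.\<close>
        then have unstopped: "eventually (\<lambda>n. \<forall>k<n. x n k \<omega> = \<xi> k \<omega> / sqrt (real n)) sequentially"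
        proof eventually_elim
          case (elim n)
          have "(\<Sum>j<k. y n j \<omega>) \<le> (\<Sum>k<n. y n k \<omega>)" if "k < n" for k
            using that y0 by (intro sum_mono2) auto
          with elim show ?case by (force simp: x_def)
        qed
        have x_sq: "(\<lambda>n. \<Sum>k<n. (t * x n k \<omega>)\<^sup>2) \<longlonglongrightarrow> t\<^sup>2 * v"
        proof (rule Lim_transform_eventually)
          show "(\<lambda>n. t\<^sup>2 * (\<Sum>k<n. y n k \<omega>)) \<longlonglongrightarrow> t\<^sup>2 * v" by (intro tendsto_intros ylim)
          show "eventually (\<lambda>n. t\<^sup>2 * (\<Sum>k<n. y n k \<omega>) = (\<Sum>k<n. (t * x n k \<omega>)\<^sup>2)) sequentially"
            using unstopped
            by eventually_elim (simp add: sum_distrib_left power_mult_distrib power_divide y_def)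
        qed
        have "(\<lambda>n. e n \<omega>) \<longlonglongrightarrow> exp (- (t\<^sup>2 * v) / 2)" unfolding e_def by (intro tendsto_intros x_sq) auto
        then have e: "(\<lambda>n. e n \<omega>) \<longlonglongrightarrow> c" by (simp add: c_def)
        have "(\<lambda>n. iexp (t * ((\<Sum>k<n. \<xi> k \<omega>) / sqrt (real n))) - T n n \<omega> * e n \<omega>) \<longlonglongrightarrow> 0"
        proof (rule LIMSEQ_I)
          fix r :: real assume r: "0 < r"
          define B where "B = t\<^sup>2 * v + 1"
          have B: "0 < B" using v by (simp add: B_def add_nonneg_pos)
          \<comment> \<open>The final estimate is \<open>2 * \<delta> * B = r / 2\<close>.\<close>
          define \<delta> where "\<delta> = r / (4 * B)"
          have \<delta>: "0 < \<delta>" using r B by (simp add: \<delta>_def)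
          \<comment> \<open>It is a square because negligibility is applied to the squares of the
            \<open>\<xi> k\<close>; \<open>1 + \<bar>t\<bar>\<close> in place of
            \<open>\<bar>t\<bar>\<close> covers \<open>t = 0\<close>.\<close>
          define \<eta> where "\<eta> = (\<delta> / (1 + \<bar>t\<bar>))\<^sup>2"
          have \<eta>: "0 < \<eta>" using \<delta> by (simp add: \<eta>_def zero_less_divide_iff add_pos_nonneg)
          have "eventually (\<lambda>n. (\<Sum>k<n. (t * x n k \<omega>)\<^sup>2) < B) sequentially"
            by (rule order_tendstoD(2)[OF x_sq]) (simp add: B_def)
          with unstopped eventually_gt_at_top[of 0] average_convergent_imp_max_negligible[OF elim \<eta>]
          have "eventually (\<lambda>n. norm (iexp (t * ((\<Sum>k<n. \<xi> k \<omega>) / sqrt (real n))) - T n n \<omega> * e n \<omega> - 0) < r) sequentially"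
          proof eventually_elim
            case (elim n)
            have small: "\<bar>t * x n k \<omega>\<bar> \<le> \<delta>" if "k < n" for k
            proof -
              have "(x n k \<omega>)\<^sup>2 \<le> \<eta>"
                using elim that by (simp add: power_divide pos_divide_le_eq)
              then have "\<bar>x n k \<omega>\<bar> \<le> \<delta> / (1 + \<bar>t\<bar>)"
                using \<delta> abs_le_square_iff[of "x n k \<omega>" "\<delta> / (1 + \<bar>t\<bar>)"] by (simp add: \<eta>_def)
              then have "\<bar>t\<bar> * \<bar>x n k \<omega>\<bar> \<le> (1 + \<bar>t\<bar>) * (\<delta> / (1 + \<bar>t\<bar>))"
                using \<delta> by (intro mult_mono) auto
              also have "\<dots> = \<delta>" using abs_ge_zero[of t] by (simp add: add_nonneg_eq_0_iff)
              finally show ?thesis by (simp add: abs_mult)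
            qed
            have "(\<Prod>k<n. iexp (t * x n k \<omega>)) = iexp (\<Sum>k<n. t * x n k \<omega>)"
              by (simp add: exp_sum[symmetric] sum_distrib_left)
            also have "(\<Sum>k<n. t * x n k \<omega>) = t * ((\<Sum>k<n. \<xi> k \<omega>) / sqrt (real n))"
              using elim by (simp add: sum_distrib_left sum_divide_distrib)
            finally have I: "iexp (t * ((\<Sum>k<n. \<xi> k \<omega>) / sqrt (real n))) = (\<Prod>k<n. iexp (t * x n k \<omega>))" ..
            have "norm (iexp (t * ((\<Sum>k<n. \<xi> k \<omega>) / sqrt (real n))) - T n n \<omega> * e n \<omega>)
              \<le> (\<Sum>k<n. norm (iexp (t * x n k \<omega>) - (1 + \<i> * of_real (t * x n k \<omega>)) * exp (- (t * x n k \<omega>)\<^sup>2 / 2)))"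
              unfolding I Te by (rule norm_prod_diff) (simp, rule cmod_one_plus_i_mult_exp_le)
            also have "\<dots> \<le> (\<Sum>k<n. 2 * \<bar>t * x n k \<omega>\<bar> ^ 3)"
              by (intro sum_mono iexp_quadratic_approx)
            also have "\<dots> \<le> (\<Sum>k<n. 2 * \<delta> * (t * x n k \<omega>)\<^sup>2)"
            proof (rule sum_mono)
              fix k assume "k \<in> {..<n}"
              then have "\<bar>t * x n k \<omega>\<bar> * (t * x n k \<omega>)\<^sup>2 \<le> \<delta> * (t * x n k \<omega>)\<^sup>2"
                using small[of k] by (intro mult_right_mono) auto
              moreover have "\<bar>a\<bar> ^ 3 = \<bar>a\<bar> * a\<^sup>2" for a :: real
                by (simp add: power3_eq_cube power2_eq_square mult.assoc)
              ultimately show "2 * \<bar>t * x n k \<omega>\<bar> ^ 3 \<le> 2 * \<delta> * (t * x n k \<omega>)\<^sup>2"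
                by simp
            qed
            also have "\<dots> = 2 * \<delta> * (\<Sum>k<n. (t * x n k \<omega>)\<^sup>2)" by (simp add: sum_distrib_left)
            also have "\<dots> \<le> 2 * \<delta> * B" using elim \<delta> by (intro mult_left_mono) auto
            also have "\<dots> < r" using r B by (simp add: \<delta>_def)
            finally show ?case by simp
          qed
          then show "\<exists>no. \<forall>n\<ge>no. norm (iexp (t * ((\<Sum>k<n. \<xi> k \<omega>) / sqrt (real n))) - T n n \<omega> * e n \<omega> - 0) < r"
            by (simp only: eventually_sequentially)
        qed
        with e show ?case by blast
      qed
      from both show "AE \<omega> in M. (\<lambda>n. e n \<omega>) \<longlonglongrightarrow> c" by eventually_elim blast
      from both show "AE \<omega> in M. (\<lambda>n. iexp (t * ((\<Sum>k<n. \<xi> k \<omega>) / sqrt (real n))) - T n n \<omega> * e n \<omega>) \<longlonglongrightarrow> 0"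
        by eventually_elim blast
    qed
    have int_I: "integrable M (\<lambda>\<omega>. iexp (t * ((\<Sum>k<n. \<xi> k \<omega>) / sqrt (real n))))" for n
      by (rule integrable_const_bound[where B = 1]) auto
    have int_Te: "integrable M (\<lambda>\<omega>. T n n \<omega> * e n \<omega>)" for n
      by (rule integrable_const_bound[where B = 1]) (use Te_le in auto)
    have lim1: "(\<lambda>n. expectation (\<lambda>\<omega>. iexp (t * ((\<Sum>k<n. \<xi> k \<omega>) / sqrt (real n))) - T n n \<omega> * e n \<omega>)) \<longlonglongrightarrow> expectation (\<lambda>\<omega>. 0)"
    proof (rule integral_dominated_convergence[where w = "\<lambda>_. 2"])
      show "AE \<omega> in M. norm (iexp (t * ((\<Sum>k<n. \<xi> k \<omega>) / sqrt (real n))) - T n n \<omega> * e n \<omega>) \<le> 2" for n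
        by (intro AE_I2 order_trans[OF norm_triangle_ineq4 order_trans[OF add_mono[OF _ Te_le]]]) (rule order_refl, simp)
    qed (use I_lim in auto)
    have lim2: "(\<lambda>n. expectation (\<lambda>\<omega>. (e n \<omega> - c)\<^sup>2)) \<longlonglongrightarrow> expectation (\<lambda>\<omega>. 0)"
    proof (rule integral_dominated_convergence[where w = "\<lambda>_. 1"])
      show "AE \<omega> in M. (\<lambda>n. (e n \<omega> - c)\<^sup>2) \<longlonglongrightarrow> 0"
        using e_lim by eventually_elim (auto intro!: tendsto_eq_intros)
      show "AE \<omega> in M. norm ((e n \<omega> - c)\<^sup>2) \<le> 1" for n
        using ec_le by (intro AE_I2) simp
    qed auto
    have lim3: "(\<lambda>n. expectation (\<lambda>\<omega>. T n n \<omega> * e n \<omega>)) \<longlonglongrightarrow> c"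
    proof (rule LIMSEQ_I)
      fix r :: real assume r: "0 < r"
      define K where "K = exp (t\<^sup>2 * (v + 1)) * (1 + t\<^sup>2 * C)"
      have K: "0 < K" using C by (simp add: K_def add_pos_nonneg)
      \<comment> \<open>As \<open>T\<close> has expectation 1, the error is the expectation of
        \<open>T * (e - c)\<close>, split by \<open>a * b \<le> \<delta> * a\<^sup>2 + b\<^sup>2 /
        (4 * \<delta>)\<close>. The first part is at most \<open>\<delta> * K = r / 2\<close>; the
        second is below \<open>r / 2\<close> once the mean square of \<open>e - c\<close> is below
        \<open>2 * r * \<delta>\<close>.\<close>
      define \<delta> where "\<delta> = r / (2 * K)"
      have \<delta>: "0 < \<delta>" using r K by (simp add: \<delta>_def)
      have "eventually (\<lambda>n. expectation (\<lambda>\<omega>. (e n \<omega> - c)\<^sup>2) < 2 * r * \<delta>) sequentially"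
        by (rule order_tendstoD(2)[OF lim2]) (use r \<delta> in simp)
      then have "eventually (\<lambda>n. norm (expectation (\<lambda>\<omega>. T n n \<omega> * e n \<omega>) - of_real c) < r) sequentially"
      proof eventually_elim
        case (elim n)
        have int_D: "integrable M (\<lambda>\<omega>. (e n \<omega> - c)\<^sup>2)"
          by (rule integrable_const_bound[where B = 1])
            (use ec_le in auto)
        have int_bd: "integrable M (\<lambda>\<omega>. \<delta> * (cmod (T n n \<omega>))\<^sup>2 + (e n \<omega> - c)\<^sup>2 / (4 * \<delta>))"
          using int_T_sq int_D by simp
        have "expectation (\<lambda>\<omega>. T n n \<omega> * e n \<omega>) - of_real c = expectation (\<lambda>\<omega>. T n n \<omega> * e n \<omega>) - of_real c * expectation (T n n)"
          by (simp add: ET)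
        also have "\<dots> = expectation (\<lambda>\<omega>. T n n \<omega> * e n \<omega> - of_real c * T n n \<omega>)"
          using int_Te int_T by simp
        also have "(\<lambda>\<omega>. T n n \<omega> * e n \<omega> - of_real c * T n n \<omega>) = (\<lambda>\<omega>. T n n \<omega> * of_real (e n \<omega> - c))"
          by (simp add: algebra_simps)
        finally have "norm (expectation (\<lambda>\<omega>. T n n \<omega> * e n \<omega>) - of_real c) = norm (expectation (\<lambda>\<omega>. T n n \<omega> * of_real (e n \<omega> - c)))"
          by simp
        also have "\<dots> \<le> expectation (\<lambda>\<omega>. norm (T n n \<omega> * of_real (e n \<omega> - c)))"
          by (rule integral_norm_bound)
        also have "\<dots> \<le> expectation (\<lambda>\<omega>. \<delta> * (cmod (T n n \<omega>))\<^sup>2 + (e n \<omega> - c)\<^sup>2 / (4 * \<delta>))"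
        proof (rule integral_mono'[OF int_bd])
          fix \<omega>
          have "0 \<le> (2 * \<delta> * a - b)\<^sup>2 / (4 * \<delta>)" for a b using \<delta> by simp
          moreover have "(2 * \<delta> * a - b)\<^sup>2 / (4 * \<delta>) = \<delta> * a\<^sup>2 + b\<^sup>2 / (4 * \<delta>) - a * b" for a b
            using \<delta> by (simp add: power2_diff field_simps power2_eq_square)
          ultimately have amgm: "a * b \<le> \<delta> * a\<^sup>2 + b\<^sup>2 / (4 * \<delta>)" for a b
            by (metis diff_ge_0_iff_ge)
          from amgm[of "cmod (T n n \<omega>)" "\<bar>e n \<omega> - c\<bar>"]
          show "norm (T n n \<omega> * of_real (e n \<omega> - c)) \<le> \<delta> * (cmod (T n n \<omega>))\<^sup>2 + (e n \<omega> - c)\<^sup>2 / (4 * \<delta>)"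
            by (simp add: norm_mult del: of_real_diff)
        qed (use \<delta> in simp)
        also have "\<dots> = \<delta> * expectation (\<lambda>\<omega>. (cmod (T n n \<omega>))\<^sup>2) + expectation (\<lambda>\<omega>. (e n \<omega> - c)\<^sup>2) / (4 * \<delta>)"
          using int_T_sq int_D by simp
        also have "\<dots> < \<delta> * K + (2 * r * \<delta>) / (4 * \<delta>)"
        proof (rule add_le_less_mono)
          show "\<delta> * expectation (\<lambda>\<omega>. (cmod (T n n \<omega>))\<^sup>2) \<le> \<delta> * K"
            using T_bound[of n] \<delta> by (intro mult_left_mono) (auto simp: K_def)
          show "expectation (\<lambda>\<omega>. (e n \<omega> - c)\<^sup>2) / (4 * \<delta>) < (2 * r * \<delta>) / (4 * \<delta>)"
            using elim \<delta> by (intro divide_strict_right_mono) auto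
        qed
        also have "\<dots> = r" using \<delta> K by (simp add: \<delta>_def field_simps)
        finally show ?case .
      qed
      then show "\<exists>no. \<forall>n\<ge>no. norm (expectation (\<lambda>\<omega>. T n n \<omega> * e n \<omega>) - of_real c) < r"
        by (simp only: eventually_sequentially)
    qed
    have "(\<lambda>n. expectation (\<lambda>\<omega>. iexp (t * ((\<Sum>k<n. \<xi> k \<omega>) / sqrt (real n))))) \<longlonglongrightarrow> c"
      using tendsto_add[OF lim1 lim3] int_I int_Te by simp
    moreover have "char (distr M borel (\<lambda>\<omega>. (\<Sum>k<n. \<xi> k \<omega>) / sqrt (real n))) t
        = expectation (\<lambda>\<omega>. iexp (t * ((\<Sum>k<n. \<xi> k \<omega>) / sqrt (real n))))" for n
      unfolding char_def by (rule integral_distr) measurable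
    ultimately show "(\<lambda>n. char (distr M borel (\<lambda>\<omega>. (\<Sum>k<n. \<xi> k \<omega>) / sqrt (real n))) t) \<longlonglongrightarrow> char (normal_law 0 v) t"
      using v by (simp only: char_normal_law c_def)
  qed
qed

section \<open>The location-scale family\<close>

text \<open>This is the second derivative of \<open>f\<close> divided by \<open>f\<close>, written
  through the score, the form whose moments \<open>assumption_A2\<close> gives. With
  \<open>ab_term\<close> and \<open>bb_term\<close> it describes the second derivatives of the
  family at location 0 and scale 1, relative to \<open>f\<close>.\<close>

definition aa_term :: "(real \<Rightarrow> real) \<Rightarrow> real \<Rightarrow> real" where
  "aa_term f x = deriv (score f) x + (score f x)\<^sup>2"

definition ab_term :: "(real \<Rightarrow> real) \<Rightarrow> real \<Rightarrow> real" where
  "ab_term f x = 2 * score f x + x * aa_term f x"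

definition bb_term :: "(real \<Rightarrow> real) \<Rightarrow> real \<Rightarrow> real" where
  "bb_term f x = 2 + 4 * (x * score f x) + x\<^sup>2 * aa_term f x"

locale smooth_density =
  fixes f :: "real \<Rightarrow> real"
  assumes f_pos: "\<And>x. 0 < f x"
    and f_diff: "\<And>x. f differentiable (at x)"
    and score_diff: "\<And>x. score f differentiable (at x)"
begin

lemma DERIV_f: "(f has_real_derivative deriv f x) (at x)"
  using f_diff DERIV_deriv_iff_real_differentiable by blast

lemma DERIV_score: "(score f has_real_derivative deriv (score f) x) (at x)"
  using score_diff DERIV_deriv_iff_real_differentiable by blast

lemma deriv_f_eq: "deriv f x = score f x * f x"
  using f_pos[of x] by (simp add: score_def)

text \<open>The second derivative of \<open>f\<close> exists because \<open>deriv f\<close> is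
  \<open>score f * f\<close>, a product of differentiable functions.\<close>

lemma DERIV_deriv_f: "(deriv f has_real_derivative aa_term f x * f x) (at x)"
proof -
  have "((\<lambda>x. score f x * f x) has_real_derivative aa_term f x * f x) (at x)"
    by (rule derivative_eq_intros DERIV_f DERIV_score refl)+
      (simp add: deriv_f_eq aa_term_def algebra_simps power2_eq_square)
  moreover have "(\<lambda>x. score f x * f x) = deriv f" by (auto simp: deriv_f_eq)
  ultimately show ?thesis by simp
qed

lemma DERIV_f_comp [derivative_intros]:
  "(g has_real_derivative g') (at x within A) \<Longrightarrow>
    ((\<lambda>x. f (g x)) has_real_derivative deriv f (g x) * g') (at x within A)"
  by (rule DERIV_chain2[OF DERIV_f])

lemma DERIV_deriv_f_comp [derivative_intros]:
  "(g has_real_derivative g') (at x within A) \<Longrightarrow>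
    ((\<lambda>x. deriv f (g x)) has_real_derivative aa_term f (g x) * f (g x) * g') (at x within A)"
  by (rule DERIV_chain2[OF DERIV_deriv_f])

lemma deriv_loc_scale_scale:
  assumes "0 < b"
  shows "deriv (loc_scale f x a) b = - (f ((x - a) / b) + (x - a) / b * deriv f ((x - a) / b)) / b\<^sup>2"
  unfolding loc_scale_def using assms
  by (intro DERIV_imp_deriv) (auto intro!: derivative_eq_intros simp: field_simps power2_eq_square)

lemma dF_loc_loc:
  assumes "0 < b"
  shows "dF f 2 0 x a b = aa_term f ((x - a) / b) * f ((x - a) / b) / b ^ 3"
proof -
  have "deriv (\<lambda>a'. loc_scale f x a' b) = (\<lambda>a. - deriv f ((x - a) / b) / b\<^sup>2)"
    unfolding loc_scale_def using assms
    by (intro ext DERIV_imp_deriv) (auto intro!: derivative_eq_intros simp: field_simps power2_eq_square)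
  moreover have "deriv (\<lambda>a. - deriv f ((x - a) / b) / b\<^sup>2) a = aa_term f ((x - a) / b) * f ((x - a) / b) / b ^ 3"
    using assms
    by (intro DERIV_imp_deriv)
      (auto intro!: derivative_eq_intros simp: field_simps power2_eq_square power3_eq_cube)
  ultimately show ?thesis by (simp add: dF_def numeral_2_eq_2)
qed

lemma dF_loc_scale:
  assumes "0 < b"
  shows "dF f 1 1 x a b = (let y = (x - a) / b in (2 * deriv f y + y * (aa_term f y * f y)) / b ^ 3)"
  using assms unfolding dF_def
  by (simp add: deriv_loc_scale_scale Let_def)
    (intro DERIV_imp_deriv, auto intro!: derivative_eq_intros simp: field_simps power2_eq_square power3_eq_cube)

lemma dF_scale_scale:
  assumes b: "0 < b"
  shows "dF f 0 2 x a b = (let y = (x - a) / b in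
    (2 * f y + 4 * y * deriv f y + y\<^sup>2 * (aa_term f y * f y)) / b ^ 3)"
proof -
  let ?d = "\<lambda>b. - (f ((x - a) / b) + (x - a) / b * deriv f ((x - a) / b)) / b\<^sup>2"
  \<comment> \<open>The inner derivative is known for positive scales only; the outer derivative
    needs it just in a neighbourhood of \<open>b\<close>.\<close>
  have "eventually (\<lambda>b'. 0 < b') (nhds b)" using b by (intro eventually_nhds_in_open[of "{0<..}", simplified]) auto
  then have "eventually (\<lambda>b'. deriv (loc_scale f x a) b' = ?d b') (nhds b)"
    by eventually_elim (rule deriv_loc_scale_scale)
  then have "deriv (deriv (loc_scale f x a)) b = deriv ?d b" by (rule deriv_cong_ev) simp
  also have "\<dots> = (let y = (x - a) / b in (2 * f y + 4 * y * deriv f y + y\<^sup>2 * (aa_term f y * f y)) / b ^ 3)"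
    using b unfolding Let_def
    by (intro DERIV_imp_deriv)
      (auto intro!: derivative_eq_intros simp: field_simps power2_eq_square power3_eq_cube)
  finally show ?thesis by (simp add: dF_def numeral_2_eq_2)
qed

lemma dF_at_origin:
  "dF f 2 0 x 0 1 = aa_term f x * f x"
  "dF f 1 1 x 0 1 = ab_term f x * f x"
  "dF f 0 2 x 0 1 = bb_term f x * f x"
  by (simp_all only: dF_loc_loc dF_loc_scale dF_scale_scale zero_less_one)
    (simp_all add: Let_def ab_term_def bb_term_def deriv_f_eq algebra_simps)

text \<open>One-variable Taylor formula along the segment from \<open>(0, 1)\<close> to
  \<open>(a, 1 + c)\<close>, on which the scale stays positive. The Lagrange form requires second
  derivatives to exist, not to be continuous, and one point \<open>s\<close> serves all three of
  them.\<close>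

lemma loc_scale_taylor:
  assumes c: "0 < 1 + c"
  obtains s where "0 < s" "s < 1"
    "loc_scale f x a (1 + c) = f x - (a * score f x + c * (1 + x * score f x)) * f x
      + (a\<^sup>2 * dF f 2 0 x (s * a) (1 + s * c) + 2 * a * c * dF f 1 1 x (s * a) (1 + s * c)
         + c\<^sup>2 * dF f 0 2 x (s * a) (1 + s * c)) / 2"
proof -
  define g0 where "g0 = (\<lambda>s. loc_scale f x (s * a) (1 + s * c))"
  define g1 where "g1 = (\<lambda>s. let B = 1 + s * c; y = (x - s * a) / B in
    - ((a + c * y) * deriv f y + c * f y) / B\<^sup>2)"
  define g2 where "g2 = (\<lambda>s. a\<^sup>2 * dF f 2 0 x (s * a) (1 + s * c)
    + 2 * a * c * dF f 1 1 x (s * a) (1 + s * c) + c\<^sup>2 * dF f 0 2 x (s * a) (1 + s * c))"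
  have pos: "0 < 1 + s * c" if "0 \<le> s" "s \<le> 1" for s
  proof (cases "0 \<le> c")
    case False
    then have "s * c \<ge> 1 * c" using that by (intro mult_right_mono_neg) auto
    then show ?thesis using c by simp
  qed (use that in \<open>auto intro: add_pos_nonneg\<close>)
  have d0: "(g0 has_real_derivative g1 s) (at s)" if "0 \<le> s" "s \<le> 1" for s
    using pos[OF that] unfolding g0_def g1_def loc_scale_def Let_def
    by (auto intro!: derivative_eq_intros) (simp add: field_simps power2_eq_square)
  have d1: "(g1 has_real_derivative g2 s) (at s)" if "0 \<le> s" "s \<le> 1" for s
  proof -
    define B where "B = 1 + s * c"
    have B: "0 < B" using pos[OF that] by (simp add: B_def)
    define y where "y = (x - s * a) / B"
    define Y where "Y = (\<lambda>s. (x - s * a) / (1 + s * c))"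
    have Y: "Y s = y" by (simp add: Y_def y_def B_def)
    \<comment> \<open>The derivative of the standardised argument along the segment. It is a
      multiple of \<open>a + c * y\<close>, the combination into which the quadratic form of second
      derivatives regroups.\<close>
    define y' where "y' = - (a + c * y) / B"
    have dY: "(Y has_real_derivative y') (at s)"
      using B unfolding Y_def y'_def y_def B_def
      by (auto intro!: derivative_eq_intros) (simp add: field_simps)
    have num: "((\<lambda>s. - ((a + c * Y s) * deriv f (Y s) + c * f (Y s))) has_real_derivative
        - (c * y' * deriv f y + (a + c * y) * (aa_term f y * f y * y') + c * (deriv f y * y'))) (at s)"
      by (auto intro!: derivative_eq_intros dY simp: Y)
    have den: "((\<lambda>s. (1 + s * c)\<^sup>2) has_real_derivative 2 * B * c) (at s)"
      by (auto intro!: derivative_eq_intros simp: B_def)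
    have "((\<lambda>s. - ((a + c * Y s) * deriv f (Y s) + c * f (Y s)) / (1 + s * c)\<^sup>2) has_real_derivative
        (- (c * y' * deriv f y + (a + c * y) * (aa_term f y * f y * y') + c * (deriv f y * y')) * B\<^sup>2
          - - ((a + c * y) * deriv f y + c * f y) * (2 * B * c)) / (B\<^sup>2 * B\<^sup>2)) (at s)"
      using DERIV_divide[OF num den] B by (simp add: Y B_def[symmetric])
    also have "(- (c * y' * deriv f y + (a + c * y) * (aa_term f y * f y * y') + c * (deriv f y * y')) * B\<^sup>2
          - - ((a + c * y) * deriv f y + c * f y) * (2 * B * c)) / (B\<^sup>2 * B\<^sup>2)
        = ((a + c * y)\<^sup>2 * (aa_term f y * f y) + 4 * c * (a + c * y) * deriv f y + 2 * c\<^sup>2 * f y) / B ^ 3"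
    proof -
      have y'B: "y' * B\<^sup>2 = - (a + c * y) * B" using B by (simp add: y'_def power2_eq_square)
      have "- (c * y' * deriv f y + (a + c * y) * (aa_term f y * f y * y') + c * (deriv f y * y')) * B\<^sup>2
          = - (2 * c * deriv f y + (a + c * y) * (aa_term f y * f y)) * (y' * B\<^sup>2)"
        by (simp add: algebra_simps)
      then have "- (c * y' * deriv f y + (a + c * y) * (aa_term f y * f y * y') + c * (deriv f y * y')) * B\<^sup>2
          - - ((a + c * y) * deriv f y + c * f y) * (2 * B * c)
          = ((a + c * y)\<^sup>2 * (aa_term f y * f y) + 4 * c * (a + c * y) * deriv f y + 2 * c\<^sup>2 * f y) * B"
        unfolding y'B by (simp add: algebra_simps power2_eq_square)
      moreover have "u * B / (B\<^sup>2 * B\<^sup>2) = u / B ^ 3" for u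
        using B by (simp add: power2_eq_square power3_eq_cube)
      ultimately show ?thesis by simp
    qed
    finally have "((\<lambda>s. - ((a + c * Y s) * deriv f (Y s) + c * f (Y s)) / (1 + s * c)\<^sup>2) has_real_derivative
        ((a + c * y)\<^sup>2 * (aa_term f y * f y) + 4 * c * (a + c * y) * deriv f y + 2 * c\<^sup>2 * f y) / B ^ 3) (at s)" .
    moreover have "g2 s = ((a + c * y)\<^sup>2 * (aa_term f y * f y) + 4 * c * (a + c * y) * deriv f y + 2 * c\<^sup>2 * f y) / B ^ 3"
      using B unfolding g2_def B_def[symmetric] dF_loc_loc[OF B] dF_loc_scale[OF B] dF_scale_scale[OF B] y_def[symmetric] Let_def
      by (simp add: add_divide_distrib[symmetric] algebra_simps power2_eq_square)
    ultimately show ?thesis unfolding g1_def Let_def Y_def by simp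
  qed
  have "\<exists>s. 0 < s \<and> s < 1 \<and> g0 1 = (\<Sum>m<2. (if m = 0 then g0 else if m = 1 then g1 else g2) 0 / fact m * 1 ^ m)
      + (if (2::nat) = 0 then g0 else if (2::nat) = 1 then g1 else g2) s / fact 2 * 1 ^ 2"
  proof (rule Maclaurin)
    show "\<forall>m t. m < (2::nat) \<and> 0 \<le> t \<and> t \<le> 1 \<longrightarrow>
        ((if m = 0 then g0 else if m = 1 then g1 else g2) has_real_derivative
        (if Suc m = 0 then g0 else if Suc m = 1 then g1 else g2) t) (at t)"
      using d0 d1 by (auto simp: less_2_cases_iff)
  qed auto
  then obtain s where s: "0 < s" "s < 1" "g0 1 = g0 0 + g1 0 + g2 s / 2"
    by (auto simp: numeral_2_eq_2)
  have "g0 0 = f x" "g1 0 = - (a * score f x + c * (1 + x * score f x)) * f x"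
    by (simp_all add: g0_def g1_def loc_scale_def deriv_f_eq algebra_simps)
  with s show ?thesis by (intro that[of s]) (simp_all add: g0_def g2_def left_diff_distrib distrib_right)
qed

text \<open>The Lipschitz bounds move the second derivatives from the intermediate Taylor point to
  \<open>(0, 1)\<close>, first in the location at fixed scale, then in the scale at location 0. Each
  changes by at most \<open>p * (\<bar>a\<bar> + \<bar>c\<bar>)\<close> relative to
  \<open>f\<close>, and the quadratic form contributes the remaining square.\<close>

lemma loc_scale_expansion:
  assumes c: "0 < 1 + c" and small: "\<bar>a\<bar> < r" "\<bar>c\<bar> < r"
    and V1: "\<And>j k a a' b. j + k = 2 \<Longrightarrow> 0 < b \<Longrightarrow>
      \<exists>a0 \<in> closed_segment a a'. \<bar>dF f j k x a b - dF f j k x a' b\<bar> \<le> V1 a0 b * \<bar>a - a'\<bar>"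
    and V2: "\<And>j k a b b'. j + k = 2 \<Longrightarrow> 0 < b \<Longrightarrow> 0 < b' \<Longrightarrow>
      \<exists>b0 \<in> closed_segment b b'. \<bar>dF f j k x a b - dF f j k x a b'\<bar> \<le> V2 a b0 * \<bar>b - b'\<bar>"
    and V_le: "\<And>a b. 0 < b \<Longrightarrow> max \<bar>a\<bar> \<bar>b - 1\<bar> < r \<Longrightarrow> \<bar>V1 a b / f x\<bar> \<le> p \<and> \<bar>V2 a b / f x\<bar> \<le> p"
  shows "\<bar>loc_scale f x a (1 + c) / f x - (1 - (a * score f x + c * (1 + x * score f x))
      + (a\<^sup>2 * aa_term f x + 2 * a * c * ab_term f x + c\<^sup>2 * bb_term f x) / 2)\<bar>
    \<le> p * (\<bar>a\<bar> + \<bar>c\<bar>) ^ 3"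
proof -
  have fx: "0 < f x" by (rule f_pos)
  obtain s where s: "0 < s" "s < 1" and taylor:
    "loc_scale f x a (1 + c) = f x - (a * score f x + c * (1 + x * score f x)) * f x
      + (a\<^sup>2 * dF f 2 0 x (s * a) (1 + s * c) + 2 * a * c * dF f 1 1 x (s * a) (1 + s * c)
         + c\<^sup>2 * dF f 0 2 x (s * a) (1 + s * c)) / 2"
    using loc_scale_taylor[OF c] by blast
  have sa: "\<bar>s * a\<bar> \<le> \<bar>a\<bar>" and sc: "\<bar>s * c\<bar> \<le> \<bar>c\<bar>"
    using s by (simp_all add: abs_mult mult_left_le_one_le)
  have B: "0 < 1 + s * c"
  proof (cases "0 \<le> c")
    case False
    then have "s * c \<ge> 1 * c" using s by (intro mult_right_mono_neg) auto
    then show ?thesis using c by simp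
  qed (use s in \<open>auto intro: add_pos_nonneg\<close>)
  \<comment> \<open>\<open>r\<close> is positive, so the centre \<open>(0, 1)\<close> lies in the
    neighbourhood, and the bound there shows that \<open>p\<close> is nonnegative.\<close>
  have "0 < r" using small by linarith
  then have p0: "0 \<le> p" using order_trans[OF abs_ge_zero conjunct1[OF V_le[of 1 0]]] by simp
  have incr: "\<bar>dF f j k x (s * a) (1 + s * c) / f x - dF f j k x 0 1 / f x\<bar> \<le> p * (\<bar>a\<bar> + \<bar>c\<bar>)"
    if jk: "j + k = 2" for j k
  proof -
    obtain a0 where a0: "a0 \<in> closed_segment (s * a) 0"
      and le1: "\<bar>dF f j k x (s * a) (1 + s * c) - dF f j k x 0 (1 + s * c)\<bar> \<le> V1 a0 (1 + s * c) * \<bar>s * a - 0\<bar>"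
      using V1[OF jk B] by blast
    obtain b0 where b0: "b0 \<in> closed_segment (1 + s * c) 1"
      and le2: "\<bar>dF f j k x 0 (1 + s * c) - dF f j k x 0 1\<bar> \<le> V2 0 b0 * \<bar>1 + s * c - 1\<bar>"
      using V2[OF jk B zero_less_one] by blast
    have a0': "\<bar>a0\<bar> \<le> \<bar>s * a\<bar>" using a0 by (auto simp: closed_segment_eq_real_ivl split: if_splits)
    have b0': "\<bar>b0 - 1\<bar> \<le> \<bar>s * c\<bar>" "0 < b0"
      using b0 B by (auto simp: closed_segment_eq_real_ivl split: if_splits)
    have "V1 a0 (1 + s * c) \<le> p * f x"
      using V_le[OF B, of a0] a0' sa sc small fx by (auto simp: abs_le_iff pos_divide_le_eq)
    then have 1: "V1 a0 (1 + s * c) * \<bar>s * a - 0\<bar> \<le> p * f x * \<bar>a\<bar>"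
      using sa p0 fx by (intro mult_mono) auto
    have "V2 0 b0 \<le> p * f x"
      using V_le[OF b0'(2), of 0] b0' sc small fx by (auto simp: abs_le_iff pos_divide_le_eq)
    then have 2: "V2 0 b0 * \<bar>1 + s * c - 1\<bar> \<le> p * f x * \<bar>c\<bar>"
      using sc p0 fx by (intro mult_mono) auto
    have "\<bar>dF f j k x (s * a) (1 + s * c) - dF f j k x 0 1\<bar> \<le> p * f x * \<bar>a\<bar> + p * f x * \<bar>c\<bar>"
      using le1 le2 1 2 by linarith
    also have "\<dots> = p * (\<bar>a\<bar> + \<bar>c\<bar>) * f x" by (simp add: algebra_simps)
    finally have "\<bar>dF f j k x (s * a) (1 + s * c) - dF f j k x 0 1\<bar> / f x \<le> p * (\<bar>a\<bar> + \<bar>c\<bar>)"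
      using fx by (simp add: pos_divide_le_eq)
    then show ?thesis using fx by (simp add: diff_divide_distrib[symmetric])
  qed
  define D where "D = (\<lambda>j k. dF f j k x (s * a) (1 + s * c) / f x - dF f j k x 0 1 / f x)"
  define P where "P = p * (\<bar>a\<bar> + \<bar>c\<bar>)"
  have P0: "0 \<le> P" using p0 by (simp add: P_def)
  have D: "\<bar>D 2 0\<bar> \<le> P" "\<bar>D 1 1\<bar> \<le> P" "\<bar>D 0 2\<bar> \<le> P"
    unfolding D_def P_def by (rule incr; simp)+
  have orig: "dF f 2 0 x 0 1 / f x = aa_term f x" "dF f 1 1 x 0 1 / f x = ab_term f x" "dF f 0 2 x 0 1 / f x = bb_term f x"
    using fx by (simp_all only: dF_at_origin) simp_all
  have "loc_scale f x a (1 + c) / f x - (1 - (a * score f x + c * (1 + x * score f x))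
      + (a\<^sup>2 * aa_term f x + 2 * a * c * ab_term f x + c\<^sup>2 * bb_term f x) / 2)
    = (a\<^sup>2 * D 2 0 + 2 * a * c * D 1 1 + c\<^sup>2 * D 0 2) / 2"
    unfolding D_def orig unfolding taylor using fx
    by (simp add: add_divide_distrib diff_divide_distrib right_diff_distrib)
  also have "\<bar>\<dots>\<bar> \<le> (a\<^sup>2 * P + 2 * \<bar>a * c\<bar> * P + c\<^sup>2 * P) / 2"
  proof -
    have "\<bar>a\<^sup>2 * D 2 0\<bar> \<le> a\<^sup>2 * P" "\<bar>2 * a * c * D 1 1\<bar> \<le> 2 * \<bar>a * c\<bar> * P" "\<bar>c\<^sup>2 * D 0 2\<bar> \<le> c\<^sup>2 * P"
      using D by (auto simp: abs_mult mult.assoc intro!: mult_left_mono)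
    moreover have "\<bar>(t + u + w) / 2\<bar> \<le> (T + U + W) / 2"
      if "\<bar>t\<bar> \<le> T" "\<bar>u\<bar> \<le> U" "\<bar>w\<bar> \<le> W" for t u w T U W :: real
      using that by (auto simp: abs_le_iff)
    ultimately show ?thesis by blast
  qed
  also have "\<dots> = P * (\<bar>a\<bar> + \<bar>c\<bar>)\<^sup>2 / 2"
    by (simp add: power2_sum abs_mult algebra_simps)
  also have "\<dots> \<le> P * (\<bar>a\<bar> + \<bar>c\<bar>)\<^sup>2" using P0 by simp
  also have "\<dots> = p * (\<bar>a\<bar> + \<bar>c\<bar>) ^ 3" by (simp add: P_def power2_eq_square power3_eq_cube)
  finally show ?thesis .
qed

lemma f_continuous: "continuous_on UNIV f"
  using DERIV_f by (meson DERIV_continuous continuous_at_imp_continuous_on)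

lemma score_continuous: "continuous_on UNIV (score f)"
  using DERIV_score by (meson DERIV_continuous continuous_at_imp_continuous_on)

lemma f_measurable: "f \<in> borel_measurable borel"
  by (rule borel_measurable_continuous_onI[OF f_continuous])

lemma score_measurable: "score f \<in> borel_measurable borel"
  by (rule borel_measurable_continuous_onI[OF score_continuous])

end

text \<open>The derivative is a pointwise limit of difference quotients; this matters for the
  derivative of the score, whose continuity is not assumed.\<close>

lemma borel_measurable_deriv:
  fixes g :: "real \<Rightarrow> real"
  assumes "\<And>x. g differentiable (at x)"
  shows "deriv g \<in> borel_measurable borel"
proof (rule borel_measurable_LIMSEQ_real)
  have g: "(g has_real_derivative deriv g x) (at x)" for x
    using assms DERIV_deriv_iff_real_differentiable by blast
  have [measurable]: "g \<in> borel_measurable borel"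
    by (rule borel_measurable_continuous_onI)
      (meson g DERIV_continuous continuous_at_imp_continuous_on)
  show "(\<lambda>x. (g (x + 1 / real (Suc i)) - g x) / (1 / real (Suc i))) \<in> borel_measurable borel" for i
    by measurable
  show "(\<lambda>i. (g (x + 1 / real (Suc i)) - g x) / (1 / real (Suc i))) \<longlonglongrightarrow> deriv g x" for x
  proof (rule filterlim_compose[of "\<lambda>h. (g (x + h) - g x) / h"])
    show "((\<lambda>h. (g (x + h) - g x) / h) \<longlongrightarrow> deriv g x) (at 0)"
      using g[of x] by (simp add: DERIV_def)
    show "filterlim (\<lambda>i. 1 / real (Suc i)) (at 0) sequentially"
      unfolding filterlim_at using LIMSEQ_inverse_real_of_nat by (auto simp: inverse_eq_divide)
  qed
qed

section \<open>Independence and convergence in probability\<close>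

lemma integrable_mult_of_squares:
  fixes a b :: "'a \<Rightarrow> real"
  assumes [measurable]: "a \<in> borel_measurable M" "b \<in> borel_measurable M"
    and sq: "integrable M (\<lambda>x. (a x)\<^sup>2)" "integrable M (\<lambda>x. (b x)\<^sup>2)"
  shows "integrable M (\<lambda>x. a x * b x)"
proof (rule Bochner_Integration.integrable_bound)
  show "integrable M (\<lambda>x. (a x)\<^sup>2 + (b x)\<^sup>2)" using sq by simp
  have "\<bar>x * y\<bar> \<le> x\<^sup>2 + y\<^sup>2" for x y :: real
  proof -
    have "0 \<le> \<bar>x * y\<bar>" by simp
    moreover have "2 * \<bar>x * y\<bar> \<le> x\<^sup>2 + y\<^sup>2"
      using sum_squares_bound[of "\<bar>x\<bar>" "\<bar>y\<bar>"] by (simp add: abs_mult)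
    ultimately show ?thesis by linarith
  qed
  then show "AE x in M. norm (a x * b x) \<le> norm ((a x)\<^sup>2 + (b x)\<^sup>2)" by (intro AE_I2) simp
qed measurable

lemma (in finite_measure) integrable_square_of_powr:
  fixes a :: "'a \<Rightarrow> real"
  assumes [measurable]: "a \<in> borel_measurable M"
    and int: "integrable M (\<lambda>x. \<bar>a x\<bar> powr (l + 2))" and l: "0 < l"
  shows "integrable M (\<lambda>x. (a x)\<^sup>2)"
proof (rule Bochner_Integration.integrable_bound)
  show "integrable M (\<lambda>x. 1 + \<bar>a x\<bar> powr (l + 2))" using int by simp
  have "y\<^sup>2 \<le> 1 + \<bar>y\<bar> powr (l + 2)" for y :: real
  proof (cases "\<bar>y\<bar> \<le> 1")
    case True
    then have "y\<^sup>2 \<le> 1" by (simp add: abs_square_le_1)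
    then show ?thesis using powr_ge_zero[of "\<bar>y\<bar>" "l + 2"] by linarith
  next
    case False
    then have "\<bar>y\<bar> powr 2 \<le> \<bar>y\<bar> powr (l + 2)" using l by (intro powr_mono) auto
    then show ?thesis using False by (simp add: powr_numeral)
  qed
  then show "AE x in M. norm ((a x)\<^sup>2) \<le> norm (1 + \<bar>a x\<bar> powr (l + 2))"
    by (intro AE_I2) (simp add: add_nonneg_nonneg)
qed measurable

text \<open>Stands in for conditioning on the past. The events generated by
  \<open>g (e \<omega>)\<close> and by \<open>W\<close> are subcollections of two independent
  families, so the two variables are independent and their expectations multiply.\<close>

lemma (in prob_space) indep_past_product:
  fixes g :: "real \<Rightarrow> real" and W :: "'a \<Rightarrow> real"
  assumes indep: "indep_set (sigma_rv M e) (sets F)" and sub: "subalgebra M F"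
    and [measurable]: "e \<in> borel_measurable M" and g [measurable]: "g \<in> borel_measurable borel"
    and W: "W \<in> borel_measurable F"
    and int: "integrable M (\<lambda>\<omega>. g (e \<omega>))" "integrable M W"
  shows "integrable M (\<lambda>\<omega>. g (e \<omega>) * W \<omega>)"
    and "expectation (\<lambda>\<omega>. g (e \<omega>) * W \<omega>) = expectation (\<lambda>\<omega>. g (e \<omega>)) * expectation W"
proof -
  have [measurable]: "W \<in> borel_measurable M" using measurable_from_subalg[OF sub W] .
  let ?A = "{(\<lambda>\<omega>. g (e \<omega>)) -` A \<inter> space M |A. A \<in> sets borel}"
  let ?B = "{W -` A \<inter> space M |A. A \<in> sets borel}"
  have "?A \<subseteq> sigma_rv M e"
  proof safe
    fix A :: "real set" assume "A \<in> sets borel"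
    then have "g -` A \<in> sets borel" using measurable_sets[OF g] by simp
    moreover have "(\<lambda>\<omega>. g (e \<omega>)) -` A \<inter> space M = e -` (g -` A) \<inter> space M" by auto
    ultimately show "(\<lambda>\<omega>. g (e \<omega>)) -` A \<inter> space M \<in> sigma_rv M e" unfolding sigma_rv_def by blast
  qed
  moreover have "?B \<subseteq> sets F" using measurable_sets[OF W] sub by (auto simp: subalgebra_def)
  ultimately have "indep_set ?A ?B"
    using indep unfolding indep_set_def by (elim indep_sets_mono_sets) (auto split: bool.split)
  moreover have "Int_stable {X -` A \<inter> space M |A. A \<in> sets borel}" for X :: "'a \<Rightarrow> real"
  proof (rule Int_stableI, safe)
    fix A B :: "real set" assume "A \<in> sets borel" "B \<in> sets borel"
    then show "\<exists>C. X -` A \<inter> space M \<inter> (X -` B \<inter> space M) = X -` C \<inter> space M \<and> C \<in> sets borel"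
      by (intro exI[of _ "A \<inter> B"]) auto
  qed
  ultimately have "indep_set (sigma_sets (space M) ?A) (sigma_sets (space M) ?B)"
    by (intro indep_set_sigma_sets)
  then have "indep_var borel (\<lambda>\<omega>. g (e \<omega>)) borel W" by (simp add: indep_var_eq)
  from indep_var_integrable[OF this int] indep_var_lebesgue_integral[OF this int]
  show "integrable M (\<lambda>\<omega>. g (e \<omega>) * W \<omega>)"
    and "expectation (\<lambda>\<omega>. g (e \<omega>) * W \<omega>) = expectation (\<lambda>\<omega>. g (e \<omega>)) * expectation W"
    by auto
qed

lemma (in prob_space) o_P_one_if_AE_tendsto:
  assumes [measurable]: "\<And>n. R n \<in> borel_measurable M"
    and lim: "AE \<omega> in M. (\<lambda>n. R n \<omega>) \<longlonglongrightarrow> 0"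
  shows "o_P_one M R"
  unfolding o_P_one_def
proof (intro conjI allI impI)
  fix \<delta> :: real assume \<delta>: "0 < \<delta>"
  let ?A = "\<lambda>n. {\<omega> \<in> space M. \<bar>R n \<omega>\<bar> > \<delta>}"
  have "(\<lambda>n. expectation (indicator (?A n))) \<longlonglongrightarrow> expectation (\<lambda>\<omega>. 0 :: real)"
  proof (rule integral_dominated_convergence[where w = "\<lambda>_. 1"])
    show "AE \<omega> in M. (\<lambda>n. indicator (?A n) \<omega> :: real) \<longlonglongrightarrow> 0"
      using lim
    proof eventually_elim
      case (elim \<omega>)
      then have "eventually (\<lambda>n. \<bar>R n \<omega>\<bar> < \<delta>) sequentially"
        using \<delta> by (auto simp: tendsto_iff)
      then have "eventually (\<lambda>n. (indicator (?A n) \<omega> :: real) = 0) sequentially"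
        by eventually_elim auto
      then show ?case by (rule tendsto_eventually)
    qed
  qed (auto simp: indicator_def)
  then show "(\<lambda>n. prob (?A n)) \<longlonglongrightarrow> 0" by simp
qed (rule assms(1))

section \<open>The model under the null hypothesis\<close>

lemma sigma_past_subset:
  assumes "\<And>i. Z i \<in> measurable M N"
  shows "sigma_past M N Z i \<subseteq> sets M"
  unfolding sigma_past_def
  by (rule sets.sigma_sets_subset) (use assms in \<open>auto intro: measurable_sets\<close>)

lemma sigma_past_innov_subset:
  assumes "\<And>i. Z i \<in> measurable M N" "\<And>i. e i \<in> borel_measurable M"
  shows "sigma_past_innov M N Z e i \<subseteq> sets M"
  unfolding sigma_past_innov_def
  by (rule sets.sigma_sets_subset) (use assms in \<open>auto intro: measurable_sets\<close>)

locale null_model = prob_space M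
  for M :: "'w measure" +
  fixes Y \<epsilon> :: "int \<Rightarrow> 'w \<Rightarrow> real"
    and X :: "int \<Rightarrow> 'w \<Rightarrow> real ^ ('d::finite)"
    and Z :: "int \<Rightarrow> 'w \<Rightarrow> 'd regr"
    and s q :: nat
    and mean scale :: "'d regr \<Rightarrow> real"
  assumes Z_eq: "Z = regressor s q Y X"
    and stationary: "stationary_process M borel (\<lambda>i \<omega>. (Y i \<omega>, X i \<omega>))"
    and ergodic: "ergodic_process M borel (\<lambda>i \<omega>. (Y i \<omega>, X i \<omega>))"
    and eps_meas [measurable]: "\<And>i. \<epsilon> i \<in> borel_measurable M"
    and eps_past: "\<And>i. indep_set (sigma_rv M (\<epsilon> i)) (sigma_past M (regr_space s q) Z i)"
    and eps_past_no_lag: "\<And>i. s = 0 \<Longrightarrow>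
      indep_set (sigma_rv M (\<epsilon> i)) (sigma_past_innov M (regr_space s q) Z \<epsilon> i)"
    and mean_meas [measurable]: "mean \<in> borel_measurable (regr_space s q)"
    and scale_meas [measurable]: "scale \<in> borel_measurable (regr_space s q)"
    and scale_pos: "\<And>z. z \<in> space (regr_space s q) \<Longrightarrow> 0 < scale z"
    and H0: "\<And>i. AE \<omega> in M. Y i \<omega> = mean (Z i \<omega>) + scale (Z i \<omega>) * \<epsilon> i \<omega>"
begin

text \<open>Only time 0 is read off the path; shifting the path gives the regressor at any other
  time.\<close>

definition path_regr :: "(int \<Rightarrow> real \<times> (real ^ 'd)) \<Rightarrow> 'd regr" where
  "path_regr x = (\<lambda>k\<in>{1..s}. fst (x (- int k)), \<lambda>k\<in>{0..q}. snd (x (- int k)))"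

text \<open>The model equation solved for the innovation at time 0. On observed paths it agrees with
  \<open>\<epsilon> 0\<close> off a null set, as \<open>H0\<close> holds almost surely.\<close>

definition path_innov :: "(int \<Rightarrow> real \<times> (real ^ 'd)) \<Rightarrow> real" where
  "path_innov x = (fst (x 0) - mean (path_regr x)) / scale (path_regr x)"

lemma fst_borel [measurable]: "fst \<in> measurable (borel :: (real \<times> (real ^ 'd)) measure) borel"
  and snd_borel [measurable]: "snd \<in> measurable (borel :: (real \<times> (real ^ 'd)) measure) borel"
  by (auto intro!: borel_measurable_continuous_onI continuous_intros)

lemma path_regr_measurable [measurable]: "path_regr \<in> measurable (PiM UNIV (\<lambda>_. borel)) (regr_space s q)"
  unfolding path_regr_def regr_space_def by measurable

lemma path_innov_measurable [measurable]: "path_innov \<in> borel_measurable (PiM UNIV (\<lambda>_. borel))"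
  unfolding path_innov_def by measurable

lemma path_regr_shift: "path_regr (\<lambda>j. (Y (j + i) \<omega>, X (j + i) \<omega>)) = Z i \<omega>"
  by (auto simp: path_regr_def Z_eq regressor_def intro!: restrict_ext)

lemma YX_measurable: "(\<lambda>\<omega>. (Y i \<omega>, X i \<omega>)) \<in> borel_measurable M"
  using stationary unfolding stationary_process_def by blast

lemma Y_measurable [measurable]: "Y i \<in> borel_measurable M"
  using measurable_compose[OF YX_measurable[of i] fst_borel] by simp

lemma Z_measurable [measurable]: "Z i \<in> measurable M (regr_space s q)"
proof -
  have "(\<lambda>\<omega>. path_regr (\<lambda>j. (Y (j + i) \<omega>, X (j + i) \<omega>))) \<in> measurable M (regr_space s q)"
    by (rule measurable_compose[OF path_measurable[OF YX_measurable] path_regr_measurable])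
  then show ?thesis by (simp only: path_regr_shift)
qed

lemma eps_path: "AE \<omega> in M. \<epsilon> i \<omega> = path_innov (\<lambda>j. (Y (j + i) \<omega>, X (j + i) \<omega>))"
  using H0[of i] AE_space
proof eventually_elim
  case (elim \<omega>)
  have "0 < scale (Z i \<omega>)" using measurable_space[OF Z_measurable elim(2)] by (rule scale_pos)
  then show ?case using elim by (simp add: path_innov_def path_regr_shift)
qed

text \<open>Stationarity and ergodicity are given for \<open>(Y, X)\<close>, moment conditions for
  time 0. Since \<open>path_innov\<close> recovers the innovation, any function of innovation and
  regressor is almost surely a functional of the shifted path; this carries moments to other times
  and gives a law of large numbers for the pairs.\<close>

lemma transfer_from_origin:
  fixes \<Phi> :: "real \<times> 'd regr \<Rightarrow> real"
  assumes \<Phi> [measurable]: "\<Phi> \<in> borel_measurable (borel \<Otimes>\<^sub>M regr_space s q)"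
    and int: "integrable M (\<lambda>\<omega>. \<Phi> (\<epsilon> 0 \<omega>, Z 0 \<omega>))"
  shows "integrable M (\<lambda>\<omega>. \<Phi> (\<epsilon> (int k + 1) \<omega>, Z (int k + 1) \<omega>))"
    and "expectation (\<lambda>\<omega>. \<Phi> (\<epsilon> (int k + 1) \<omega>, Z (int k + 1) \<omega>)) = expectation (\<lambda>\<omega>. \<Phi> (\<epsilon> 0 \<omega>, Z 0 \<omega>))"
    and "AE \<omega> in M. (\<lambda>n. (\<Sum>k<n. \<Phi> (\<epsilon> (int k + 1) \<omega>, Z (int k + 1) \<omega>)) / real n)
      \<longlonglongrightarrow> expectation (\<lambda>\<omega>. \<Phi> (\<epsilon> 0 \<omega>, Z 0 \<omega>))"
proof -
  define \<Psi> where "\<Psi> = (\<lambda>x. \<Phi> (path_innov x, path_regr x))"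
  have \<Psi> [measurable]: "\<Psi> \<in> borel_measurable (PiM UNIV (\<lambda>_. borel))" unfolding \<Psi>_def by measurable
  let ?W = "\<lambda>i \<omega>. (Y i \<omega>, X i \<omega>)"
  have path_M [measurable]: "(\<lambda>\<omega>. \<Psi> (\<lambda>j. ?W (j + i) \<omega>)) \<in> borel_measurable M" for i
    by (rule measurable_compose[OF path_measurable[OF YX_measurable] \<Psi>])
  have ae: "AE \<omega> in M. \<Psi> (\<lambda>j. ?W (j + i) \<omega>) = \<Phi> (\<epsilon> i \<omega>, Z i \<omega>)" for i
    using eps_path[of i] by eventually_elim (simp add: \<Psi>_def path_regr_shift)
  have int_eq: "integrable M (\<lambda>\<omega>. \<Psi> (\<lambda>j. ?W (j + i) \<omega>)) \<longleftrightarrow> integrable M (\<lambda>\<omega>. \<Phi> (\<epsilon> i \<omega>, Z i \<omega>))"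
    and exp_eq: "expectation (\<lambda>\<omega>. \<Psi> (\<lambda>j. ?W (j + i) \<omega>)) = expectation (\<lambda>\<omega>. \<Phi> (\<epsilon> i \<omega>, Z i \<omega>))" for i
    by (rule integrable_cong_AE[OF _ _ ae] integral_cong_AE[OF _ _ ae]; measurable)+
  have int0: "integrable M (\<lambda>\<omega>. \<Psi> (\<lambda>j. ?W j \<omega>))" using int_eq[of 0] int by simp
  have exp0: "expectation (\<lambda>\<omega>. \<Psi> (\<lambda>j. ?W j \<omega>)) = expectation (\<lambda>\<omega>. \<Phi> (\<epsilon> 0 \<omega>, Z 0 \<omega>))"
    using exp_eq[of 0] by simp
  note shift = stationary_shift[OF stationary \<Psi> int0, of "Suc k" for k]
  show "integrable M (\<lambda>\<omega>. \<Phi> (\<epsilon> (int k + 1) \<omega>, Z (int k + 1) \<omega>))"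
    using shift(1)[of k] int_eq[of "int k + 1"] by (simp add: add.commute)
  show "expectation (\<lambda>\<omega>. \<Phi> (\<epsilon> (int k + 1) \<omega>, Z (int k + 1) \<omega>)) = expectation (\<lambda>\<omega>. \<Phi> (\<epsilon> 0 \<omega>, Z 0 \<omega>))"
    using shift(2)[of k] exp_eq[of "int k + 1"] exp0 by (simp add: add.commute)
  have "AE \<omega> in M. \<forall>k. \<Psi> (\<lambda>j. ?W (j + (int k + 1)) \<omega>) = \<Phi> (\<epsilon> (int k + 1) \<omega>, Z (int k + 1) \<omega>)"
    unfolding AE_all_countable using ae by blast
  with stationary_ergodic_lln[OF prob_space_axioms stationary ergodic \<Psi> int0]
  show "AE \<omega> in M. (\<lambda>n. (\<Sum>k<n. \<Phi> (\<epsilon> (int k + 1) \<omega>, Z (int k + 1) \<omega>)) / real n)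
      \<longlonglongrightarrow> expectation (\<lambda>\<omega>. \<Phi> (\<epsilon> 0 \<omega>, Z 0 \<omega>))"
  proof eventually_elim
    case (elim \<omega>)
    then show ?case by (simp only: exp0)
  qed
qed

text \<open>When \<open>s = 0\<close> past innovations cannot be recovered from past regressors; then the larger
  \<open>\<sigma>\<close>-field of the hypothesis contains them outright.\<close>

lemma innovation_filtration:
  obtains \<eta> :: "int \<Rightarrow> 'w \<Rightarrow> real" and F :: "int \<Rightarrow> 'w measure"
  where "\<And>i. AE \<omega> in M. \<eta> i \<omega> = \<epsilon> i \<omega>"
    and "\<And>i. \<eta> i \<in> borel_measurable M"
    and "\<And>i. subalgebra M (F i)"
    and "\<And>i j. j \<le> i \<Longrightarrow> Z j \<in> measurable (F i) (regr_space s q)"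
    and "\<And>i j. j < i \<Longrightarrow> \<eta> j \<in> borel_measurable (F i)"
    and "\<And>i. indep_set (sigma_rv M (\<epsilon> i)) (sets (F i))"
proof (cases "s = 0")
  case True
  define F where "F = (\<lambda>i. sigma (space M) (sigma_past_innov M (regr_space s q) Z \<epsilon> i))"
  have alg: "sigma_algebra (space M) (sigma_past_innov M (regr_space s q) Z \<epsilon> i)" for i
    unfolding sigma_past_innov_def by (rule sigma_algebra_sigma_sets) auto
  have F: "sets (F i) = sigma_past_innov M (regr_space s q) Z \<epsilon> i" "space (F i) = space M" for i
    using sigma_algebra.sets_measure_of_eq[OF alg[of i]] sigma_algebra.space_measure_of_eq[OF alg[of i]]
    by (simp_all add: F_def)
  show ?thesis
  proof (rule that[of \<epsilon> F])
    show "subalgebra M (F i)" for i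
      using sigma_past_innov_subset[OF Z_measurable eps_meas] by (simp add: subalgebra_def F)
    show "Z j \<in> measurable (F i) (regr_space s q)" if "j \<le> i" for i j
      using that measurable_space[OF Z_measurable[of j]]
      by (intro measurableI) (auto simp: F sigma_past_innov_def intro!: sigma_sets.Basic)
    show "\<epsilon> j \<in> borel_measurable (F i)" if "j < i" for i j
      using that by (intro measurableI) (auto simp: F sigma_past_innov_def intro!: sigma_sets.Basic)
  qed (use eps_past_no_lag[OF True] F in auto)
next
  case False
  define F where "F = (\<lambda>i. sigma (space M) (sigma_past M (regr_space s q) Z i))"
  have alg: "sigma_algebra (space M) (sigma_past M (regr_space s q) Z i)" for i
    unfolding sigma_past_def by (rule sigma_algebra_sigma_sets) auto
  have F: "sets (F i) = sigma_past M (regr_space s q) Z i" "space (F i) = space M" for i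
    using sigma_algebra.sets_measure_of_eq[OF alg[of i]] sigma_algebra.space_measure_of_eq[OF alg[of i]]
    by (simp_all add: F_def)
  have Z_F: "Z j \<in> measurable (F i) (regr_space s q)" if "j \<le> i" for i j
    using that measurable_space[OF Z_measurable[of j]]
    by (intro measurableI) (auto simp: F sigma_past_def intro!: sigma_sets.Basic)
  \<comment> \<open>The \<sigma>-field of the past is not completed, so \<open>\<epsilon> j\<close>
    itself need not be measurable in it; this version is, and differs from it on a null set
    only.\<close>
  define \<eta> where "\<eta> = (\<lambda>i \<omega>. (Y i \<omega> - mean (Z i \<omega>)) / scale (Z i \<omega>))"
  show ?thesis
  proof (rule that[of \<eta> F])
    show "AE \<omega> in M. \<eta> i \<omega> = \<epsilon> i \<omega>" for i
      using eps_path[of i] by eventually_elim (simp add: \<eta>_def path_innov_def path_regr_shift)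
    show "\<eta> i \<in> borel_measurable M" for i unfolding \<eta>_def by measurable
    show "subalgebra M (F i)" for i
      using sigma_past_subset[OF Z_measurable] by (simp add: subalgebra_def F)
    show "\<eta> j \<in> borel_measurable (F i)" if "j < i" for i j
    proof -
      have [measurable]: "Z j \<in> measurable (F i) (regr_space s q)" using that by (intro Z_F) simp
      \<comment> \<open>For \<open>j < i\<close> the response \<open>Y j\<close> is the first lag in
        \<open>Z (j + 1)\<close>, whose index is still at most \<open>i\<close>.\<close>
      have "(\<lambda>z. fst z 1) \<in> borel_measurable (regr_space s q :: 'd regr measure)"
        unfolding regr_space_def using False
        by (intro measurable_compose[OF measurable_fst measurable_component_singleton]) simp
      moreover have "Z (j + 1) \<in> measurable (F i) (regr_space s q)" using that by (intro Z_F) simp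
      ultimately have "(\<lambda>\<omega>. fst (Z (j + 1) \<omega>) 1) \<in> borel_measurable (F i)"
        by (rule measurable_compose[rotated])
      moreover have "fst (Z (j + 1) \<omega>) 1 = Y j \<omega>" for \<omega>
        using False by (simp add: Z_eq regressor_def)
      ultimately have [measurable]: "Y j \<in> borel_measurable (F i)" by simp
      show ?thesis unfolding \<eta>_def by measurable
    qed
  qed (use eps_past F Z_F in auto)
qed

end

section \<open>Local asymptotic normality\<close>

lemma sum_int_interval: "(\<Sum>i = 1..int n. g i) = (\<Sum>k<n. g (int k + 1))"
  by (rule sum.reindex_bij_witness[of _ "\<lambda>k. int k + 1" "\<lambda>i. nat (i - 1)"]) auto

lemma powr_minus_half: "real n powr (- 1 / 2) = 1 / sqrt (real n)"
  by (cases "n = 0") (simp_all add: powr_minus_divide powr_half_sqrt)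

locale lan_model = null_model M Y \<epsilon> X Z s q mean scale + smooth_density f
  for M :: "'w measure" and Y \<epsilon> :: "int \<Rightarrow> 'w \<Rightarrow> real"
    and X :: "int \<Rightarrow> 'w \<Rightarrow> real ^ ('d::finite)" and Z :: "int \<Rightarrow> 'w \<Rightarrow> 'd regr"
    and s q :: nat and mean scale :: "'d regr \<Rightarrow> real" and f :: "real \<Rightarrow> real" +
  fixes G S :: "'d regr \<Rightarrow> real" and h h' :: real
  assumes G_meas [measurable]: "G \<in> borel_measurable (regr_space s q)"
    and S_meas [measurable]: "S \<in> borel_measurable (regr_space s q)"
    and alternative_scale_pos: "\<And>n z. n \<ge> 1 \<Longrightarrow> z \<in> space (regr_space s q) \<Longrightarrow>
      0 < scale z + h' * real n powr (- 1 / 2) * S z"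
    and A1_2: "assumption_A1_2 M f (\<epsilon> 0)"
    and A2: "assumption_A2 M f (\<epsilon> 0)"
    and A3: "assumption_A3 M f (\<epsilon> 0) (Z 0) scale G S"
begin

abbreviation u :: "'d regr \<Rightarrow> real" where "u z \<equiv> G z / scale z"
abbreviation v :: "'d regr \<Rightarrow> real" where "v z \<equiv> S z / scale z"
abbreviation Msc :: "real \<Rightarrow> real" where "Msc \<equiv> score f"
abbreviation \<tau>2 :: real where "\<tau>2 \<equiv> lan_variance M f (\<epsilon> 0) (Z 0) scale G S h h'"

definition lin_term :: "real \<times> 'd regr \<Rightarrow> real" where
  "lin_term = (\<lambda>(x, z). - (h * Msc x * u z + h' * (1 + x * Msc x) * v z))"

text \<open>\<open>n\<close> times the second-order Taylor term at location
  \<open>h * u z / sqrt n\<close> and scale \<open>1 + h' * v z / sqrt n\<close>.\<close>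

definition quad_term :: "real \<times> 'd regr \<Rightarrow> real" where
  "quad_term = (\<lambda>(x, z). (h\<^sup>2 * (aa_term f x * (u z)\<^sup>2) + 2 * h * h' * (ab_term f x * (u z * v z))
     + h'\<^sup>2 * (bb_term f x * (v z)\<^sup>2)) / 2)"

definition weight :: "'d regr \<Rightarrow> real" where
  "weight z = \<bar>h * u z\<bar> + \<bar>h' * v z\<bar>"

declare score_measurable [measurable] f_measurable [measurable]

lemma deriv_score_measurable [measurable]: "deriv (score f) \<in> borel_measurable borel"
  using score_diff by (rule borel_measurable_deriv)

lemma aa_term_measurable [measurable]: "aa_term f \<in> borel_measurable borel"
  unfolding aa_term_def by measurable

lemma ab_term_measurable [measurable]: "ab_term f \<in> borel_measurable borel"
  unfolding ab_term_def by measurable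

lemma bb_term_measurable [measurable]: "bb_term f \<in> borel_measurable borel"
  unfolding bb_term_def by measurable

lemma weight_measurable [measurable]: "weight \<in> borel_measurable (regr_space s q)"
  unfolding weight_def by measurable

lemma lin_term_measurable [measurable]: "lin_term \<in> borel_measurable (borel \<Otimes>\<^sub>M regr_space s q)"
  unfolding lin_term_def by measurable

lemma quad_term_measurable [measurable]: "quad_term \<in> borel_measurable (borel \<Otimes>\<^sub>M regr_space s q)"
  unfolding quad_term_def by measurable

section \<open>Moments at time 0\<close>

lemma square_integrable:
  "integrable M (\<lambda>\<omega>. (u (Z 0 \<omega>))\<^sup>2)" "integrable M (\<lambda>\<omega>. (v (Z 0 \<omega>))\<^sup>2)"
  "integrable M (\<lambda>\<omega>. (Msc (\<epsilon> 0 \<omega>))\<^sup>2)" "integrable M (\<lambda>\<omega>. (\<epsilon> 0 \<omega> * Msc (\<epsilon> 0 \<omega>))\<^sup>2)"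
proof -
  obtain l where l: "0 < l"
    and int: "integrable M (\<lambda>\<omega>. \<bar>u (Z 0 \<omega>)\<bar> powr (l + 2))" "integrable M (\<lambda>\<omega>. \<bar>v (Z 0 \<omega>)\<bar> powr (l + 2))"
      "integrable M (\<lambda>\<omega>. \<bar>Msc (\<epsilon> 0 \<omega>)\<bar> powr (l + 2))"
      "integrable M (\<lambda>\<omega>. \<bar>\<epsilon> 0 \<omega> * Msc (\<epsilon> 0 \<omega>)\<bar> powr (l + 2))"
    using A3 unfolding assumption_A3_def by blast
  show "integrable M (\<lambda>\<omega>. (u (Z 0 \<omega>))\<^sup>2)" "integrable M (\<lambda>\<omega>. (v (Z 0 \<omega>))\<^sup>2)"
    "integrable M (\<lambda>\<omega>. (Msc (\<epsilon> 0 \<omega>))\<^sup>2)" "integrable M (\<lambda>\<omega>. (\<epsilon> 0 \<omega> * Msc (\<epsilon> 0 \<omega>))\<^sup>2)"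
    by (rule integrable_square_of_powr[OF _ int(1) l] integrable_square_of_powr[OF _ int(2) l]
        integrable_square_of_powr[OF _ int(3) l] integrable_square_of_powr[OF _ int(4) l]; measurable)+
qed

lemma uv_integrable: "integrable M (\<lambda>\<omega>. u (Z 0 \<omega>) * v (Z 0 \<omega>))"
  by (rule integrable_mult_of_squares) (use square_integrable in measurable)

lemma score_moments:
  "has_bochner_integral M (\<lambda>\<omega>. Msc (\<epsilon> 0 \<omega>)) 0"
  "has_bochner_integral M (\<lambda>\<omega>. \<epsilon> 0 \<omega> * Msc (\<epsilon> 0 \<omega>)) (- 1)"
  "has_bochner_integral M (\<lambda>\<omega>. aa_term f (\<epsilon> 0 \<omega>)) 0"
  "has_bochner_integral M (\<lambda>\<omega>. \<epsilon> 0 \<omega> * aa_term f (\<epsilon> 0 \<omega>)) 0"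
  "has_bochner_integral M (\<lambda>\<omega>. (\<epsilon> 0 \<omega>)\<^sup>2 * aa_term f (\<epsilon> 0 \<omega>)) 2"
  using A2 by (simp_all add: assumption_A2_def aa_term_def)

lemma ab_moment: "has_bochner_integral M (\<lambda>\<omega>. ab_term f (\<epsilon> 0 \<omega>)) 0"
  using has_bochner_integral_add[OF has_bochner_integral_mult_right[OF score_moments(1), of 2] score_moments(4)]
  by (simp add: ab_term_def)

text \<open>The moments of \<open>assumption_A2\<close> balance: 2 - 4 + 2 = 0.\<close>

lemma bb_moment: "has_bochner_integral M (\<lambda>\<omega>. bb_term f (\<epsilon> 0 \<omega>)) 0"
proof -
  have "has_bochner_integral M (\<lambda>_. 2 :: real) 2" by (simp add: has_bochner_integral_iff prob_space)
  from has_bochner_integral_add[OF has_bochner_integral_add[OF this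
      has_bochner_integral_mult_right[OF score_moments(2), of 4]] score_moments(5)]
  show ?thesis by (simp add: bb_term_def)
qed

lemma origin_product:
  fixes g :: "real \<Rightarrow> real" and w :: "'d regr \<Rightarrow> real"
  assumes [measurable]: "g \<in> borel_measurable borel" and w [measurable]: "w \<in> borel_measurable (regr_space s q)"
    and g: "has_bochner_integral M (\<lambda>\<omega>. g (\<epsilon> 0 \<omega>)) c" and int: "integrable M (\<lambda>\<omega>. w (Z 0 \<omega>))"
  shows "has_bochner_integral M (\<lambda>\<omega>. g (\<epsilon> 0 \<omega>) * w (Z 0 \<omega>)) (c * expectation (\<lambda>\<omega>. w (Z 0 \<omega>)))"
proof -
  obtain \<eta> F where "\<And>i :: int. AE \<omega> in M. \<eta> i \<omega> = \<epsilon> i \<omega>" and F: "\<And>i. subalgebra M (F i)"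
    "\<And>i j. j \<le> i \<Longrightarrow> Z j \<in> measurable (F i) (regr_space s q)"
    "\<And>i. indep_set (sigma_rv M (\<epsilon> i)) (sets (F i))"
    by (rule innovation_filtration) blast
  have [measurable]: "Z 0 \<in> measurable (F 0) (regr_space s q)" by (rule F(2)) simp
  have "(\<lambda>\<omega>. w (Z 0 \<omega>)) \<in> borel_measurable (F 0)" by measurable
  from indep_past_product[OF F(3)[of 0] F(1) eps_meas assms(1) this _ int] g
  show ?thesis by (simp add: has_bochner_integral_iff)
qed

text \<open>Each summand is a centred function of the innovation times a function of the independent
  regressor. Hence the likelihood ratio has no second-order drift of its own, and the shift by half
  the variance is due to the logarithm alone.\<close>

lemma quad_term_moment: "has_bochner_integral M (\<lambda>\<omega>. quad_term (\<epsilon> 0 \<omega>, Z 0 \<omega>)) 0"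
proof -
  have 1: "has_bochner_integral M (\<lambda>\<omega>. aa_term f (\<epsilon> 0 \<omega>) * (u (Z 0 \<omega>))\<^sup>2) (0 * expectation (\<lambda>\<omega>. (u (Z 0 \<omega>))\<^sup>2))"
    by (rule origin_product[OF _ _ score_moments(3) square_integrable(1)]) measurable
  have 2: "has_bochner_integral M (\<lambda>\<omega>. ab_term f (\<epsilon> 0 \<omega>) * (u (Z 0 \<omega>) * v (Z 0 \<omega>)))
      (0 * expectation (\<lambda>\<omega>. u (Z 0 \<omega>) * v (Z 0 \<omega>)))"
    by (rule origin_product[OF _ _ ab_moment uv_integrable]) measurable
  have 3: "has_bochner_integral M (\<lambda>\<omega>. bb_term f (\<epsilon> 0 \<omega>) * (v (Z 0 \<omega>))\<^sup>2) (0 * expectation (\<lambda>\<omega>. (v (Z 0 \<omega>))\<^sup>2))"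
    by (rule origin_product[OF _ _ bb_moment square_integrable(2)]) measurable
  have "has_bochner_integral M (\<lambda>\<omega>. (h\<^sup>2 * (aa_term f (\<epsilon> 0 \<omega>) * (u (Z 0 \<omega>))\<^sup>2)
      + (2 * h * h') * (ab_term f (\<epsilon> 0 \<omega>) * (u (Z 0 \<omega>) * v (Z 0 \<omega>)))
      + h'\<^sup>2 * (bb_term f (\<epsilon> 0 \<omega>) * (v (Z 0 \<omega>))\<^sup>2)) / 2)
      ((h\<^sup>2 * (0 * expectation (\<lambda>\<omega>. (u (Z 0 \<omega>))\<^sup>2)) + (2 * h * h') * (0 * expectation (\<lambda>\<omega>. u (Z 0 \<omega>) * v (Z 0 \<omega>)))
      + h'\<^sup>2 * (0 * expectation (\<lambda>\<omega>. (v (Z 0 \<omega>))\<^sup>2))) / 2)"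
    by (intro has_bochner_integral_divide has_bochner_integral_add has_bochner_integral_mult_right 1 2 3)
  then show ?thesis by (simp add: quad_term_def)
qed

text \<open>Independence splits each product into an innovation moment and a regressor moment. As
  \<open>\<epsilon> 0 * Msc (\<epsilon> 0)\<close> has mean -1, the square of
  \<open>1 + \<epsilon> 0 * Msc (\<epsilon> 0)\<close> has mean
  \<open>1 - 2 + fisher_mom M f (\<epsilon> 0) 2\<close>; in the mixed moment the linear part drops
  out because the score is centred.\<close>

lemma lin_term_square_moment: "has_bochner_integral M (\<lambda>\<omega>. (lin_term (\<epsilon> 0 \<omega>, Z 0 \<omega>))\<^sup>2) \<tau>2"
proof -
  have I: "has_bochner_integral M (\<lambda>\<omega>. (Msc (\<epsilon> 0 \<omega>))\<^sup>2) (fisher_mom M f (\<epsilon> 0) 0)"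
    using square_integrable(3) by (simp add: has_bochner_integral_iff fisher_mom_def)
  have I2: "has_bochner_integral M (\<lambda>\<omega>. (\<epsilon> 0 \<omega> * Msc (\<epsilon> 0 \<omega>))\<^sup>2) (fisher_mom M f (\<epsilon> 0) 2)"
    using square_integrable(4) by (simp add: has_bochner_integral_iff fisher_mom_def power_mult_distrib)
  have "integrable M (\<lambda>\<omega>. Msc (\<epsilon> 0 \<omega>) * (\<epsilon> 0 \<omega> * Msc (\<epsilon> 0 \<omega>)))"
    by (rule integrable_mult_of_squares) (use square_integrable in measurable)
  then have I1: "has_bochner_integral M (\<lambda>\<omega>. Msc (\<epsilon> 0 \<omega>) * (\<epsilon> 0 \<omega> * Msc (\<epsilon> 0 \<omega>))) (fisher_mom M f (\<epsilon> 0) 1)"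
    by (simp add: has_bochner_integral_iff fisher_mom_def power2_eq_square algebra_simps)
  have one: "has_bochner_integral M (\<lambda>_. 1 :: real) 1" by (simp add: has_bochner_integral_iff prob_space)
  have J2: "has_bochner_integral M (\<lambda>\<omega>. (1 + \<epsilon> 0 \<omega> * Msc (\<epsilon> 0 \<omega>))\<^sup>2) (fisher_mom M f (\<epsilon> 0) 2 - 1)"
    using has_bochner_integral_add[OF has_bochner_integral_add[OF one
        has_bochner_integral_mult_right[OF score_moments(2), of 2]] I2]
    by (simp add: power2_sum algebra_simps)
  have J1: "has_bochner_integral M (\<lambda>\<omega>. Msc (\<epsilon> 0 \<omega>) * (1 + \<epsilon> 0 \<omega> * Msc (\<epsilon> 0 \<omega>))) (fisher_mom M f (\<epsilon> 0) 1)"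
    using has_bochner_integral_add[OF score_moments(1) I1] by (simp add: distrib_left)
  have 1: "has_bochner_integral M (\<lambda>\<omega>. (Msc (\<epsilon> 0 \<omega>))\<^sup>2 * (u (Z 0 \<omega>))\<^sup>2)
      (fisher_mom M f (\<epsilon> 0) 0 * expectation (\<lambda>\<omega>. (u (Z 0 \<omega>))\<^sup>2))"
    by (rule origin_product[OF _ _ I square_integrable(1)]) measurable
  have 2: "has_bochner_integral M (\<lambda>\<omega>. (1 + \<epsilon> 0 \<omega> * Msc (\<epsilon> 0 \<omega>))\<^sup>2 * (v (Z 0 \<omega>))\<^sup>2)
      ((fisher_mom M f (\<epsilon> 0) 2 - 1) * expectation (\<lambda>\<omega>. (v (Z 0 \<omega>))\<^sup>2))"
    by (rule origin_product[OF _ _ J2 square_integrable(2)]) measurable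
  have 3: "has_bochner_integral M (\<lambda>\<omega>. (Msc (\<epsilon> 0 \<omega>) * (1 + \<epsilon> 0 \<omega> * Msc (\<epsilon> 0 \<omega>))) * (u (Z 0 \<omega>) * v (Z 0 \<omega>)))
      (fisher_mom M f (\<epsilon> 0) 1 * expectation (\<lambda>\<omega>. u (Z 0 \<omega>) * v (Z 0 \<omega>)))"
    by (rule origin_product[OF _ _ J1 uv_integrable]) measurable
  have combined: "has_bochner_integral M (\<lambda>\<omega>. h\<^sup>2 * ((Msc (\<epsilon> 0 \<omega>))\<^sup>2 * (u (Z 0 \<omega>))\<^sup>2)
      + h'\<^sup>2 * ((1 + \<epsilon> 0 \<omega> * Msc (\<epsilon> 0 \<omega>))\<^sup>2 * (v (Z 0 \<omega>))\<^sup>2)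
      + (2 * h * h') * ((Msc (\<epsilon> 0 \<omega>) * (1 + \<epsilon> 0 \<omega> * Msc (\<epsilon> 0 \<omega>))) * (u (Z 0 \<omega>) * v (Z 0 \<omega>))))
      (h\<^sup>2 * (fisher_mom M f (\<epsilon> 0) 0 * expectation (\<lambda>\<omega>. (u (Z 0 \<omega>))\<^sup>2))
      + h'\<^sup>2 * ((fisher_mom M f (\<epsilon> 0) 2 - 1) * expectation (\<lambda>\<omega>. (v (Z 0 \<omega>))\<^sup>2))
      + (2 * h * h') * (fisher_mom M f (\<epsilon> 0) 1 * expectation (\<lambda>\<omega>. u (Z 0 \<omega>) * v (Z 0 \<omega>))))"
    by (intro has_bochner_integral_add has_bochner_integral_mult_right 1 2 3)
  have square: "(lin_term (x, z))\<^sup>2 = h\<^sup>2 * ((Msc x)\<^sup>2 * (u z)\<^sup>2) + h'\<^sup>2 * ((1 + x * Msc x)\<^sup>2 * (v z)\<^sup>2)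
      + (2 * h * h') * ((Msc x * (1 + x * Msc x)) * (u z * v z))" for x z
  proof -
    have "(- (h * a * b + h' * c * d))\<^sup>2 = h\<^sup>2 * (a\<^sup>2 * b\<^sup>2) + h'\<^sup>2 * (c\<^sup>2 * d\<^sup>2) + (2 * h * h') * ((a * c) * (b * d))"
      for a b c d by (simp only: power2_minus) (simp add: power2_sum power_mult_distrib algebra_simps)
    then show ?thesis unfolding lin_term_def split_conv .
  qed
  have variance: "\<tau>2 = h\<^sup>2 * (fisher_mom M f (\<epsilon> 0) 0 * expectation (\<lambda>\<omega>. (u (Z 0 \<omega>))\<^sup>2))
      + h'\<^sup>2 * ((fisher_mom M f (\<epsilon> 0) 2 - 1) * expectation (\<lambda>\<omega>. (v (Z 0 \<omega>))\<^sup>2))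
      + (2 * h * h') * (fisher_mom M f (\<epsilon> 0) 1 * expectation (\<lambda>\<omega>. u (Z 0 \<omega>) * v (Z 0 \<omega>)))"
    by (simp add: lan_variance_def power2_eq_square)
  show ?thesis unfolding square variance by (rule combined)
qed

lemma weight_square_integrable: "integrable M (\<lambda>\<omega>. (weight (Z 0 \<omega>))\<^sup>2)"
proof (rule Bochner_Integration.integrable_bound)
  show "integrable M (\<lambda>\<omega>. 2 * (h\<^sup>2 * (u (Z 0 \<omega>))\<^sup>2 + h'\<^sup>2 * (v (Z 0 \<omega>))\<^sup>2))"
    using square_integrable by auto
  have "(weight z)\<^sup>2 \<le> 2 * (h\<^sup>2 * (u z)\<^sup>2 + h'\<^sup>2 * (v z)\<^sup>2)" for z
    using sum_squares_bound[of "\<bar>h * u z\<bar>" "\<bar>h' * v z\<bar>"]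
    by (simp only: weight_def power2_sum power2_abs) (simp add: power_mult_distrib power_divide)
  then show "AE \<omega> in M. norm ((weight (Z 0 \<omega>))\<^sup>2) \<le> norm (2 * (h\<^sup>2 * (u (Z 0 \<omega>))\<^sup>2 + h'\<^sup>2 * (v (Z 0 \<omega>))\<^sup>2))"
    by (intro AE_I2) (auto intro: order_trans[OF _ abs_ge_self])
qed measurable

section \<open>The central sequence as a sum of martingale differences\<close>

lemma central_seq_eq:
  "central_seq f \<epsilon> Z scale G S h h' n \<omega> = (\<Sum>k<n. lin_term (\<epsilon> (int k + 1) \<omega>, Z (int k + 1) \<omega>)) / sqrt (real n)"
  unfolding central_seq_def sum_int_interval powr_minus_half
  by (simp only: lin_term_def split_conv sum_negf) simp

lemma central_seq_measurable [measurable]: "central_seq f \<epsilon> Z scale G S h h' n \<in> borel_measurable M"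
  unfolding central_seq_eq[abs_def] by measurable

lemma loglik_ratio_measurable [measurable]: "loglik_ratio f \<epsilon> Z scale G S h h' n \<in> borel_measurable M"
  unfolding loglik_ratio_def Let_def loc_scale_def sum_int_interval by measurable

text \<open>Both innovation factors, \<open>Msc x\<close> and \<open>1 + x * Msc x\<close>, are
  centred. The regressor factor is measurable in \<open>F\<close> and merges with \<open>W\<close>;
  their product is integrable because both are square integrable.\<close>

lemma lin_term_orthogonal:
  assumes F: "subalgebra M F" "indep_set (sigma_rv M (\<epsilon> (int k + 1))) (sets F)"
    and Z_F [measurable]: "Z (int k + 1) \<in> measurable F (regr_space s q)"
    and W [measurable]: "W \<in> borel_measurable F" and W_sq: "integrable M (\<lambda>\<omega>. (W \<omega>)\<^sup>2)"
  shows "expectation (\<lambda>\<omega>. lin_term (\<epsilon> (int k + 1) \<omega>, Z (int k + 1) \<omega>) * W \<omega>) = 0"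
proof -
  let ?e = "\<epsilon> (int k + 1)" and ?z = "Z (int k + 1)"
  have [measurable]: "W \<in> borel_measurable M" using measurable_from_subalg[OF F(1) W] .
  have prod: "integrable M (\<lambda>\<omega>. g (?e \<omega>) * (w (?z \<omega>) * W \<omega>))"
    "expectation (\<lambda>\<omega>. g (?e \<omega>) * (w (?z \<omega>) * W \<omega>)) = 0"
    if [measurable]: "g \<in> borel_measurable borel" "w \<in> borel_measurable (regr_space s q)"
      and g: "has_bochner_integral M (\<lambda>\<omega>. g (\<epsilon> 0 \<omega>)) 0" and w: "integrable M (\<lambda>\<omega>. (w (Z 0 \<omega>))\<^sup>2)"
    for g w
  proof -
    have meas: "(\<lambda>p. g (fst p)) \<in> borel_measurable (borel \<Otimes>\<^sub>M regr_space s q)"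
      "(\<lambda>p. (w (snd p))\<^sup>2) \<in> borel_measurable (borel \<Otimes>\<^sub>M regr_space s q)" by measurable
    have int_g: "integrable M (\<lambda>\<omega>. g (?e \<omega>))" and exp_g: "expectation (\<lambda>\<omega>. g (?e \<omega>)) = 0"
      using transfer_from_origin(1,2)[OF meas(1)] g by (simp_all add: has_bochner_integral_iff)
    have "integrable M (\<lambda>\<omega>. (w (?z \<omega>))\<^sup>2)" using transfer_from_origin(1)[OF meas(2)] w by simp
    then have int_w: "integrable M (\<lambda>\<omega>. w (?z \<omega>) * W \<omega>)"
      by (intro integrable_mult_of_squares W_sq) measurable
    have "(\<lambda>\<omega>. w (?z \<omega>) * W \<omega>) \<in> borel_measurable F" by measurable
    from indep_past_product[OF F(2,1) eps_meas that(1) this int_g int_w] exp_g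
    show "integrable M (\<lambda>\<omega>. g (?e \<omega>) * (w (?z \<omega>) * W \<omega>))"
      "expectation (\<lambda>\<omega>. g (?e \<omega>) * (w (?z \<omega>) * W \<omega>)) = 0" by simp_all
  qed
  have one: "has_bochner_integral M (\<lambda>_. 1 :: real) 1" by (simp add: has_bochner_integral_iff prob_space)
  have centred: "has_bochner_integral M (\<lambda>\<omega>. 1 + \<epsilon> 0 \<omega> * Msc (\<epsilon> 0 \<omega>)) 0"
    using has_bochner_integral_add[OF one score_moments(2)] by simp
  have p1: "integrable M (\<lambda>\<omega>. Msc (?e \<omega>) * (u (?z \<omega>) * W \<omega>))"
    "expectation (\<lambda>\<omega>. Msc (?e \<omega>) * (u (?z \<omega>) * W \<omega>)) = 0"
    by (rule prod[OF _ _ score_moments(1) square_integrable(1)]; measurable)+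
  have p2: "integrable M (\<lambda>\<omega>. (1 + ?e \<omega> * Msc (?e \<omega>)) * (v (?z \<omega>) * W \<omega>))"
    "expectation (\<lambda>\<omega>. (1 + ?e \<omega> * Msc (?e \<omega>)) * (v (?z \<omega>) * W \<omega>)) = 0"
    by (rule prod[of "\<lambda>x. 1 + x * Msc x", OF _ _ centred square_integrable(2)]; measurable)+
  have "has_bochner_integral M (\<lambda>\<omega>. (- h) * (Msc (?e \<omega>) * (u (?z \<omega>) * W \<omega>))
      + (- h') * ((1 + ?e \<omega> * Msc (?e \<omega>)) * (v (?z \<omega>) * W \<omega>))) ((- h) * 0 + (- h') * 0)"
    by (intro has_bochner_integral_add has_bochner_integral_mult_right) (use p1 p2 in \<open>simp_all only: has_bochner_integral_iff simp_thms\<close>)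
  moreover have "(- h) * (Msc x * (u z * w)) + (- h') * ((1 + x * Msc x) * (v z * w)) = lin_term (x, z) * w" for x z w
  proof -
    have "(- h) * (m * (U * w)) + (- h') * (n * (V * w)) = - (h * m * U + h' * n * V) * w" for m U n V w
      by (simp add: algebra_simps)
    then show ?thesis unfolding lin_term_def split_conv by blast
  qed
  ultimately show ?thesis by (simp add: has_bochner_integral_iff)
qed

lemma lin_term_square_lln:
  "AE \<omega> in M. (\<lambda>n. (\<Sum>k<n. (lin_term (\<epsilon> (int k + 1) \<omega>, Z (int k + 1) \<omega>))\<^sup>2) / real n) \<longlonglongrightarrow> \<tau>2"
proof -
  have "(\<lambda>p. (lin_term p)\<^sup>2) \<in> borel_measurable (borel \<Otimes>\<^sub>M regr_space s q)" by measurable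
  from transfer_from_origin(3)[OF this] lin_term_square_moment
  show ?thesis by (simp add: has_bochner_integral_iff)
qed

theorem central_seq_conv_in_distr:
  "conv_in_distr M (central_seq f \<epsilon> Z scale G S h h') (normal_law 0 \<tau>2)"
proof -
  obtain \<eta> F where \<eta>: "\<And>i. AE \<omega> in M. \<eta> i \<omega> = \<epsilon> i \<omega>" and \<eta>_M [measurable]: "\<And>i. \<eta> i \<in> borel_measurable M"
    and F: "\<And>i. subalgebra M (F i)"
    and Z_F: "\<And>i j. j \<le> i \<Longrightarrow> Z j \<in> measurable (F i) (regr_space s q)"
    and \<eta>_F: "\<And>i j. j < i \<Longrightarrow> \<eta> j \<in> borel_measurable (F i)"
    and indep: "\<And>i. indep_set (sigma_rv M (\<epsilon> i)) (sets (F i))"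
    by (rule innovation_filtration) blast
  \<comment> \<open>Built from the adapted version of the innovations; its sums agree almost surely
    with the central sequence and thus have the same law.\<close>
  define \<xi> where "\<xi> = (\<lambda>k \<omega>. lin_term (\<eta> (int k + 1) \<omega>, Z (int k + 1) \<omega>))"
  have \<xi>_M [measurable]: "\<xi> k \<in> borel_measurable M" for k unfolding \<xi>_def by measurable
  have ae: "AE \<omega> in M. \<forall>k. \<xi> k \<omega> = lin_term (\<epsilon> (int k + 1) \<omega>, Z (int k + 1) \<omega>)"
    unfolding AE_all_countable
  proof
    show "AE \<omega> in M. \<xi> k \<omega> = lin_term (\<epsilon> (int k + 1) \<omega>, Z (int k + 1) \<omega>)" for k
      using \<eta>[of "int k + 1"] by eventually_elim (simp add: \<xi>_def)
  qed
  have sq_meas: "(\<lambda>p. (lin_term p)\<^sup>2) \<in> borel_measurable (borel \<Otimes>\<^sub>M regr_space s q)" by measurable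
  have sq_eq: "integrable M (\<lambda>\<omega>. (\<xi> k \<omega>)\<^sup>2)" "expectation (\<lambda>\<omega>. (\<xi> k \<omega>)\<^sup>2) = \<tau>2" for k
  proof -
    have ae_k: "AE \<omega> in M. (\<xi> k \<omega>)\<^sup>2 = (lin_term (\<epsilon> (int k + 1) \<omega>, Z (int k + 1) \<omega>))\<^sup>2"
      using ae by eventually_elim simp
    have int0: "integrable M (\<lambda>\<omega>. (lin_term (\<epsilon> 0 \<omega>, Z 0 \<omega>))\<^sup>2)" and exp0: "expectation (\<lambda>\<omega>. (lin_term (\<epsilon> 0 \<omega>, Z 0 \<omega>))\<^sup>2) = \<tau>2"
      using lin_term_square_moment by (simp_all add: has_bochner_integral_iff)
    show "integrable M (\<lambda>\<omega>. (\<xi> k \<omega>)\<^sup>2)"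
      using transfer_from_origin(1)[OF sq_meas int0] by (subst integrable_cong_AE[OF _ _ ae_k]) measurable
    show "expectation (\<lambda>\<omega>. (\<xi> k \<omega>)\<^sup>2) = \<tau>2"
      using transfer_from_origin(2)[OF sq_meas int0] exp0 by (subst integral_cong_AE[OF _ _ ae_k]) auto
  qed
  have "weak_conv_m (\<lambda>n. distr M borel (\<lambda>\<omega>. (\<Sum>k<n. \<xi> k \<omega>) / sqrt (real n))) (normal_law 0 \<tau>2)"
  proof (rule martingale_difference_clt[where F = "\<lambda>k. F (int k + 1)" and C = \<tau>2])
    show "\<xi> j \<in> borel_measurable (F (int k + 1))" if "j < k" for j k
    proof -
      have [measurable]: "\<eta> (int j + 1) \<in> borel_measurable (F (int k + 1))"
        "Z (int j + 1) \<in> measurable (F (int k + 1)) (regr_space s q)"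
        using that by (auto intro: \<eta>_F Z_F)
      show ?thesis unfolding \<xi>_def by measurable
    qed
    show "expectation (\<lambda>\<omega>. \<xi> k \<omega> * W \<omega>) = 0"
      if W: "W \<in> borel_measurable (F (int k + 1))" and W_sq: "integrable M (\<lambda>\<omega>. (W \<omega>)\<^sup>2)" for k W
    proof -
      have [measurable]: "W \<in> borel_measurable M" using measurable_from_subalg[OF F W] .
      have "expectation (\<lambda>\<omega>. \<xi> k \<omega> * W \<omega>) = expectation (\<lambda>\<omega>. lin_term (\<epsilon> (int k + 1) \<omega>, Z (int k + 1) \<omega>) * W \<omega>)"
        using ae by (intro integral_cong_AE) (measurable, auto)
      also have "\<dots> = 0" by (rule lin_term_orthogonal[OF F indep Z_F W W_sq]) simp
      finally show ?thesis .
    qed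
    show "AE \<omega> in M. (\<lambda>n. (\<Sum>k<n. (\<xi> k \<omega>)\<^sup>2) / real n) \<longlonglongrightarrow> \<tau>2"
      using ae lin_term_square_lln by eventually_elim simp
  qed (simp_all only: F sq_eq prob_space_axioms order_refl)
  moreover have "distr M borel (\<lambda>\<omega>. (\<Sum>k<n. \<xi> k \<omega>) / sqrt (real n)) = distr M borel (central_seq f \<epsilon> Z scale G S h h' n)" for n
  proof (rule distr_cong_AE)
    show "AE \<omega> in M. (\<Sum>k<n. \<xi> k \<omega>) / sqrt (real n) = central_seq f \<epsilon> Z scale G S h h' n \<omega>"
      using ae by eventually_elim (simp add: central_seq_eq)
  qed auto
  ultimately show ?thesis unfolding conv_in_distr_def by simp
qed

text \<open>Outside one null set five averages converge, and from there on the argument is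
  deterministic. Per observation, \<open>X\<close> is the linear term and \<open>E\<close> the rest
  of the ratio minus 1, that is, the quadratic term plus the cubic remainder.\<close>

theorem loglik_ratio_AE_expansion:
  "AE \<omega> in M. (\<lambda>n. loglik_ratio f \<epsilon> Z scale G S h h' n \<omega> - central_seq f \<epsilon> Z scale G S h h' n \<omega>) \<longlonglongrightarrow> - \<tau>2 / 2"
proof -
  obtain V1 V2 :: "real \<Rightarrow> real \<Rightarrow> real \<Rightarrow> real" where
    V1_all: "\<forall>j k x a a' b. j + k = 2 \<longrightarrow> 0 < b \<longrightarrow>
      (\<exists>a0 \<in> closed_segment a a'. \<bar>dF f j k x a b - dF f j k x a' b\<bar> \<le> V1 x a0 b * \<bar>a - a'\<bar>)"
    and V2_all: "\<forall>j k x a b b'. j + k = 2 \<longrightarrow> 0 < b \<longrightarrow> 0 < b' \<longrightarrow>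
      (\<exists>b0 \<in> closed_segment b b'. \<bar>dF f j k x a b - dF f j k x a b'\<bar> \<le> V2 x a b0 * \<bar>b - b'\<bar>)"
    and dom: "\<exists>\<phi> \<in> borel_measurable borel. \<exists>r>0. (\<forall>x::real. 0 < \<phi> x) \<and> integrable M (\<lambda>\<omega>. \<phi> (\<epsilon> 0 \<omega>)) \<and>
      (\<forall>x a b. 0 < b \<longrightarrow> max \<bar>a\<bar> \<bar>b - 1\<bar> < r \<longrightarrow> \<bar>V1 x a b / f x\<bar> \<le> \<phi> x \<and> \<bar>V2 x a b / f x\<bar> \<le> \<phi> x)"
    using A1_2 unfolding assumption_A1_2_def by auto
  from dom obtain \<phi> r where \<phi>_meas [measurable]: "\<phi> \<in> borel_measurable borel"
    and r: "0 < r" and \<phi>_pos: "\<And>x. 0 < \<phi> x" and \<phi>_int: "integrable M (\<lambda>\<omega>. \<phi> (\<epsilon> 0 \<omega>))"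
    and V_le: "\<And>x a b. 0 < b \<Longrightarrow> max \<bar>a\<bar> \<bar>b - 1\<bar> < r \<Longrightarrow> \<bar>V1 x a b / f x\<bar> \<le> \<phi> x \<and> \<bar>V2 x a b / f x\<bar> \<le> \<phi> x"
    by (elim bexE exE conjE) blast
  have V1: "\<exists>a0 \<in> closed_segment a a'. \<bar>dF f j k x a b - dF f j k x a' b\<bar> \<le> V1 x a0 b * \<bar>a - a'\<bar>"
    if "j + k = 2" "0 < b" for j k x a a' b using V1_all that by blast
  have V2: "\<exists>b0 \<in> closed_segment b b'. \<bar>dF f j k x a b - dF f j k x a b'\<bar> \<le> V2 x a b0 * \<bar>b - b'\<bar>"
    if "j + k = 2" "0 < b" "0 < b'" for j k x a b b' using V2_all that by blast
  have meas: "(\<lambda>p. \<bar>quad_term p\<bar>) \<in> borel_measurable (borel \<Otimes>\<^sub>M regr_space s q)"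
    "(\<lambda>p. (weight (snd p))\<^sup>2) \<in> borel_measurable (borel \<Otimes>\<^sub>M regr_space s q)"
    "(\<lambda>p. \<phi> (fst p) * (weight (snd p))\<^sup>2) \<in> borel_measurable (borel \<Otimes>\<^sub>M regr_space s q)"
    by measurable
  have q_int: "integrable M (\<lambda>\<omega>. quad_term (\<epsilon> 0 \<omega>, Z 0 \<omega>))" and q_exp: "expectation (\<lambda>\<omega>. quad_term (\<epsilon> 0 \<omega>, Z 0 \<omega>)) = 0"
    using quad_term_moment by (simp_all add: has_bochner_integral_iff)
  \<comment> \<open>\<open>\<phi> (\<epsilon> 0)\<close> is known only to be integrable; its product
    with the squared weight is integrable because innovation and regressor are independent.\<close>
  have "has_bochner_integral M (\<lambda>\<omega>. \<phi> (\<epsilon> 0 \<omega>) * (weight (Z 0 \<omega>))\<^sup>2)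
      (expectation (\<lambda>\<omega>. \<phi> (\<epsilon> 0 \<omega>)) * expectation (\<lambda>\<omega>. (weight (Z 0 \<omega>))\<^sup>2))"
    using \<phi>_int weight_square_integrable by (intro origin_product) (auto simp: has_bochner_integral_iff)
  then have \<phi>w_int: "integrable M (\<lambda>\<omega>. \<phi> (\<epsilon> 0 \<omega>) * (weight (Z 0 \<omega>))\<^sup>2)"
    by (simp add: has_bochner_integral_iff)
  have q_lln: "AE \<omega> in M. (\<lambda>n. (\<Sum>k<n. quad_term (\<epsilon> (int k + 1) \<omega>, Z (int k + 1) \<omega>)) / real n) \<longlonglongrightarrow> 0"
    using transfer_from_origin(3)[OF quad_term_measurable q_int] by (simp only: q_exp)
  have q_abs_lln: "AE \<omega> in M. (\<lambda>n. (\<Sum>k<n. \<bar>quad_term (\<epsilon> (int k + 1) \<omega>, Z (int k + 1) \<omega>)\<bar>) / real n)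
      \<longlonglongrightarrow> expectation (\<lambda>\<omega>. \<bar>quad_term (\<epsilon> 0 \<omega>, Z 0 \<omega>)\<bar>)"
    using transfer_from_origin(3)[OF meas(1)] q_int by simp
  have w_lln: "AE \<omega> in M. (\<lambda>n. (\<Sum>k<n. (weight (Z (int k + 1) \<omega>))\<^sup>2) / real n) \<longlonglongrightarrow> expectation (\<lambda>\<omega>. (weight (Z 0 \<omega>))\<^sup>2)"
    using transfer_from_origin(3)[OF meas(2)] weight_square_integrable by simp
  have \<phi>w_lln: "AE \<omega> in M. (\<lambda>n. (\<Sum>k<n. \<phi> (\<epsilon> (int k + 1) \<omega>) * (weight (Z (int k + 1) \<omega>))\<^sup>2) / real n)
      \<longlonglongrightarrow> expectation (\<lambda>\<omega>. \<phi> (\<epsilon> 0 \<omega>) * (weight (Z 0 \<omega>))\<^sup>2)"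
    using transfer_from_origin(3)[OF meas(3)] \<phi>w_int by simp
  from lin_term_square_lln q_lln q_abs_lln w_lln \<phi>w_lln AE_space show ?thesis
  proof eventually_elim
    case (elim \<omega>)
    define e where "e = (\<lambda>k. \<epsilon> (int k + 1) \<omega>)"
    define z where "z = (\<lambda>k. Z (int k + 1) \<omega>)"
    define a where "a = (\<lambda>n k. h * (1 / sqrt (real n)) * u (z k))"
    define c where "c = (\<lambda>n k. h' * (1 / sqrt (real n)) * v (z k))"
    define X where "X = (\<lambda>n k. lin_term (e k, z k) / sqrt (real n))"
    define E where "E = (\<lambda>n k. loc_scale f (e k) (a n k) (1 + c n k) / f (e k) - 1 - X n k)"
    have z: "z k \<in> space (regr_space s q)" for k
      unfolding z_def using elim(6) by (rule measurable_space[OF Z_measurable])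
    have X_eq: "X n k = - (a n k * Msc (e k) + c n k * (1 + e k * Msc (e k)))" for n k
    proof -
      have "- (h * m * U + h' * n * V) / t = - (h * (1 / t) * U * m + h' * (1 / t) * V * n)" for m U n V t
        by (simp add: divide_inverse algebra_simps)
      then show ?thesis unfolding X_def lin_term_def a_def c_def split_conv .
    qed
    have q_eq: "quad_term (e k, z k) / real n = ((a n k)\<^sup>2 * aa_term f (e k) + 2 * a n k * c n k * ab_term f (e k)
        + (c n k)\<^sup>2 * bb_term f (e k)) / 2" if "0 < n" for n k
    proof -
      have inv: "(1 / sqrt (real n)) * (1 / sqrt (real n)) = 1 / real n" by simp
      have gen: "((h * i * U)\<^sup>2 * A + 2 * (h * i * U) * (h' * i * V) * B + (h' * i * V)\<^sup>2 * C) / 2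
          = (h\<^sup>2 * (A * U\<^sup>2) + 2 * h * h' * (B * (U * V)) + h'\<^sup>2 * (C * V\<^sup>2)) / 2 * (i * i)"
        for i U V A B C
        by (simp add: algebra_simps power2_eq_square)
      show ?thesis unfolding a_def c_def quad_term_def split_conv gen inv
        by (simp only: times_divide_eq_right mult_1_right)
    qed
    have E_bound: "\<bar>E n k - quad_term (e k, z k) / real n\<bar> \<le> \<phi> (e k) * (weight (z k) / sqrt (real n)) ^ 3"
      if n: "0 < n" and small: "weight (z k) / sqrt (real n) < r" for n k
    proof -
      have w_eq: "weight (z k) / sqrt (real n) = \<bar>a n k\<bar> + \<bar>c n k\<bar>"
        by (simp add: weight_def a_def c_def abs_mult add_divide_distrib mult.commute)
      \<comment> \<open>Positivity of the scale under the alternative, divided by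
        \<open>scale (z k)\<close>, is positivity of the family parameter
        \<open>1 + c n k\<close>.\<close>
      have "0 < scale (z k) + h' * (1 / sqrt (real n)) * S (z k)"
        using alternative_scale_pos[of n, OF _ z[of k]] n by (simp only: powr_minus_half)
      then have "0 < (scale (z k) + h' * (1 / sqrt (real n)) * S (z k)) / scale (z k)"
        using scale_pos[OF z] by simp
      also have "\<dots> = 1 + c n k" using scale_pos[OF z[of k]] by (simp add: c_def add_divide_distrib)
      finally have c_pos: "0 < 1 + c n k" .
      have sm: "\<bar>a n k\<bar> < r" "\<bar>c n k\<bar> < r" using small unfolding w_eq by linarith+
      have "\<bar>loc_scale f (e k) (a n k) (1 + c n k) / f (e k) - (1 - (a n k * Msc (e k) + c n k * (1 + e k * Msc (e k)))
          + ((a n k)\<^sup>2 * aa_term f (e k) + 2 * a n k * c n k * ab_term f (e k) + (c n k)\<^sup>2 * bb_term f (e k)) / 2)\<bar>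
        \<le> \<phi> (e k) * (\<bar>a n k\<bar> + \<bar>c n k\<bar>) ^ 3"
        by (rule loc_scale_expansion[OF c_pos sm V1 V2 V_le])
      also have "loc_scale f (e k) (a n k) (1 + c n k) / f (e k) - (1 - (a n k * Msc (e k) + c n k * (1 + e k * Msc (e k)))
          + ((a n k)\<^sup>2 * aa_term f (e k) + 2 * a n k * c n k * ab_term f (e k) + (c n k)\<^sup>2 * bb_term f (e k)) / 2)
        = E n k - quad_term (e k, z k) / real n"
      proof -
        have "L - (1 - A + Q) = L - 1 - - A - Q" for L A Q :: real by simp
        then show ?thesis unfolding q_eq[OF n] E_def X_eq .
      qed
      finally show ?thesis unfolding w_eq .
    qed
    have X_max: "eventually (\<lambda>n. \<forall>k<n. \<bar>X n k\<bar> \<le> \<delta>) sequentially" if \<delta>: "0 < \<delta>" for \<delta>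
    proof -
      have "0 < \<delta>\<^sup>2" using \<delta> by simp
      from average_convergent_imp_max_negligible[OF elim(1) this] eventually_gt_at_top[of 0]
      show ?thesis
      proof eventually_elim
        case (elim n)
        show ?case
        proof (intro allI impI)
          fix k assume "k < n"
          then have "(X n k)\<^sup>2 \<le> \<delta>\<^sup>2"
            using elim by (simp add: X_def e_def z_def power_divide pos_divide_le_eq)
          then show "\<bar>X n k\<bar> \<le> \<delta>" using \<delta> abs_le_square_iff[of "X n k" \<delta>] by simp
        qed
      qed
    qed
    have X_sq: "(\<lambda>n. \<Sum>k<n. (X n k)\<^sup>2) \<longlonglongrightarrow> \<tau>2"
      using elim(1) by (simp add: X_def e_def z_def power_divide sum_divide_distrib)
    have avg: "(\<lambda>n. (\<Sum>k<n. quad_term (e k, z k)) / real n) \<longlonglongrightarrow> 0"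
      "(\<lambda>n. (\<Sum>k<n. \<bar>quad_term (e k, z k)\<bar>) / real n) \<longlonglongrightarrow> expectation (\<lambda>\<omega>. \<bar>quad_term (\<epsilon> 0 \<omega>, Z 0 \<omega>)\<bar>)"
      "(\<lambda>n. (\<Sum>k<n. (weight (z k))\<^sup>2) / real n) \<longlonglongrightarrow> expectation (\<lambda>\<omega>. (weight (Z 0 \<omega>))\<^sup>2)"
      "(\<lambda>n. (\<Sum>k<n. \<phi> (e k) * (weight (z k))\<^sup>2) / real n) \<longlonglongrightarrow> expectation (\<lambda>\<omega>. \<phi> (\<epsilon> 0 \<omega>) * (weight (Z 0 \<omega>))\<^sup>2)"
      using elim(2-5) by (simp_all only: e_def z_def)
    have w0: "0 \<le> weight (z k)" for k by (simp add: weight_def)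
    note R = array_remainder[OF avg less_imp_le[OF \<phi>_pos] w0 r E_bound]
    have "(\<lambda>n. (\<Sum>k<n. ln (1 + X n k + E n k)) - (\<Sum>k<n. X n k)) \<longlonglongrightarrow> - \<tau>2 / 2"
      by (rule sum_ln_expansion[OF X_max X_sq R(1) R(2) R(3)])
    moreover have "(\<Sum>k<n. ln (1 + X n k + E n k)) = loglik_ratio f \<epsilon> Z scale G S h h' n \<omega>" for n
    proof -
      have "1 + X n k + E n k = loc_scale f (e k) (a n k) (1 + c n k) / f (e k)" for k
      proof -
        have "1 + t + (w - 1 - t) = w" for t w :: real by simp
        then show ?thesis unfolding E_def .
      qed
      then show ?thesis
        by (simp only: loglik_ratio_def Let_def sum_int_interval powr_minus_half a_def c_def e_def z_def)
    qed
    moreover have "(\<Sum>k<n. X n k) = central_seq f \<epsilon> Z scale G S h h' n \<omega>" for n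
      by (simp add: central_seq_eq X_def e_def z_def sum_divide_distrib)
    ultimately show ?case by simp
  qed
qed

theorem local_asymptotic_normality:
  "o_P_one M (\<lambda>n \<omega>. loglik_ratio f \<epsilon> Z scale G S h h' n \<omega>
     - (central_seq f \<epsilon> Z scale G S h h' n \<omega> - \<tau>2 / 2))
   \<and> conv_in_distr M (central_seq f \<epsilon> Z scale G S h h') (normal_law 0 \<tau>2)"
proof (intro conjI o_P_one_if_AE_tendsto central_seq_conv_in_distr)
  show "AE \<omega> in M. (\<lambda>n. loglik_ratio f \<epsilon> Z scale G S h h' n \<omega>
     - (central_seq f \<epsilon> Z scale G S h h' n \<omega> - \<tau>2 / 2)) \<longlonglongrightarrow> 0"
    using loglik_ratio_AE_expansion
  proof eventually_elim
    case (elim \<omega>)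
    have "x - (y - t) = x - y + t" for x y t :: real by simp
    moreover have "- \<tau>2 / 2 + \<tau>2 / 2 = 0" by simp
    ultimately show ?case using tendsto_add[OF elim tendsto_const[of "\<tau>2 / 2"]] by (simp only:)
  qed
qed (rule borel_measurable_diff[OF loglik_ratio_measurable borel_measurable_diff[OF central_seq_measurable borel_measurable_const]])

end

theorem theorem2p1:
  fixes M :: "'w measure"
    and Y \<epsilon> :: "int \<Rightarrow> 'w \<Rightarrow> real"
    and X :: "int \<Rightarrow> 'w \<Rightarrow> real ^ ('d::finite)"
    and Z :: "int \<Rightarrow> 'w \<Rightarrow> 'd regr"
    and s q :: nat
    and f :: "real \<Rightarrow> real"
    and m :: "real ^ ('l::finite) \<Rightarrow> 'd regr \<Rightarrow> real"
    and \<sigma> :: "real ^ ('p::finite) \<Rightarrow> 'd regr \<Rightarrow> real"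
    and \<Theta>\<^sub>1 :: "(real ^ 'l) set" and \<Theta>\<^sub>2 :: "(real ^ 'p) set"
    and \<rho>\<^sub>0 :: "real ^ 'l" and \<theta>\<^sub>0 :: "real ^ 'p"
    and G S :: "'d regr \<Rightarrow> real"
    and h h' :: real
  assumes prob: "prob_space M"
    and Z_eq: "Z = regressor s q Y X"
    \<comment> \<open>observations\<close>
    and stationary: "stationary_process M borel (\<lambda>i \<omega>. (Y i \<omega>, X i \<omega>))"
    and ergodic: "ergodic_process M borel (\<lambda>i \<omega>. (Y i \<omega>, X i \<omega>))"
    and moments_Y: "integrable M (\<lambda>\<omega>. \<bar>Y 0 \<omega>\<bar> ^ 2)" "integrable M (\<lambda>\<omega>. \<bar>Y 0 \<omega>\<bar> ^ 3)"
    and moments_X: "integrable M (\<lambda>\<omega>. norm (X 0 \<omega>) ^ 2)" "integrable M (\<lambda>\<omega>. norm (X 0 \<omega>) ^ 3)"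
    \<comment> \<open>innovations\<close>
    and eps_indep: "prob_space.indep_vars M (\<lambda>_. borel) \<epsilon> UNIV"
    and eps_density: "\<And>i. distributed M lborel (\<epsilon> i) (\<lambda>x. ennreal (f x))"
    and f_pos: "\<And>x. 0 < f x"
    and eps_centred: "\<And>i. has_bochner_integral M (\<epsilon> i) 0"
    and eps_variance: "\<And>i. has_bochner_integral M (\<lambda>\<omega>. (\<epsilon> i \<omega>)\<^sup>2) 1"
    and eps_past: "\<And>i. prob_space.indep_set M (sigma_rv M (\<epsilon> i)) (sigma_past M (regr_space s q) Z i)"
    and eps_past_no_lag: "\<And>i. s = 0 \<Longrightarrow>
      prob_space.indep_set M (sigma_rv M (\<epsilon> i)) (sigma_past_innov M (regr_space s q) Z \<epsilon> i)"
    \<comment> \<open>regression and scale functions\<close>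
    and Theta1: "interior \<Theta>\<^sub>1 \<noteq> {}" "\<rho>\<^sub>0 \<in> \<Theta>\<^sub>1"
    and Theta2: "interior \<Theta>\<^sub>2 \<noteq> {}" "\<theta>\<^sub>0 \<in> \<Theta>\<^sub>2"
    and m_meas: "\<And>\<rho>. \<rho> \<in> \<Theta>\<^sub>1 \<Longrightarrow> m \<rho> \<in> borel_measurable (regr_space s q)"
    and sigma_meas: "\<And>\<theta>. \<theta> \<in> \<Theta>\<^sub>2 \<Longrightarrow> \<sigma> \<theta> \<in> borel_measurable (regr_space s q)"
    and sigma_pos: "\<And>\<theta> z. \<theta> \<in> \<Theta>\<^sub>2 \<Longrightarrow> z \<in> space (regr_space s q) \<Longrightarrow> 0 < \<sigma> \<theta> z"
    and G_meas: "G \<in> borel_measurable (regr_space s q)"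
    and S_meas: "S \<in> borel_measurable (regr_space s q)"
    \<comment> \<open>null hypothesis; positivity of the scale under the local alternatives\<close>
    and H0: "\<And>i. AE \<omega> in M. Y i \<omega> = m \<rho>\<^sub>0 (Z i \<omega>) + \<sigma> \<theta>\<^sub>0 (Z i \<omega>) * \<epsilon> i \<omega>"
    and hh': "h * h' \<noteq> 0"
    and H1_scale_pos: "\<And>n z. n \<ge> 1 \<Longrightarrow> z \<in> space (regr_space s q) \<Longrightarrow>
      0 < \<sigma> \<theta>\<^sub>0 z + h' * real n powr (- 1 / 2) * S z"
    \<comment> \<open>regularity\<close>
    and f_diff: "\<And>x. f differentiable (at x)"
    and score_diff: "\<And>x. score f differentiable (at x)"
    and A1_1: "assumption_A1_1 M f (\<epsilon> 0)"
    and A1_2: "assumption_A1_2 M f (\<epsilon> 0)"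
    and A2: "assumption_A2 M f (\<epsilon> 0)"
    and A3: "assumption_A3 M f (\<epsilon> 0) (Z 0) (\<sigma> \<theta>\<^sub>0) G S"
  shows "o_P_one M (\<lambda>n \<omega>. loglik_ratio f \<epsilon> Z (\<sigma> \<theta>\<^sub>0) G S h h' n \<omega>
             - (central_seq f \<epsilon> Z (\<sigma> \<theta>\<^sub>0) G S h h' n \<omega>
                - lan_variance M f (\<epsilon> 0) (Z 0) (\<sigma> \<theta>\<^sub>0) G S h h' / 2))
    \<and> conv_in_distr M (central_seq f \<epsilon> Z (\<sigma> \<theta>\<^sub>0) G S h h')
        (normal_law 0 (lan_variance M f (\<epsilon> 0) (Z 0) (\<sigma> \<theta>\<^sub>0) G S h h'))"
proof -
  interpret prob_space M by (rule prob)
  have eps_measurable: "\<epsilon> i \<in> borel_measurable M" for i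
    using distributed_measurable[OF eps_density[of i]] by simp
  interpret lan_model M Y \<epsilon> X Z s q "m \<rho>\<^sub>0" "\<sigma> \<theta>\<^sub>0" f G S h h'
  proof unfold_locales
    show "0 < \<sigma> \<theta>\<^sub>0 z" if "z \<in> space (regr_space s q)" for z
      using sigma_pos[OF Theta2(2) that] .
    show "0 < \<sigma> \<theta>\<^sub>0 z + h' * real n powr (- 1 / 2) * S z"
      if "n \<ge> 1" "z \<in> space (regr_space s q)" for n z
      using H1_scale_pos[OF that] .
    show "indep_set (sigma_rv M (\<epsilon> i)) (sigma_past_innov M (regr_space s q) Z \<epsilon> i)" if "s = 0" for i
      using eps_past_no_lag[OF that] .
  qed (use Theta1(2) Theta2(2) in \<open>auto intro: Z_eq stationary ergodic eps_measurable eps_past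
      m_meas sigma_meas H0 f_pos f_diff score_diff G_meas S_meas A1_2 A2 A3\<close>)
  show ?thesis by (rule local_asymptotic_normality)
qed

end
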